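(* Let $\Gamma$ be a discrete cocompact subgroup of $\mathrm{Isom}^+(\mathbb{D})$. Let $\mathrm{HQD}(\mathbb{D},\Gamma)$ be the vector space of $\Gamma$-invariant holomorphic quadratic differentials on $\mathbb{D}$ and let $\mathfrak{g}$ be the space of Killing vector fields on $\mathbb{D}$. Then the mapping $$\varPhi:\mathrm{HQD}(\mathbb{D},\Gamma)\to H^1(\Gamma;\mathfrak{g}),\qquad q\mapsto[c],\quad c=\delta\chi,$$ is an injective mapping, where $\chi$ is a harmonic vector field on $\mathbb{D}$ with $(\mathcal{L}_\chi\mathbf{g}_{\mathbb{D}})^{(2,0)}=q$ admitting an $L^2$-extension to $\overline{\mathbb{D}}$ whose restriction to $\mathbb{S}^1$ is tangential.
   Context: $\mathbb{D}=\{|z|<1\}$ carries $\mathbf{g}_{\mathbb{D}}=4(dx^2+dy^2)/(1-|z|^2)^2$; $\mathrm{Isom}^+(\mathbb{D})$ is its group of orientation preserving isometries. Vector fields are identified with $\mathbb{C}$-valued functions. A quadratic differential $q=f\,dz^2$ is $\Gamma$-invariant if $f(\gamma(z))\gamma'(z)^2=f(z)$ for all $\gamma\in\Gamma$, $z\in\mathbb{D}$. For $q\in\mathrm{HQD}(\mathbb{D},\Gamma)$ such a $\chi$ exists and is unique up to addition of Killing vector fields, and $\delta\chi$ is a $1$-cocycle with values in $\mathfrak{g}$ whose class depends only on $q$. Harmonic vector field: for a smooth map $\phi:U\to \mathbb{D}$ from an open set $U\subseteq \mathbb{D}$, the tension field is $\tau(\phi)=\mathrm{trace}(\nabla d\phi)$,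 with $\nabla$ the connection on $T^*U\otimes\phi^{-1}T\mathbb{D}$ induced by the Levi-Civita connections. A smooth vector field $\xi$ on $U$ is harmonic if there is a smooth family of smooth maps $\phi_t:U\to \mathbb{D}$, $t\in[0,\epsilon)$, such that $\phi_0$ is the inclusion, $\frac{d\phi_t}{dt}|_{t=0}=\xi$, and $\frac{d}{dt}|_{t=0}\tau(\phi_t)(x)=0$ for all $x\in U$ (computed in the standard coordinates of $\mathbb{C}$). $(2,0)$-part: the trace-free part of the Lie derivative $\mathcal{L}_\xi\mathbf{g}_{\mathbb{D}}$ can be written uniquely as the real part of $h\,dz^2$ with $h$ complex-valued, and $(\mathcal{L}_\xi\mathbf{g}_{\mathbb{D}})^{(2,0)}:=h\,dz^2$. $L^2$-extension: a continuous vector field $X$ on $\mathbb{D}$ has an $L^2$-extension to $\overline{\mathbb{D}}$ if the vector fields $X_\epsilon(z)=X((1-\epsilon)z)$ on $\mathbb{S}^1$ converge as $\epsilon\to0$ in the Hilbert space of $L^2$-vector fields ($\mathbb{C}$-valued functions) on $\mathbb{S}^1$; the limit is the restriction of the extension to $\mathbb{S}^1$. An $L^2$-vector field on $\mathbb{S}^1$ is tangential if it is of the form $z\mapsto f(z)\,iz$ with $f$ real-valued. Cohomology: $\Gamma$ acts on vector fields on $\mathbb{D}$ by $(\gamma^*F)(z)=F(\gamma(z))\gamma'(z)^{-1}$. A $1$-cocycle is a map $c:\Gamma\to\mathfrak{g}$ with $c_{\gamma_1\circ\gamma_2}=\gamma_2^*c_{\gamma_1}+c_{\gamma_2}$; the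 coboundary of a vector field $F$ is $\delta F:\gamma\mapsto\gamma^*F-F$; $H^1(\Gamma;\mathfrak{g})$ is the space of $\mathfrak{g}$-valued cocycles modulo coboundaries of elements of $\mathfrak{g}$. *)

theory Defs
  imports "HOL-Analysis.Analysis" "HOL-Algebra.Bij"
begin

section \<open>Smooth maps\<close>

text \<open>\<open>Ck_on\<close> is meant for open sets.\<close>

primrec Ck_on :: "nat \<Rightarrow> 'a::euclidean_space set \<Rightarrow> ('a \<Rightarrow> 'b::real_normed_vector) \<Rightarrow> bool" where
  "Ck_on 0 S f \<longleftrightarrow> continuous_on S f"
| "Ck_on (Suc k) S f \<longleftrightarrow>
     (\<forall>x\<in>S. f differentiable (at x)) \<and> (\<forall>v. Ck_on k S (\<lambda>x. frechet_derivative f (at x) v))"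

text \<open>
  On an arbitrary set (such as \<open>{0..<\<epsilon>} \<times> U\<close>) a map is smooth if near every point of the set it
  agrees with a smooth map defined on an open neighbourhood.
\<close>

definition smooth_on :: "'a::euclidean_space set \<Rightarrow> ('a \<Rightarrow> 'b::real_normed_vector) \<Rightarrow> bool" where
  "smooth_on S f \<longleftrightarrow>
     (\<forall>x\<in>S. \<exists>W g. open W \<and> x \<in> W \<and> (\<forall>k. Ck_on k W g) \<and> (\<forall>y\<in>W \<inter> S. f y = g y))"


section \<open>The hyperbolic disc\<close>

abbreviation disc :: "complex set" where
  "disc \<equiv> ball 0 1"

definition hyp_metric :: "complex \<Rightarrow> complex \<Rightarrow> complex \<Rightarrow> real" where
  "hyp_metric z v w = 4 * (v \<bullet> w) / (1 - (norm z)\<^sup>2)\<^sup>2"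

text \<open>
  The basis \<open>{1, \<i>}\<close> of \<open>\<complex>\<close> is orthogonal for the metric, so rescaling it gives an orthonormal basis.
\<close>

definition hyp_trace :: "complex \<Rightarrow> (complex \<Rightarrow> complex \<Rightarrow> 'b::real_vector) \<Rightarrow> 'b" where
  "hyp_trace z T = (\<Sum>e\<in>Basis. (1 / hyp_metric z e e) *\<^sub>R T e e)"

text \<open>The Levi-Civita connection applied to constant vector fields, given by the Koszul formula.\<close>

definition christoffel :: "complex \<Rightarrow> complex \<Rightarrow> complex \<Rightarrow> complex" where
  "christoffel z v w = (THE u. \<forall>e. hyp_metric z u e =
     (frechet_derivative (\<lambda>x. hyp_metric x w e) (at z) v
      + frechet_derivative (\<lambda>x. hyp_metric x v e) (at z) w
      - frechet_derivative (\<lambda>x. hyp_metric x v w) (at z) e) / 2)"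

definition cov_hessian :: "(complex \<Rightarrow> complex) \<Rightarrow> complex \<Rightarrow> complex \<Rightarrow> complex \<Rightarrow> complex" where
  "cov_hessian \<phi> z v w =
     frechet_derivative (\<lambda>x. frechet_derivative \<phi> (at x) w) (at z) v
     - frechet_derivative \<phi> (at z) (christoffel z v w)
     + christoffel (\<phi> z) (frechet_derivative \<phi> (at z) v) (frechet_derivative \<phi> (at z) w)"

definition tension :: "(complex \<Rightarrow> complex) \<Rightarrow> complex \<Rightarrow> complex" where
  "tension \<phi> z = hyp_trace z (cov_hessian \<phi> z)"


section \<open>Vector fields\<close>

definition harmonic_field_on :: "complex set \<Rightarrow> (complex \<Rightarrow> complex) \<Rightarrow> bool" where
  "harmonic_field_on U \<xi> \<longleftrightarrow> smooth_on U \<xi> \<and>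
     (\<exists>\<epsilon>>0. \<exists>\<phi> :: real \<Rightarrow> complex \<Rightarrow> complex.
        smooth_on ({0..<\<epsilon>} \<times> U) (\<lambda>(t, z). \<phi> t z) \<and>
        (\<forall>t\<in>{0..<\<epsilon>}. \<phi> t ` U \<subseteq> disc) \<and>
        (\<forall>z\<in>U. \<phi> 0 z = z) \<and>
        (\<forall>z\<in>U. ((\<lambda>t. \<phi> t z) has_vector_derivative \<xi> z) (at 0 within {0..<\<epsilon>})) \<and>
        (\<forall>z\<in>U. ((\<lambda>t. tension (\<phi> t) z) has_vector_derivative 0) (at 0 within {0..<\<epsilon>})))"

text \<open>The Lie derivative of the metric along \<open>\<xi>\<close>, evaluated on constant vector fields.\<close>

definition lie_metric :: "(complex \<Rightarrow> complex) \<Rightarrow> complex \<Rightarrow> complex \<Rightarrow> complex \<Rightarrow> real" where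
  "lie_metric \<xi> z v w =
     frechet_derivative (\<lambda>x. hyp_metric x v w) (at z) (\<xi> z)
     + hyp_metric z (frechet_derivative \<xi> (at z) v) w
     + hyp_metric z v (frechet_derivative \<xi> (at z) w)"

definition trace_free_part ::
    "complex \<Rightarrow> (complex \<Rightarrow> complex \<Rightarrow> real) \<Rightarrow> complex \<Rightarrow> complex \<Rightarrow> real" where
  "trace_free_part z T v w = T v w - hyp_trace z T / 2 * hyp_metric z v w"

text \<open>The coefficient \<open>h\<close> of the quadratic differential \<open>h dz\<^sup>2\<close>.\<close>

definition lie_metric_20 :: "(complex \<Rightarrow> complex) \<Rightarrow> complex \<Rightarrow> complex" where
  "lie_metric_20 \<xi> z =
     (THE h. \<forall>v w. trace_free_part z (lie_metric \<xi> z) v w = Re (h * v * w))"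

text \<open>
  Objects living on the disc that have to form a set of functions (Killing fields, quadratic
  differentials, isometries) are made \<open>undefined\<close> off the disc, so that equality of functions is
  equality on the disc.
\<close>

definition killing :: "(complex \<Rightarrow> complex) set" where
  "killing = {X \<in> extensional disc. smooth_on disc X \<and> (\<forall>z\<in>disc. \<forall>v w. lie_metric X z v w = 0)}"


section \<open>Isometries\<close>

text \<open>
  For real-linear \<open>L :: complex \<Rightarrow> complex\<close>, the number \<open>Im (cnj (L 1) * L \<i>)\<close> is the determinant
  of \<open>L\<close>.
\<close>

definition isom_plus :: "(complex \<Rightarrow> complex) set" where
  "isom_plus = {\<gamma> \<in> Bij disc. smooth_on disc \<gamma> \<and>
     (\<forall>z\<in>disc. let L = frechet_derivative \<gamma> (at z) in
        (\<forall>v w. hyp_metric (\<gamma> z) (L v) (L w) = hyp_metric z v w) \<and> Im (cnj (L 1) * L \<i>) > 0)}"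

definition isom_plus_group :: "(complex \<Rightarrow> complex) monoid" where
  "isom_plus_group = (BijGroup disc)\<lparr>carrier := isom_plus\<rparr>"

text \<open>The compact-open topology.\<close>

definition isom_plus_topology :: "(complex \<Rightarrow> complex) topology" where
  "isom_plus_topology = topology_generated_by
     {{\<gamma> \<in> isom_plus. \<gamma> ` K \<subseteq> V} | K V. compact K \<and> K \<subseteq> disc \<and> open V}"

definition discrete_subset :: "(complex \<Rightarrow> complex) set \<Rightarrow> bool" where
  "discrete_subset \<Gamma> \<longleftrightarrow> subtopology isom_plus_topology \<Gamma> = discrete_topology \<Gamma>"

definition orbit_of :: "(complex \<Rightarrow> complex) set \<Rightarrow> complex \<Rightarrow> complex set" where
  "orbit_of \<Gamma> z = (\<lambda>\<gamma>. \<gamma> z) ` \<Gamma>"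

definition orbit_space :: "(complex \<Rightarrow> complex) set \<Rightarrow> complex set topology" where
  "orbit_space \<Gamma> = topology (\<lambda>U. U \<subseteq> orbit_of \<Gamma> ` disc \<and>
     openin (top_of_set disc) {z \<in> disc. orbit_of \<Gamma> z \<in> U})"

lemma openin_orbit_space:
  "openin (orbit_space \<Gamma>) U \<longleftrightarrow>
     U \<subseteq> orbit_of \<Gamma> ` disc \<and> openin (top_of_set disc) {z \<in> disc. orbit_of \<Gamma> z \<in> U}"
proof -
  define P where "P U \<longleftrightarrow> U \<subseteq> orbit_of \<Gamma> ` disc \<and>
    openin (top_of_set disc) {z \<in> disc. orbit_of \<Gamma> z \<in> U}" for U
  have "P (S \<inter> T)" if "P S" "P T" for S T
  proof -
    have "{z \<in> disc. orbit_of \<Gamma> z \<in> S \<inter> T} =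
      {z \<in> disc. orbit_of \<Gamma> z \<in> S} \<inter> {z \<in> disc. orbit_of \<Gamma> z \<in> T}" by blast
    then show ?thesis
      using that unfolding P_def by (metis (no_types, lifting) le_infI1 openin_Int)
  qed
  moreover have "P (\<Union>\<K>)" if "\<forall>K\<in>\<K>. P K" for \<K>
  proof -
    have "{z \<in> disc. orbit_of \<Gamma> z \<in> \<Union>\<K>} = (\<Union>K\<in>\<K>. {z \<in> disc. orbit_of \<Gamma> z \<in> K})" by blast
    moreover have "openin (top_of_set disc) (\<Union>K\<in>\<K>. {z \<in> disc. orbit_of \<Gamma> z \<in> K})"
      using that unfolding P_def by (intro openin_Union) blast
    ultimately show ?thesis using that unfolding P_def by auto
  qed
  ultimately have "istopology P" unfolding istopology_def by blast
  then have "openin (topology P) = P" by (rule topology_inverse')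
  moreover have "orbit_space \<Gamma> = topology P" unfolding orbit_space_def P_def ..
  ultimately show ?thesis unfolding P_def by simp
qed

definition cocompact :: "(complex \<Rightarrow> complex) set \<Rightarrow> bool" where
  "cocompact \<Gamma> \<longleftrightarrow> compact_space (orbit_space \<Gamma>)"

text \<open>A quadratic differential \<open>f dz\<^sup>2\<close> is represented by its coefficient \<open>f\<close>.\<close>

definition HQD :: "(complex \<Rightarrow> complex) set \<Rightarrow> (complex \<Rightarrow> complex) set" where
  "HQD \<Gamma> = {f \<in> extensional disc. f holomorphic_on disc \<and>
     (\<forall>\<gamma>\<in>\<Gamma>. \<forall>z\<in>disc. f (\<gamma> z) * (deriv \<gamma> z)\<^sup>2 = f z)}"


section \<open>Cohomology\<close>

definition pull_field :: "(complex \<Rightarrow> complex) \<Rightarrow> (complex \<Rightarrow> complex) \<Rightarrow> complex \<Rightarrow> complex" where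
  "pull_field \<gamma> F z = F (\<gamma> z) * inverse (deriv \<gamma> z)"

definition cocycles ::
    "(complex \<Rightarrow> complex) set \<Rightarrow> ((complex \<Rightarrow> complex) \<Rightarrow> complex \<Rightarrow> complex) set" where
  "cocycles \<Gamma> = {c \<in> \<Gamma> \<rightarrow>\<^sub>E killing. \<forall>\<gamma>\<^sub>1\<in>\<Gamma>. \<forall>\<gamma>\<^sub>2\<in>\<Gamma>. \<forall>z\<in>disc.
     c (\<gamma>\<^sub>1 \<otimes>\<^bsub>isom_plus_group\<^esub> \<gamma>\<^sub>2) z = pull_field \<gamma>\<^sub>2 (c \<gamma>\<^sub>1) z + c \<gamma>\<^sub>2 z}"

definition coboundary ::
    "(complex \<Rightarrow> complex) set \<Rightarrow> (complex \<Rightarrow> complex) \<Rightarrow> (complex \<Rightarrow> complex) \<Rightarrow> complex \<Rightarrow> complex" where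
  "coboundary \<Gamma> F = (\<lambda>\<gamma>\<in>\<Gamma>. \<lambda>z\<in>disc. pull_field \<gamma> F z - F z)"

definition cohomologous ::
    "(complex \<Rightarrow> complex) set \<Rightarrow>
     (((complex \<Rightarrow> complex) \<Rightarrow> complex \<Rightarrow> complex) \<times> ((complex \<Rightarrow> complex) \<Rightarrow> complex \<Rightarrow> complex)) set" where
  "cohomologous \<Gamma> = {(c, c'). c \<in> cocycles \<Gamma> \<and> c' \<in> cocycles \<Gamma> \<and>
     (\<exists>K\<in>killing. \<forall>\<gamma>\<in>\<Gamma>. \<forall>z\<in>disc. c \<gamma> z - c' \<gamma> z = coboundary \<Gamma> K \<gamma> z)}"

definition H1 ::
    "(complex \<Rightarrow> complex) set \<Rightarrow> ((complex \<Rightarrow> complex) \<Rightarrow> complex \<Rightarrow> complex) set set" where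
  "H1 \<Gamma> = cocycles \<Gamma> // cohomologous \<Gamma>"

definition cohomology_class ::
    "(complex \<Rightarrow> complex) set \<Rightarrow> ((complex \<Rightarrow> complex) \<Rightarrow> complex \<Rightarrow> complex) \<Rightarrow>
     ((complex \<Rightarrow> complex) \<Rightarrow> complex \<Rightarrow> complex) set" where
  "cohomology_class \<Gamma> c = cohomologous \<Gamma> `` {c}"


section \<open>Boundary values\<close>

text \<open>Arc length on the unit circle.\<close>

definition circle_measure :: "complex measure" where
  "circle_measure =
     distr (restrict_space lborel {0..<2 * pi}) (restrict_space borel (sphere 0 1)) cis"

definition has_L2_extension :: "(complex \<Rightarrow> complex) \<Rightarrow> (complex \<Rightarrow> complex) \<Rightarrow> bool" where
  "has_L2_extension X Y \<longleftrightarrow> continuous_on disc X \<and>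
     Y \<in> borel_measurable circle_measure \<and>
     (\<integral>\<^sup>+ z. ennreal ((norm (Y z))\<^sup>2) \<partial>circle_measure) < \<infinity> \<and>
     ((\<lambda>\<epsilon>::real. \<integral>\<^sup>+ z. ennreal ((norm (X ((1 - of_real \<epsilon>) * z) - Y z))\<^sup>2) \<partial>circle_measure)
        \<longlongrightarrow> 0) (at_right 0)"

definition tangential :: "(complex \<Rightarrow> complex) \<Rightarrow> bool" where
  "tangential Y \<longleftrightarrow> (\<exists>f :: complex \<Rightarrow> real. AE z in circle_measure. Y z = of_real (f z) * (\<i> * z))"


section \<open>The map from quadratic differentials to cohomology\<close>

definition solves :: "(complex \<Rightarrow> complex) \<Rightarrow> (complex \<Rightarrow> complex) \<Rightarrow> bool" where
  "solves q X \<longleftrightarrow> harmonic_field_on disc X \<and> (\<forall>z\<in>disc. lie_metric_20 X z = q z) \<and>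
     (\<exists>Y. has_L2_extension X Y \<and> tangential Y)"

definition Phi ::
    "(complex \<Rightarrow> complex) set \<Rightarrow> (complex \<Rightarrow> complex) \<Rightarrow>
     ((complex \<Rightarrow> complex) \<Rightarrow> complex \<Rightarrow> complex) set" where
  "Phi \<Gamma> q = cohomology_class \<Gamma> (coboundary \<Gamma> (SOME X. solves q X))"

end

(*
  In Wirtinger terms (L_X g)^(2,0) = q says dbar X = rho^2 cnj q / 8 with rho = 1 - |z|^2. If F''' = q, then
  chi_F = (rho^2 cnj F'' + 2 z rho cnj F' + 2 z^2 cnj F - 2 F) / 8 solves this equation and is harmonic.
  By cocompactness |q| rho^2 is bounded, so F extends continuously to the closed disc while rho^2 F'' and
  rho F' tend to 0, and chi_F becomes tangential on the circle.

  Two solutions differ by a holomorphic field X whose radial component Re (cnj z X) tends to 0 in mean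
  square. The Fourier coefficients of the radial component force X = a + i b z - cnj a z^2, and these are
  exactly the Killing fields. Isometries are Moebius maps and preserve the vanishing of the radial
  component, so the coboundary of a solution is Killing-valued.

  Injectivity: if two solutions have cohomologous coboundaries, their difference minus a Killing field is a
  Gamma-invariant field X, hence |X| / rho is bounded. Then X - chi_F and i X - chi_(-i F) are both Killing,
  and eliminating X shows that F is a quadratic polynomial, so q = F''' = 0.
*)
theory Submission
  imports Defs "HOL-Complex_Analysis.Complex_Analysis"
begin


section \<open>Smooth maps\<close>

text \<open>The boundary condition is posed in the mean over circles about 0. An isometry does not
  permute these circles, so it cannot simply be transported by \<open>pull_field\<close>. Vanishing
  of the radial part along \<open>at_boundary\<close> is uniform in the angle and does transport,
  but only for bounded fields, because the pullback mixes in \<open>rho\<close> times the whole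
  field. Hence the shape of the proof: uniqueness holds in the weak L2 class, existence is proved in
  the strong class, and comparing an arbitrary solution with chi_F upgrades it to a bounded field
  with uniformly vanishing radial part. The second obstacle is that harmonicity asks for a jointly
  smooth family of maps into the disc. Once such a family is built, its linearised tension field
  reduces to the statement that dbar X / rho^2 has zero derivative in z, that is, to holomorphy of
  q.\<close>

lemma frechet_derivative_eq:
  "(f has_derivative f') (at x) \<Longrightarrow> frechet_derivative f (at x) v = f' v"
  using frechet_derivative_at by metis

lemma has_derivative_cong_open:
  assumes "open S" "x \<in> S" "\<And>y. y \<in> S \<Longrightarrow> f y = g y"
  shows "(f has_derivative f') (at x) \<longleftrightarrow> (g has_derivative f') (at x)"
  using assms by (metis has_derivative_transform_within_open)

lemma frechet_derivative_cong_open: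
  assumes "open S" "x \<in> S" "\<And>y. y \<in> S \<Longrightarrow> f y = g y"
  shows "frechet_derivative f (at x) = frechet_derivative g (at x)"
  unfolding frechet_derivative_def
  using has_derivative_cong_open[OF assms] by simp

lemma differentiable_cong_open:
  assumes "open S" "x \<in> S" "\<And>y. y \<in> S \<Longrightarrow> f y = g y"
  shows "f differentiable (at x) \<longleftrightarrow> g differentiable (at x)"
  unfolding differentiable_def using has_derivative_cong_open[OF assms] by simp

lemma Ck_on_cong:
  assumes "open S" "\<And>y. y \<in> S \<Longrightarrow> f y = g y"
  shows "Ck_on k S f \<longleftrightarrow> Ck_on k S g"
  using assms(2)
proof (induction k arbitrary: f g)
  case 0
  then show ?case by (simp cong: continuous_on_cong)
next
  case (Suc k)
  have "f differentiable (at x) \<longleftrightarrow> g differentiable (at x)" if "x \<in> S" for x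
    using differentiable_cong_open[OF assms(1) that] Suc.prems by blast
  moreover have "Ck_on k S (\<lambda>x. frechet_derivative f (at x) v) \<longleftrightarrow>
      Ck_on k S (\<lambda>x. frechet_derivative g (at x) v)" for v
    by (rule Suc.IH) (metis frechet_derivative_cong_open[OF assms(1)] Suc.prems)
  ultimately show ?case by simp
qed

lemma Ck_on_subset:
  "Ck_on k S f \<Longrightarrow> T \<subseteq> S \<Longrightarrow> Ck_on k T f"
proof (induction k arbitrary: f)
  case 0
  then show ?case by (auto intro: continuous_on_subset)
next
  case (Suc k)
  then show ?case by (auto simp: subset_iff)
qed

lemma Ck_on_mono: "Ck_on (Suc k) S f \<Longrightarrow> Ck_on k S f"
proof (induction k arbitrary: f)
  case 0
  then show ?case
    by (simp add: continuous_at_imp_continuous_on differentiable_imp_continuous_within)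
next
  case (Suc k)
  then show ?case by simp
qed

lemma Ck_on_Suc_has_derivative:
  "Ck_on (Suc k) S f \<Longrightarrow> x \<in> S \<Longrightarrow> (f has_derivative frechet_derivative f (at x)) (at x)"
  using frechet_derivative_works by auto

lemma Ck_on_const: "Ck_on k S (\<lambda>x. c)"
  by (induction k arbitrary: c) auto

lemma Ck_on_bounded_linear:
  assumes "bounded_linear L"
  shows "Ck_on k S L"
proof (cases k)
  case 0
  then show ?thesis using assms by (simp add: linear_continuous_on)
next
  case (Suc j)
  have "(L has_derivative L) (at x)" for x
    using assms bounded_linear_imp_has_derivative by blast
  then have "L differentiable (at x)" "frechet_derivative L (at x) = L" for x
    by (auto simp: differentiable_def frechet_derivative_at[symmetric])
  then show ?thesis using Suc by (simp add: Ck_on_const)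
qed

lemma Ck_on_linear_compose:
  assumes "bounded_linear L" "open S" "Ck_on k S f"
  shows "Ck_on k S (\<lambda>x. L (f x))"
  using assms(3)
proof (induction k arbitrary: f)
  case 0
  then show ?case using assms(1) by (simp add: linear_continuous_on_compose[unfolded comp_def]
    bounded_linear.continuous_on)
next
  case (Suc k)
  have d: "((\<lambda>x. L (f x)) has_derivative (\<lambda>v. L (frechet_derivative f (at x) v))) (at x)"
    if "x \<in> S" for x
    using Ck_on_Suc_has_derivative[OF Suc.prems that] bounded_linear.has_derivative[OF assms(1)]
    by blast
  have "Ck_on k S (\<lambda>x. frechet_derivative (\<lambda>x. L (f x)) (at x) v)" for v
    using Suc.IH[of "\<lambda>x. frechet_derivative f (at x) v"] Suc.prems
    by (subst Ck_on_cong[OF assms(2)]) (auto simp: frechet_derivative_eq[OF d])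
  then show ?case using d by (auto simp: differentiable_def)
qed

lemma Ck_on_add:
  assumes "open S" "Ck_on k S f" "Ck_on k S g"
  shows "Ck_on k S (\<lambda>x. f x + g x)"
  using assms(2,3)
proof (induction k arbitrary: f g)
  case 0
  then show ?case by (simp add: continuous_on_add)
next
  case (Suc k)
  have d: "((\<lambda>x. f x + g x) has_derivative
      (\<lambda>v. frechet_derivative f (at x) v + frechet_derivative g (at x) v)) (at x)"
    if "x \<in> S" for x
    by (intro has_derivative_add Ck_on_Suc_has_derivative[OF Suc.prems(1) that]
        Ck_on_Suc_has_derivative[OF Suc.prems(2) that])
  have "Ck_on k S (\<lambda>x. frechet_derivative (\<lambda>x. f x + g x) (at x) v)" for v
    using Suc.IH[of "\<lambda>x. frechet_derivative f (at x) v" "\<lambda>x. frechet_derivative g (at x) v"]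
      Suc.prems
    by (subst Ck_on_cong[OF assms(1)]) (auto simp: frechet_derivative_eq[OF d])
  then show ?case using d by (auto simp: differentiable_def)
qed

lemma Ck_on_mult:
  fixes f g :: "'a::euclidean_space \<Rightarrow> 'b::real_normed_algebra"
  assumes "open S" "Ck_on k S f" "Ck_on k S g"
  shows "Ck_on k S (\<lambda>x. f x * g x)"
  using assms(2,3)
proof (induction k arbitrary: f g)
  case 0
  then show ?case by (simp add: continuous_on_mult)
next
  case (Suc k)
  have d: "((\<lambda>x. f x * g x) has_derivative
      (\<lambda>v. f x * frechet_derivative g (at x) v + frechet_derivative f (at x) v * g x)) (at x)"
    if "x \<in> S" for x
    by (intro has_derivative_mult Ck_on_Suc_has_derivative[OF Suc.prems(1) that]
        Ck_on_Suc_has_derivative[OF Suc.prems(2) that])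
  have "Ck_on k S (\<lambda>x. f x * frechet_derivative g (at x) v + frechet_derivative f (at x) v * g x)" for v
    using Suc.prems by (intro Ck_on_add[OF assms(1)] Suc.IH Ck_on_mono[of k S f]
      Ck_on_mono[of k S g]) simp_all
  then have "Ck_on k S (\<lambda>x. frechet_derivative (\<lambda>x. f x * g x) (at x) v)" for v
    by (subst Ck_on_cong[OF assms(1)]) (auto simp: frechet_derivative_eq[OF d])
  then show ?case using d by (auto simp: differentiable_def)
qed

lemma Ck_on_minus: "open S \<Longrightarrow> Ck_on k S f \<Longrightarrow> Ck_on k S (\<lambda>x. - f x)"
  using Ck_on_linear_compose[of uminus S k f] bounded_linear_minus[OF bounded_linear_ident] by auto

lemma Ck_on_diff:
  "open S \<Longrightarrow> Ck_on k S f \<Longrightarrow> Ck_on k S g \<Longrightarrow> Ck_on k S (\<lambda>x. f x - g x)"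
  using Ck_on_add[of S k f "\<lambda>x. - g x"] Ck_on_minus[of S k g] by simp

lemma Ck_on_inverse:
  fixes f :: "'a::euclidean_space \<Rightarrow> 'b::real_normed_div_algebra"
  assumes "open S" "Ck_on k S f" "\<And>x. x \<in> S \<Longrightarrow> f x \<noteq> 0"
  shows "Ck_on k S (\<lambda>x. inverse (f x))"
  using assms(2)
proof (induction k)
  case 0
  then show ?case using assms by (simp add: continuous_on_inverse)
next
  case (Suc k)
  have d: "((\<lambda>x. inverse (f x)) has_derivative
      (\<lambda>v. - (inverse (f x) * frechet_derivative f (at x) v * inverse (f x)))) (at x)"
    if "x \<in> S" for x
    using Deriv.has_derivative_inverse[OF assms(3)[OF that] Ck_on_Suc_has_derivative[OF Suc.prems that]]
    by simp
  have "Ck_on k S (\<lambda>x. inverse (f x))"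
    by (rule Suc.IH[OF Ck_on_mono[OF Suc.prems]])
  then have "Ck_on k S (\<lambda>x. - (inverse (f x) * frechet_derivative f (at x) v * inverse (f x)))" for v
    using Suc.prems
    by (intro Ck_on_minus Ck_on_mult assms(1)) auto
  then have "Ck_on k S (\<lambda>x. frechet_derivative (\<lambda>x. inverse (f x)) (at x) v)" for v
    by (subst Ck_on_cong[OF assms(1)]) (auto simp: frechet_derivative_eq[OF d])
  then show ?case using d by (auto simp: differentiable_def)
qed

lemma Ck_on_holomorphic:
  assumes "open S" "f holomorphic_on S"
  shows "Ck_on k S f"
  using assms(2)
proof (induction k arbitrary: f)
  case 0
  then show ?case by (simp add: holomorphic_on_imp_continuous_on)
next
  case (Suc k)
  have d: "(f has_derivative (\<lambda>v. deriv f x * v)) (at x)" if "x \<in> S" for x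
    using holomorphic_derivI[OF Suc.prems assms(1) that]
    by (simp add: has_field_derivative_def)
  have "Ck_on k S (\<lambda>x. deriv f x * v)" for v
    by (intro Ck_on_mult Ck_on_const assms Suc.IH holomorphic_deriv Suc.prems)
  then have "Ck_on k S (\<lambda>x. frechet_derivative f (at x) v)" for v
    by (subst Ck_on_cong[OF assms(1)]) (auto simp: frechet_derivative_eq[OF d])
  then show ?case using d by (auto simp: differentiable_def)
qed

lemma Ck_on_compose_snd:
  fixes f :: "'a::euclidean_space \<Rightarrow> 'b::real_normed_vector"
  assumes "open S" "Ck_on k S f"
  shows "Ck_on k ((UNIV :: 'c::euclidean_space set) \<times> S) (\<lambda>p. f (snd p))"
  using assms(2)
proof (induction k arbitrary: f)
  case 0
  then show ?case by (auto intro!: continuous_on_compose2[of S f _ snd] continuous_intros)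
next
  case (Suc k)
  have d: "((\<lambda>p. f (snd p)) has_derivative (\<lambda>v. frechet_derivative f (at (snd p)) (snd v))) (at p)"
    if "p \<in> (UNIV :: 'c set) \<times> S" for p
  proof -
    have "(f has_derivative frechet_derivative f (at (snd p))) (at (snd p))"
      using Ck_on_Suc_has_derivative[OF Suc.prems, of "snd p"] that by auto
    from has_derivative_compose[OF has_derivative_snd[OF has_derivative_ident] this]
    show ?thesis .
  qed
  have o: "open ((UNIV :: 'c set) \<times> S)" using assms(1) by (simp add: open_Times)
  have "Ck_on k ((UNIV :: 'c set) \<times> S) (\<lambda>x. frechet_derivative (\<lambda>p. f (snd p)) (at x) v)" for v
    using Suc.IH[of "\<lambda>x. frechet_derivative f (at x) (snd v)"] Suc.prems
    by (subst Ck_on_cong[OF o, where g="\<lambda>p. frechet_derivative f (at (snd p)) (snd v)"])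
       (auto simp: frechet_derivative_eq[OF d])
  then show ?case using d unfolding Ck_on.simps differentiable_def by blast
qed

text \<open>The local extensions in \<open>smooth_on\<close> vary with the point, whereas
  \<open>Ck_on\<close> differentiates one function throughout. The induction therefore runs over
  \<open>C\<close>, the local version of \<open>Ck_on\<close>, which passes to directional
  derivatives on the same neighbourhood.\<close>

lemma smooth_on_open_iff:
  assumes "open S"
  shows "smooth_on S f \<longleftrightarrow> (\<forall>k. Ck_on k S f)"
proof
  assume "\<forall>k. Ck_on k S f"
  then show "smooth_on S f" unfolding smooth_on_def using assms by blast
next
  assume s: "smooth_on S f"
  define C where "C k g \<longleftrightarrow> (\<forall>x\<in>S. \<exists>W. open W \<and> x \<in> W \<and> W \<subseteq> S \<and> Ck_on k W g)"
    for k and g :: "'a \<Rightarrow> 'b"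
  have *: "Ck_on k S g" if "C k g" for k g
    using that
  proof (induction k arbitrary: g)
    case 0
    have "continuous (at x) g" if x: "x \<in> S" for x
    proof -
      obtain W where W: "open W" "x \<in> W" "Ck_on 0 W g" using 0 x unfolding C_def by blast
      then show ?thesis by (simp add: continuous_on_eq_continuous_at)
    qed
    then show ?case by (simp add: continuous_at_imp_continuous_on)
  next
    case (Suc k)
    have W: "\<exists>W. open W \<and> x \<in> W \<and> W \<subseteq> S \<and> (\<forall>y\<in>W. g differentiable at y) \<and>
        (\<forall>v. Ck_on k W (\<lambda>x. frechet_derivative g (at x) v))" if "x \<in> S" for x
      using Suc.prems that unfolding C_def Ck_on.simps by blast
    have "g differentiable at x" if "x \<in> S" for x
      using W[OF that] by blast
    moreover have "C k (\<lambda>x. frechet_derivative g (at x) v)" for v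
      unfolding C_def using W by metis
    ultimately show ?case using Suc.IH unfolding Ck_on.simps by blast
  qed
  have "C k f" for k
    unfolding C_def
  proof
    fix x assume "x \<in> S"
    then obtain W g where W: "open W" "x \<in> W" "\<forall>k. Ck_on k W g" "\<forall>y\<in>W \<inter> S. f y = g y"
      using s unfolding smooth_on_def by meson
    have "Ck_on k (W \<inter> S) g" using W(3) Ck_on_subset by blast
    then have "Ck_on k (W \<inter> S) f"
      using Ck_on_cong[of "W \<inter> S" f g k] W(1,4) assms by (simp add: open_Int)
    then show "\<exists>W. open W \<and> x \<in> W \<and> W \<subseteq> S \<and> Ck_on k W f"
      using W assms \<open>x \<in> S\<close> by (intro exI[of _ "W \<inter> S"]) auto
  qed
  then show "\<forall>k. Ck_on k S f" using * by blast
qed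

lemma smooth_on_subset_extension:
  assumes "open W" "T \<subseteq> W" "\<And>k. Ck_on k W g"
  shows "smooth_on T g"
  unfolding smooth_on_def using assms by (metis subset_iff)

text \<open>A variation is smooth jointly in time and position, while its tension field
  differentiates in position at fixed time. Trading that derivative for a joint one in direction
  \<open>(0, v)\<close> makes its continuity in \<open>t\<close> available.\<close>

lemma frechet_derivative_slice:
  fixes H :: "'a::euclidean_space \<times> 'b::euclidean_space \<Rightarrow> 'c::real_normed_vector"
  assumes "H differentiable (at (t, z))"
  shows "frechet_derivative (\<lambda>z. H (t, z)) (at z) v = frechet_derivative H (at (t, z)) (0, v)"
    and "(\<lambda>z. H (t, z)) differentiable (at z)"
proof -
  have "(H has_derivative frechet_derivative H (at (t, z))) (at (t, z))"
    using assms frechet_derivative_works by blast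
  moreover have "((\<lambda>z. (t, z)) has_derivative (\<lambda>v. (0, v))) (at z)"
    by (auto intro!: derivative_eq_intros)
  ultimately have "((\<lambda>z. H (t, z)) has_derivative (\<lambda>v. frechet_derivative H (at (t, z)) (0, v))) (at z)"
    using has_derivative_compose by fastforce
  then show "frechet_derivative (\<lambda>z. H (t, z)) (at z) v = frechet_derivative H (at (t, z)) (0, v)"
    and "(\<lambda>z. H (t, z)) differentiable (at z)"
    by (auto simp: frechet_derivative_eq differentiable_def)
qed


section \<open>Wirtinger derivatives\<close>

text \<open>The numbers \<open>a\<close> and \<open>b\<close> are the derivatives with respect to z
  and cnj z, and \<open>b = 0\<close> is the Cauchy-Riemann equation. As a relation at one point, it
  lets both derivatives be computed by unification.\<close>

definition has_wirtinger :: "(complex \<Rightarrow> complex) \<Rightarrow> complex \<Rightarrow> complex \<Rightarrow> complex \<Rightarrow> bool" where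
  "has_wirtinger f a b z \<longleftrightarrow> (f has_derivative (\<lambda>v. a * v + b * cnj v)) (at z)"

lemma has_wirtinger_cong_open:
  assumes "open S" "z \<in> S" "\<And>y. y \<in> S \<Longrightarrow> f y = g y"
  shows "has_wirtinger f a b z \<longleftrightarrow> has_wirtinger g a b z"
  unfolding has_wirtinger_def by (rule has_derivative_cong_open[OF assms])

lemma differentiable_imp_has_wirtinger:
  assumes "f differentiable (at z)"
  obtains a b where "has_wirtinger f a b z"
proof -
  obtain D where D: "(f has_derivative D) (at z)" using assms by (auto simp: differentiable_def)
  interpret linear D using D has_derivative_linear by blast
  \<comment> \<open>The usual combinations of the two partial derivatives, forced by evaluation at 1
    and \<open>\<i>\<close>.\<close>
  have e: "D v = (D 1 - \<i> * D \<i>) / 2 * v + (D 1 + \<i> * D \<i>) / 2 * cnj v" for v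
  proof -
    have v: "v = Re v *\<^sub>R 1 + Im v *\<^sub>R \<i>"
      by (simp add: complex_eq_iff)
    have "D v = Re v *\<^sub>R D 1 + Im v *\<^sub>R D \<i>"
      using add[of "Re v *\<^sub>R 1" "Im v *\<^sub>R \<i>"] scale v by metis
    then show ?thesis
      by (simp add: complex_eq_iff field_simps)
  qed
  define p q where "p = (D 1 - \<i> * D \<i>) / 2" and "q = (D 1 + \<i> * D \<i>) / 2"
  have "D = (\<lambda>v. p * v + q * cnj v)" using e unfolding p_def q_def by blast
  then have "has_wirtinger f p q z"
    unfolding has_wirtinger_def using D by metis
  then show ?thesis using that by blast
qed

lemma has_wirtinger_0_iff: "has_wirtinger f a 0 z \<longleftrightarrow> (f has_field_derivative a) (at z)"
  by (simp add: has_wirtinger_def has_field_derivative_def)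

lemma has_wirtinger_const: "has_wirtinger (\<lambda>z. c) 0 0 z"
  by (simp add: has_wirtinger_0_iff)

lemma has_wirtinger_ident: "has_wirtinger (\<lambda>z. z) 1 0 z"
  by (simp add: has_wirtinger_0_iff)

lemma has_wirtinger_add:
  "has_wirtinger f a b z \<Longrightarrow> has_wirtinger g c d z \<Longrightarrow> has_wirtinger (\<lambda>z. f z + g z) (a + c) (b + d) z"
  unfolding has_wirtinger_def by (auto dest: has_derivative_add simp: algebra_simps)

lemma has_wirtinger_minus:
  "has_wirtinger f a b z \<Longrightarrow> has_wirtinger (\<lambda>z. - f z) (- a) (- b) z"
  unfolding has_wirtinger_def by (auto dest: has_derivative_minus simp: algebra_simps)

lemma has_wirtinger_diff:
  "has_wirtinger f a b z \<Longrightarrow> has_wirtinger g c d z \<Longrightarrow> has_wirtinger (\<lambda>z. f z - g z) (a - c) (b - d) z"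
  using has_wirtinger_add[of f a b z "\<lambda>z. - g z" "- c" "- d"] has_wirtinger_minus[of g c d z] by simp

lemma has_wirtinger_mult:
  assumes "has_wirtinger f a b z" "has_wirtinger g c d z"
  shows "has_wirtinger (\<lambda>z. f z * g z) (f z * c + a * g z) (f z * d + b * g z) z"
  using has_derivative_mult[OF assms[unfolded has_wirtinger_def]]
  unfolding has_wirtinger_def by (simp add: algebra_simps)

lemma has_wirtinger_cnj:
  assumes "has_wirtinger f a b z"
  shows "has_wirtinger (\<lambda>z. cnj (f z)) (cnj b) (cnj a) z"
  using bounded_linear.has_derivative[OF bounded_linear_cnj assms[unfolded has_wirtinger_def]]
  unfolding has_wirtinger_def by (simp add: algebra_simps)

text \<open>A holomorphic inner map does not mix the two derivatives. This gives the transformation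
  law of dbar X under isometries.\<close>

lemma has_wirtinger_compose_holomorphic:
  assumes "(g has_field_derivative g') (at z)" "has_wirtinger f a b (g z)"
  shows "has_wirtinger (\<lambda>z. f (g z)) (a * g') (b * cnj g') z"
proof -
  have "(g has_derivative (\<lambda>v. g' * v)) (at z)"
    using assms(1) by (simp add: has_field_derivative_def)
  from has_derivative_compose[OF this assms(2)[unfolded has_wirtinger_def]]
  show ?thesis unfolding has_wirtinger_def by (simp add: algebra_simps)
qed

lemmas has_wirtinger_intros =
  has_wirtinger_const has_wirtinger_ident has_wirtinger_add has_wirtinger_minus
  has_wirtinger_diff has_wirtinger_mult has_wirtinger_cnj

lemma has_wirtinger_imp_differentiable: "has_wirtinger f a b z \<Longrightarrow> f differentiable (at z)"
  unfolding has_wirtinger_def differentiable_def by blast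

lemma has_wirtinger_imp_continuous_on:
  "(\<And>z. z \<in> S \<Longrightarrow> \<exists>a b. has_wirtinger f a b z) \<Longrightarrow> continuous_on S f"
  by (meson has_wirtinger_imp_differentiable differentiable_imp_continuous_within
      continuous_at_imp_continuous_on)


section \<open>Boundary uniqueness\<close>

text \<open>On the unit circle \<open>cnj z * X z\<close> has the normal component of X as real part
  and the tangential one as imaginary part.\<close>

definition radial :: "(complex \<Rightarrow> complex) \<Rightarrow> complex \<Rightarrow> real" where
  "radial X z = Re (cnj z * X z)"

text \<open>A substitute for a tangential L2 boundary value that mentions no boundary field; it is
  stable under differences and is what the Fourier argument consumes.\<close>

definition L2_tangential :: "(complex \<Rightarrow> complex) \<Rightarrow> bool" where
  "L2_tangential X \<longleftrightarrow>
     ((\<lambda>r. integral {0..2*pi} (\<lambda>t. (radial X (of_real r * cis t))\<^sup>2)) \<longlongrightarrow> 0) (at_left 1)"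

text \<open>Cauchy's formula for the k-th derivative, read as a Fourier coefficient: the factor
  \<open>r ^ k / \<i>\<close> turns dz / z^(k+1) into the weight exp(-ikt) dt.\<close>

lemma circle_mean_derivative:
  fixes f :: "complex \<Rightarrow> complex"
  assumes f: "f holomorphic_on disc" and r: "0 < r" "r < 1"
  shows "((\<lambda>t. f (of_real r * cis t) * cis (- (real k * t))) has_integral
           (2 * pi * of_real r ^ k * ((deriv ^^ k) f 0 / fact k))) {0..2*pi}"
proof -
  have "((\<lambda>u. f u / (u - 0) ^ Suc k) has_contour_integral
      ((2 * pi * \<i>) / fact k * (deriv ^^ k) f 0)) (circlepath 0 r)"
  proof (rule Cauchy_has_contour_integral_higher_derivative_circlepath)
    show "continuous_on (cball 0 r) f"
      using holomorphic_on_imp_continuous_on[OF f] r by (elim continuous_on_subset) auto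
    show "f holomorphic_on ball 0 r"
      using f r by (elim holomorphic_on_subset) auto
  qed (use r in auto)
  then have "((\<lambda>t. f (of_real r * cis t) / (of_real r * cis t) ^ Suc k * r * \<i> * cis t) has_integral
      ((2 * pi * \<i>) / fact k * (deriv ^^ k) f 0)) {0..2*pi}"
    unfolding circlepath_def by (subst (asm) has_contour_integral_part_circlepath_iff) auto
  then have "((\<lambda>t. (of_real r ^ k / \<i>) * (f (of_real r * cis t) / (of_real r * cis t) ^ Suc k * r * \<i> * cis t))
      has_integral (of_real r ^ k / \<i>) * ((2 * pi * \<i>) / fact k * (deriv ^^ k) f 0)) {0..2*pi}"
    by (rule has_integral_mult_right)
  moreover have "(of_real r ^ k / \<i>) * (f (of_real r * cis t) / (of_real r * cis t) ^ Suc k * r * \<i> * cis t)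
      = f (of_real r * cis t) * cis (- (real k * t))" for t
  proof -
    have "(cis t) ^ k * cis (- (real k * t)) = 1"
      by (simp add: Complex.DeMoivre cis_mult)
    then have "cis (- (real k * t)) = 1 / cis t ^ k"
      by (simp add: field_simps)
    then show ?thesis using r by (simp add: field_simps power_mult_distrib)
  qed
  moreover have "(of_real r ^ k / \<i>) * ((2 * pi * \<i>) / fact k * (deriv ^^ k) f 0) =
      2 * pi * of_real r ^ k * ((deriv ^^ k) f 0 / fact k)"
    by (simp add: field_simps)
  ultimately show ?thesis by simp
qed

text \<open>Multiplying by z^m moves the mode to frequency zero, where the mean value property sees
  only the value at 0.\<close>

lemma circle_mean_positive_mode:
  fixes f :: "complex \<Rightarrow> complex"
  assumes f: "f holomorphic_on disc" and r: "0 < r" "r < 1"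
  shows "((\<lambda>t. f (of_real r * cis t) * cis (real m * t)) has_integral
           (2 * pi * (if m = 0 then f 0 else 0))) {0..2*pi}"
proof -
  have "((\<lambda>t. (f (of_real r * cis t) * (of_real r * cis t) ^ m) * cis (- (real 0 * t))) has_integral
      (2 * pi * of_real r ^ 0 * ((deriv ^^ 0) (\<lambda>z. f z * z ^ m) 0 / fact 0))) {0..2*pi}"
    by (rule circle_mean_derivative[OF _ r]) (intro holomorphic_intros f)
  then have "((\<lambda>t. (1 / of_real r ^ m) * ((f (of_real r * cis t) * (of_real r * cis t) ^ m) * cis (- (real 0 * t)))) has_integral
      (1 / of_real r ^ m) * (2 * pi * of_real r ^ 0 * ((deriv ^^ 0) (\<lambda>z. f z * z ^ m) 0 / fact 0))) {0..2*pi}"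
    by (rule has_integral_mult_right)
  then show ?thesis
    using r by (cases "m = 0") (simp_all add: power_mult_distrib Complex.DeMoivre mult.assoc power_0_left)
qed

lemma radial_continuous_on_circle:
  assumes "continuous_on disc X" "0 < r" "r < 1"
  shows "continuous_on A (\<lambda>t. radial X (of_real r * cis t))"
proof -
  have "continuous_on A (\<lambda>t. X (of_real r * cis t))"
    using assms by (intro continuous_on_compose2[OF assms(1)] continuous_intros)
      (auto simp: norm_mult)
  then show ?thesis unfolding radial_def by (intro continuous_intros)
qed

text \<open>An L2 norm bounds every Fourier coefficient. Instead of Cauchy-Schwarz for integrals,
  the pointwise inequality x \<le> d/2 + x^2/(2d) is integrated, with \<open>d\<close> adapted to
  the accuracy wanted.\<close>

lemma L2_tangential_coeff_tendsto_0:
  assumes c: "continuous_on disc X" and T: "L2_tangential X"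
  shows "((\<lambda>r. integral {0..2*pi} (\<lambda>t. of_real (radial X (of_real r * cis t)) * cis (- (real m * t))))
           \<longlongrightarrow> 0) (at_left 1)"
proof (rule tendstoI)
  fix e :: real assume e: "e > 0"
  \<comment> \<open>The two contributions are pi d < 4 d and less than d/2, which together stay
    below 5 d.\<close>
  define d where "d = e / 5"
  have d: "d > 0" using e by (simp add: d_def)
  define J where "J r = integral {0..2*pi} (\<lambda>t. (radial X (of_real r * cis t))\<^sup>2)" for r
  have "\<forall>\<^sub>F r in at_left 1. J r < d\<^sup>2"
    using T d unfolding L2_tangential_def J_def[symmetric]
    by (auto intro: order_tendstoD)
  moreover have "\<forall>\<^sub>F r in at_left (1::real). 0 < r \<and> r < 1"
    using eventually_at_left_real[of 0 "1::real"] by (auto elim: eventually_mono)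
  ultimately show "\<forall>\<^sub>F r in at_left 1. dist (integral {0..2*pi}
      (\<lambda>t. of_real (radial X (of_real r * cis t)) * cis (- (real m * t)))) 0 < e"
  proof eventually_elim
    case (elim r)
    have cr: "continuous_on {0..2*pi} (\<lambda>t. radial X (of_real r * cis t))"
      by (rule radial_continuous_on_circle) (use c elim in auto)
    have "norm (integral {0..2*pi} (\<lambda>t. of_real (radial X (of_real r * cis t)) * cis (- (real m * t))))
        \<le> integral {0..2*pi} (\<lambda>t. d / 2 + (1 / (2 * d)) * (radial X (of_real r * cis t))\<^sup>2)"
    proof (rule integral_norm_bound_integral)
      show "(\<lambda>t. of_real (radial X (of_real r * cis t)) * cis (- (real m * t))) integrable_on {0..2*pi}"
        by (intro integrable_continuous_real continuous_intros cr)
      show "(\<lambda>t. d / 2 + (1 / (2 * d)) * (radial X (of_real r * cis t))\<^sup>2) integrable_on {0..2*pi}"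
        by (intro integrable_continuous_real continuous_intros cr)
      fix t
      define x where "x = \<bar>radial X (of_real r * cis t)\<bar>"
      have "0 \<le> (x - d)\<^sup>2" by simp
      then have "2 * d * x \<le> d\<^sup>2 + x\<^sup>2" by (simp add: power2_eq_square algebra_simps)
      then have "x \<le> d / 2 + (1 / (2 * d)) * x\<^sup>2"
        using d by (simp add: field_simps power2_eq_square)
      then show "norm (of_real (radial X (of_real r * cis t)) * cis (- (real m * t)))
          \<le> d / 2 + (1 / (2 * d)) * (radial X (of_real r * cis t))\<^sup>2"
        by (simp add: norm_mult x_def)
    qed
    also have "\<dots> = integral {0..2*pi} (\<lambda>t. d / 2) + integral {0..2*pi} (\<lambda>t. (1 / (2 * d)) * (radial X (of_real r * cis t))\<^sup>2)"
      by (intro integral_add integrable_continuous_real continuous_intros cr)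
    also have "\<dots> = pi * d + (1 / (2 * d)) * J r"
      by (simp add: J_def)
    also have "\<dots> < 4 * d + (1 / (2 * d)) * d\<^sup>2"
      using elim d pi_less_4 by (intro add_strict_mono mult_strict_right_mono mult_strict_left_mono) auto
    also have "\<dots> < e" using d by (simp add: power2_eq_square d_def field_simps)
    finally show ?case by simp
  qed
qed

text \<open>Twice the radial part is r times the sum of \<open>cis (- t) * X\<close> and its
  conjugate. The first summand contributes the Taylor coefficient of order m + 1; the conjugate one
  pairs X with \<open>cis ((m - 1) * t)\<close>, which is visible only for m = 0 and m = 1, whence
  the exceptional cases.\<close>

lemma holomorphic_radial_coeff:
  assumes f: "X holomorphic_on disc" and r: "0 < r" "r < 1"
  defines "c \<equiv> \<lambda>n. (deriv ^^ n) X 0 / fact n"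
  shows "integral {0..2*pi} (\<lambda>t. of_real (radial X (of_real r * cis t)) * cis (- (real m * t))) =
    pi * r * (r ^ (m + 1) * c (m + 1) + (if m = 0 then r * cnj (c 1) else if m = 1 then cnj (c 0) else 0))"
proof -
  \<comment> \<open>The mean of X against \<open>cis ((m - 1) * t)\<close>; the subtraction is real,
    so m = 0 gives frequency -1 and picks out \<open>c 1\<close>.\<close>
  define B where "B = (if m = 0 then 2 * pi * (r * c 1) else 2 * pi * (if m = 1 then c 0 else 0))"
  have A: "((\<lambda>t. X (of_real r * cis t) * cis (- (real (m + 1) * t))) has_integral
           (2 * pi * of_real r ^ (m + 1) * c (m + 1))) {0..2*pi}"
    unfolding c_def by (rule circle_mean_derivative[OF f r])
  have "((\<lambda>t. X (of_real r * cis t) * cis ((real m - 1) * t)) has_integral B) {0..2*pi}"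
  proof (cases m)
    case 0
    then show ?thesis
      using circle_mean_derivative[OF f r, of 1] by (simp add: B_def c_def mult.assoc)
  next
    case (Suc k)
    then show ?thesis
      using circle_mean_positive_mode[OF f r, of k] by (cases k) (simp_all add: B_def c_def)
  qed
  then have "((\<lambda>t. cnj (X (of_real r * cis t) * cis ((real m - 1) * t))) has_integral cnj B) {0..2*pi}"
    using has_integral_cnj[of "\<lambda>t. X (of_real r * cis t) * cis ((real m - 1) * t)" B] by (simp add: comp_def)
  from has_integral_mult_right[OF has_integral_add[OF A this], of "of_real r / 2"]
  have "((\<lambda>t. of_real r / 2 * (X (of_real r * cis t) * cis (- (real (m + 1) * t)) +
      cnj (X (of_real r * cis t) * cis ((real m - 1) * t)))) has_integral
      of_real r / 2 * (2 * pi * of_real r ^ (m + 1) * c (m + 1) + cnj B)) {0..2*pi}" .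
  moreover have "of_real r / 2 * (X (of_real r * cis t) * cis (- (real (m + 1) * t)) +
      cnj (X (of_real r * cis t) * cis ((real m - 1) * t))) =
      of_real (radial X (of_real r * cis t)) * cis (- (real m * t))" for t
  proof -
    define w where "w = X (of_real r * cis t)"
    have e1: "cis (- (real (m + 1) * t)) = cis (- t) * cis (- (real m * t))"
      by (simp add: cis_mult algebra_simps)
    have e2: "cnj (cis ((real m - 1) * t)) = cis t * cis (- (real m * t))"
      by (simp add: cis_cnj cis_mult algebra_simps)
    have eq: "complex_of_real (radial X (of_real r * cis t)) = of_real r * (cis (- t) * w + cnj (cis (- t) * w)) / 2"
      by (simp add: radial_def w_def complex_eq_iff algebra_simps)
    show ?thesis
      unfolding e1 w_def[symmetric] complex_cnj_mult e2 eq
      by (simp add: cis_cnj algebra_simps)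
  qed
  ultimately have "((\<lambda>t. of_real (radial X (of_real r * cis t)) * cis (- (real m * t))) has_integral
      of_real r / 2 * (2 * pi * of_real r ^ (m + 1) * c (m + 1) + cnj B)) {0..2*pi}"
    by simp
  then have "integral {0..2*pi} (\<lambda>t. of_real (radial X (of_real r * cis t)) * cis (- (real m * t))) =
      of_real r / 2 * (2 * pi * of_real r ^ (m + 1) * c (m + 1) + cnj B)"
    by (rule integral_unique)
  then show ?thesis by (simp add: B_def algebra_simps)
qed

text \<open>The Fourier coefficients are polynomials in r, so their limit 0 is their value at r = 1.
  Frequency 0 gives Re c_1 = 0, frequency 1 gives c_2 = - cnj c_0, and every higher frequency kills
  one Taylor coefficient.\<close>

theorem holomorphic_L2_tangential_quadratic:
  assumes f: "X holomorphic_on disc" and T: "L2_tangential X"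
  obtains a :: complex and b :: real where
    "\<And>z. z \<in> disc \<Longrightarrow> X z = a + \<i> * b * z - cnj a * z\<^sup>2"
proof -
  define c where "c n = (deriv ^^ n) X 0 / fact n" for n
  define G where "G m r = pi * complex_of_real r * (of_real r ^ (m + 1) * c (m + 1) +
    (if m = 0 then r * cnj (c 1) else if m = 1 then cnj (c 0) else 0))" for m r
  have lim: "(G m \<longlongrightarrow> 0) (at_left 1)" for m
  proof (rule Lim_transform_eventually[OF
        L2_tangential_coeff_tendsto_0[OF holomorphic_on_imp_continuous_on[OF f] T, of m]])
    have "\<forall>\<^sub>F r in at_left (1::real). 0 < r \<and> r < 1"
      using eventually_at_left_real[of 0 "1::real"] by (auto elim: eventually_mono)
    then show "\<forall>\<^sub>F r in at_left 1. integral {0..2*pi}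
        (\<lambda>t. of_real (radial X (of_real r * cis t)) * cis (- (real m * t))) = G m r"
    proof eventually_elim
      case (elim r)
      then show ?case
        using holomorphic_radial_coeff[OF f, of r m] unfolding G_def c_def by simp
    qed
  qed
  have "(G m \<longlongrightarrow> G m 1) (at_left 1)" for m
    unfolding G_def by (cases "m = 0") (auto intro!: tendsto_eq_intros)
  then have G1: "G m 1 = 0" for m
    using lim tendsto_unique trivial_limit_at_left_real by blast
  have g: "c (m + 1) + (if m = 0 then cnj (c 1) else if m = 1 then cnj (c 0) else 0) = 0" for m
    using G1[of m] unfolding G_def by auto
  have c1: "c 1 + cnj (c 1) = 0" using g[of 0] by simp
  have c2: "c 2 = - cnj (c 0)" using g[of 1] by (simp add: add_eq_0_iff numeral_2_eq_2)
  have cn: "c n = 0" if "n \<ge> 3" for n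
    using g[of "n - 1"] that by (auto split: if_splits)
  have "c 1 = \<i> * of_real (Im (c 1))"
    using c1 by (simp add: complex_eq_iff)
  moreover have "X z = c 0 + c 1 * z + c 2 * z\<^sup>2" if "z \<in> disc" for z
  proof -
    have "(\<lambda>n. c n * (z - 0) ^ n) sums X z"
      unfolding c_def by (rule holomorphic_power_series[OF f that])
    moreover have "(\<lambda>n. c n * (z - 0) ^ n) sums (\<Sum>n<3. c n * (z - 0) ^ n)"
      by (rule sums_finite) (auto simp: cn)
    ultimately have "X z = (\<Sum>n<3. c n * (z - 0) ^ n)" using sums_unique2 by blast
    then show ?thesis by (simp add: numeral_3_eq_3 numeral_2_eq_2)
  qed
  ultimately show ?thesis using c2 that[of "c 0" "Im (c 1)"] by (metis mult_minus_left diff_conv_add_uminus)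
qed


section \<open>Metric, tension field and Killing fields in coordinates\<close>

text \<open>The metric is 4 / rho^2 times the Euclidean one, and \<open>rho\<close> is the distance
  to the circle up to a factor between 1 and 2.\<close>

definition rho :: "complex \<Rightarrow> real" where
  "rho z = 1 - (norm z)\<^sup>2"

lemma rho_pos: "z \<in> disc \<Longrightarrow> rho z > 0"
  by (simp add: rho_def abs_square_less_1 power_less_one_iff)

lemma rho_of_real: "of_real (rho z) = 1 - z * cnj z"
  by (simp add: rho_def flip: complex_norm_square)

lemma hyp_metric_rho: "hyp_metric z v w = 4 * (v \<bullet> w) / (rho z)\<^sup>2"
  by (simp add: hyp_metric_def rho_def)

lemma rho_has_derivative: "(rho has_derivative (\<lambda>u. - 2 * (z \<bullet> u))) (at z)"
proof -
  have e: "rho = (\<lambda>z. 1 - z \<bullet> z)" by (auto simp: rho_def power2_norm_eq_inner)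
  show ?thesis unfolding e by (auto intro!: derivative_eq_intros simp: inner_commute)
qed

lemma hyp_metric_has_derivative:
  assumes "z \<in> disc"
  shows "((\<lambda>x. hyp_metric x v w) has_derivative (\<lambda>u. 16 * (v \<bullet> w) * (z \<bullet> u) / rho z ^ 3)) (at z)"
proof -
  have r: "rho z \<noteq> 0" using rho_pos[OF assms] by simp
  have "((\<lambda>x. 4 * (v \<bullet> w) / (rho x)\<^sup>2) has_derivative
      (\<lambda>u. 16 * (v \<bullet> w) * (z \<bullet> u) / rho z ^ 3)) (at z)"
    using r by (auto intro!: derivative_eq_intros rho_has_derivative
      simp: field_simps power2_eq_square power3_eq_cube)
  then show ?thesis by (simp add: hyp_metric_rho)
qed

lemma frechet_derivative_hyp_metric:
  assumes "z \<in> disc"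
  shows "frechet_derivative (\<lambda>x. hyp_metric x v w) (at z) u = 16 * (v \<bullet> w) * (z \<bullet> u) / rho z ^ 3"
  by (rule frechet_derivative_eq[OF hyp_metric_has_derivative[OF assms]])

text \<open>For exp(2u) times the Euclidean metric the connection is du(v) w + du(w) v - <v,w> grad
  u; here u = log (2 / rho), with gradient 2 z / rho.\<close>

lemma christoffel_eq:
  assumes "z \<in> disc"
  shows "christoffel z v w = (2 / rho z) *\<^sub>R ((z \<bullet> v) *\<^sub>R w + (z \<bullet> w) *\<^sub>R v - (v \<bullet> w) *\<^sub>R z)"
    (is "_ = ?u")
proof -
  have r: "rho z > 0" using rho_pos[OF assms] .
  have *: "(\<forall>e. hyp_metric z u e =
     (frechet_derivative (\<lambda>x. hyp_metric x w e) (at z) v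
      + frechet_derivative (\<lambda>x. hyp_metric x v e) (at z) w
      - frechet_derivative (\<lambda>x. hyp_metric x v w) (at z) e) / 2) \<longleftrightarrow> (\<forall>e. u \<bullet> e = ?u \<bullet> e)" for u
  proof (intro arg_cong[where f=All] ext)
    fix e
    have 1: "?u \<bullet> e = (rho z)\<^sup>2 / 4 * ((16 * (w \<bullet> e) * (z \<bullet> v) / rho z ^ 3
        + 16 * (v \<bullet> e) * (z \<bullet> w) / rho z ^ 3 - 16 * (v \<bullet> w) * (z \<bullet> e) / rho z ^ 3) / 2)"
      using r by (simp add: field_simps inner_add_left inner_diff_left power2_eq_square power3_eq_cube)
    have 2: "4 * x / (rho z)\<^sup>2 = y \<longleftrightarrow> x = (rho z)\<^sup>2 / 4 * y" for x y
      using r by (auto simp: field_simps)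
    show "(hyp_metric z u e =
     (frechet_derivative (\<lambda>x. hyp_metric x w e) (at z) v
      + frechet_derivative (\<lambda>x. hyp_metric x v e) (at z) w
      - frechet_derivative (\<lambda>x. hyp_metric x v w) (at z) e) / 2) \<longleftrightarrow> u \<bullet> e = ?u \<bullet> e"
      unfolding frechet_derivative_hyp_metric[OF assms] 1
      unfolding hyp_metric_rho 2 ..
  qed
  show ?thesis
    unfolding christoffel_def *
    by (rule the_equality) (blast, metis vector_eq_rdot)
qed

lemma hyp_trace_eq:
  fixes T :: "complex \<Rightarrow> complex \<Rightarrow> 'b::real_vector"
  shows "hyp_trace z T = ((rho z)\<^sup>2 / 4) *\<^sub>R (T 1 1 + T \<i> \<i>)"
  unfolding hyp_trace_def by (simp add: Basis_complex_def hyp_metric_rho scaleR_right_distrib)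

lemma tension_eq:
  assumes z: "z \<in> disc" and d: "\<phi> differentiable (at z)" and \<phi>: "\<phi> z \<in> disc"
  defines "D \<equiv> \<lambda>v. frechet_derivative \<phi> (at z) v"
  defines "D2 \<equiv> \<lambda>v. frechet_derivative (\<lambda>x. frechet_derivative \<phi> (at x) v) (at z) v"
  shows "tension \<phi> z = of_real ((rho z)\<^sup>2 / 4) *
    (D2 1 + D2 \<i> + 2 * cnj (\<phi> z) / of_real (rho (\<phi> z)) * ((D 1)\<^sup>2 + (D \<i>)\<^sup>2))"
proof -
  interpret linear D
    unfolding D_def using d linear_frechet_derivative by blast
  \<comment> \<open>In dimension two the connection of a conformal metric has zero trace, so the
    domain contributes only the flat Laplacian.\<close>
  have "christoffel z 1 1 + christoffel z \<i> \<i> = 0"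
    by (simp add: christoffel_eq[OF z] complex_eq_iff algebra_simps)
  then have g: "D (christoffel z 1 1) + D (christoffel z \<i> \<i>) = 0"
    using add[of "christoffel z 1 1" "christoffel z \<i> \<i>"] zero by simp
  \<comment> \<open>On the diagonal, 2 <z,v> v - |v|^2 z collapses to the complex product cnj z
    v^2.\<close>
  have c: "christoffel (\<phi> z) v v = cnj (\<phi> z) * v\<^sup>2 * 2 / of_real (rho (\<phi> z))" for v
    using rho_pos[OF \<phi>]
    by (simp add: christoffel_eq[OF \<phi>] complex_eq_iff inner_complex_def field_simps power2_eq_square)
  have "tension \<phi> z = ((rho z)\<^sup>2 / 4) *\<^sub>R (D2 1 - D (christoffel z 1 1) + christoffel (\<phi> z) (D 1) (D 1)
      + (D2 \<i> - D (christoffel z \<i> \<i>) + christoffel (\<phi> z) (D \<i>) (D \<i>)))"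
    unfolding tension_def hyp_trace_eq cov_hessian_def D_def D2_def ..
  also have "\<dots> = ((rho z)\<^sup>2 / 4) *\<^sub>R (D2 1 + D2 \<i> + (christoffel (\<phi> z) (D 1) (D 1) + christoffel (\<phi> z) (D \<i>) (D \<i>))
      - (D (christoffel z 1 1) + D (christoffel z \<i> \<i>)))"
    by (simp add: algebra_simps)
  also have "\<dots> = of_real ((rho z)\<^sup>2 / 4) *
    (D2 1 + D2 \<i> + 2 * cnj (\<phi> z) / of_real (rho (\<phi> z)) * ((D 1)\<^sup>2 + (D \<i>)\<^sup>2))"
    unfolding g c by (simp add: scaleR_conv_of_real algebra_simps add_divide_distrib)
  finally show ?thesis .
qed

text \<open>The terms in \<open>v \<bullet> w\<close> are conformal. The only trace-free
  contribution is the one with \<open>cnj b\<close>, so the (2,0)-part sees nothing of X but its cnj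
  z derivative.\<close>

lemma lie_metric_eq:
  assumes "z \<in> disc" "has_wirtinger X a b z"
  shows "lie_metric X z v w = 16 * (v \<bullet> w) * (z \<bullet> X z) / rho z ^ 3
    + (8 * Re a * (v \<bullet> w) + Re (8 * cnj b * v * w)) / (rho z)\<^sup>2"
proof -
  have f: "frechet_derivative X (at z) u = a * u + b * cnj u" for u
    using assms(2) unfolding has_wirtinger_def by (rule frechet_derivative_eq)
  have "lie_metric X z v w = 16 * (v \<bullet> w) * (z \<bullet> X z) / rho z ^ 3
      + 4 * ((a * v + b * cnj v) \<bullet> w + v \<bullet> (a * w + b * cnj w)) / (rho z)\<^sup>2"
    unfolding lie_metric_def f frechet_derivative_hyp_metric[OF assms(1)]
    unfolding hyp_metric_rho by (simp add: add_divide_distrib algebra_simps)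
  moreover have "4 * ((a * v + b * cnj v) \<bullet> w + v \<bullet> (a * w + b * cnj w)) =
      8 * Re a * (v \<bullet> w) + Re (8 * cnj b * v * w)"
    by (simp add: inner_complex_def algebra_simps)
  ultimately show ?thesis by simp
qed

lemma lie_metric_20_eq:
  assumes "z \<in> disc" "has_wirtinger X a b z"
  shows "lie_metric_20 X z = 8 * cnj b / of_real ((rho z)\<^sup>2)"
proof -
  have r: "rho z > 0" using rho_pos[OF assms(1)] .
  have t: "trace_free_part z (lie_metric X z) v w = Re (8 * cnj b / of_real ((rho z)\<^sup>2) * v * w)" for v w
  proof -
    have "Re (8 * cnj b / of_real ((rho z)\<^sup>2) * v * w) = Re (8 * cnj b * v * w) / (rho z)\<^sup>2"
      by (metis (no_types, lifting) Re_divide_of_real times_divide_eq_left)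
    then show ?thesis
      unfolding trace_free_part_def hyp_trace_eq lie_metric_eq[OF assms] hyp_metric_rho
      using r by (simp add: field_simps power2_eq_square power3_eq_cube)
  qed
  \<comment> \<open>Testing on (1, 1) and (1, \<open>\<i>\<close>) reads off the real and the
    imaginary part of \<open>h\<close>; this is the uniqueness that \<open>THE\<close> asks
    for.\<close>
  have "h = 8 * cnj b / of_real ((rho z)\<^sup>2)"
    if "\<forall>v w. Re (8 * cnj b / of_real ((rho z)\<^sup>2) * v * w) = Re (h * v * w)" for h
    using that[rule_format, of 1 1] that[rule_format, of 1 \<i>]
    by (simp add: complex_eq_iff)
  then show ?thesis
    unfolding lie_metric_20_def t by (intro the_equality) auto
qed

lemma lie_metric_20_iff:
  assumes "z \<in> disc" "has_wirtinger X a b z"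
  shows "lie_metric_20 X z = q \<longleftrightarrow> b = of_real ((rho z)\<^sup>2) * cnj q / 8"
proof -
  have r: "rho z \<noteq> 0" using rho_pos[OF assms(1)] by simp
  have "8 * cnj b / of_real ((rho z)\<^sup>2) = q \<longleftrightarrow> cnj (8 * cnj b) = cnj (q * of_real ((rho z)\<^sup>2))"
    unfolding complex_cnj_cancel_iff using r by (simp add: field_simps)
  then show ?thesis
    unfolding lie_metric_20_eq[OF assms] by (auto simp: field_simps)
qed

section \<open>Approach to the unit circle and Killing fields as polynomials\<close>

abbreviation at_boundary :: "complex filter" where
  "at_boundary \<equiv> filtercomap norm (at_left 1)"

lemma eventually_at_boundary:
  "eventually P at_boundary \<longleftrightarrow> (\<exists>d<1. \<forall>z. d < norm z \<and> norm z < 1 \<longrightarrow> P z)"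
proof -
  have 1: "eventually Q (at_left (1::real)) \<longleftrightarrow> (\<exists>d<1. \<forall>x. d < x \<and> x < 1 \<longrightarrow> Q x)" for Q
    using eventually_at_left[of 0 "1::real" Q] by auto
  show ?thesis
  proof
    assume "eventually P at_boundary"
    then obtain Q where Q: "eventually Q (at_left 1)" "\<And>z. Q (norm z) \<Longrightarrow> P z"
      unfolding eventually_filtercomap by blast
    then show "\<exists>d<1. \<forall>z. d < norm z \<and> norm z < 1 \<longrightarrow> P z" unfolding 1 by blast
  next
    assume "\<exists>d<1. \<forall>z. d < norm z \<and> norm z < 1 \<longrightarrow> P z"
    then have "eventually (\<lambda>r. \<forall>z. norm z = r \<longrightarrow> P z) (at_left 1)"
      unfolding 1 by blast
    then show "eventually P at_boundary"
      unfolding eventually_filtercomap by blast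
  qed
qed

lemma eventually_at_boundary_disc: "eventually (\<lambda>z. z \<in> disc) at_boundary"
  unfolding eventually_at_boundary by (intro exI[of _ 0]) auto

lemma rho_tendsto_boundary: "(rho \<longlongrightarrow> 0) at_boundary"
proof -
  have "((\<lambda>r::real. 1 - r\<^sup>2) \<longlongrightarrow> 1 - 1\<^sup>2) (at_left 1)"
    by (intro tendsto_intros)
  from filterlim_compose[OF this filterlim_filtercomap, of norm]
  show ?thesis unfolding rho_def[abs_def] by simp
qed

lemma vanishing_radial_imp_L2_tangential:
  assumes c: "continuous_on disc X" and v: "(radial X \<longlongrightarrow> 0) at_boundary"
  shows "L2_tangential X"
  unfolding L2_tangential_def
proof (rule tendstoI)
  fix e :: real assume e: "e > 0"
  \<comment> \<open>The unit circle has length 2 pi < 8, so a bound e/10 on the square integrates to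
    less than e.\<close>
  define s where "s = sqrt (e / 10)"
  have s: "s > 0" "s\<^sup>2 = e / 10" using e by (auto simp: s_def)
  have "eventually (\<lambda>z. norm (radial X z) < s) at_boundary"
    using v s(1) by (auto simp: tendsto_iff dist_norm)
  then obtain d where d: "d < 1" "\<And>z. d < norm z \<Longrightarrow> norm z < 1 \<Longrightarrow> \<bar>radial X z\<bar> < s"
    unfolding eventually_at_boundary by auto
  have "\<forall>\<^sub>F r in at_left (1::real). max d 0 < r \<and> r < 1"
    using eventually_at_left_real[of "max d 0" "1::real"] d(1) by (auto elim: eventually_mono)
  then show "\<forall>\<^sub>F r in at_left 1. dist (integral {0..2*pi} (\<lambda>t. (radial X (of_real r * cis t))\<^sup>2)) 0 < e"
  proof eventually_elim
    case (elim r)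
    have "norm (integral {0..2*pi} (\<lambda>t. (radial X (of_real r * cis t))\<^sup>2)) \<le> integral {0..2*pi} (\<lambda>t. e / 10)"
    proof (rule integral_norm_bound_integral)
      show "(\<lambda>t. (radial X (of_real r * cis t))\<^sup>2) integrable_on {0..2*pi}"
        using elim by (intro integrable_continuous_real continuous_intros radial_continuous_on_circle c) auto
      fix t
      have "\<bar>radial X (of_real r * cis t)\<bar> < s"
        using elim by (intro d(2)) (auto simp: norm_mult)
      then have "\<bar>radial X (of_real r * cis t)\<bar>\<^sup>2 \<le> s\<^sup>2"
        by (intro power_mono) auto
      then show "norm ((radial X (of_real r * cis t))\<^sup>2) \<le> e / 10" using s by simp
    qed (auto)
    also have "\<dots> = 2 * pi * (e / 10)" by simp
    also have "\<dots> < e" using e pi_less_4 by (simp add: field_simps)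
    finally show ?case by simp
  qed
qed

text \<open>These polynomials form the Lie algebra su(1,1) of infinitesimal automorphisms of the
  disc. Unlike \<open>killing\<close>, the predicate ignores values off the disc and so applies to
  fields that are not extensional.\<close>

definition killing_polynomial :: "(complex \<Rightarrow> complex) \<Rightarrow> bool" where
  "killing_polynomial X \<longleftrightarrow>
     (\<exists>(a::complex) (b::real). \<forall>z\<in>disc. X z = a + \<i> * of_real b * z - cnj a * z\<^sup>2)"

lemma holomorphic_vanishing_radial_killing:
  assumes "X holomorphic_on disc" "(radial X \<longlongrightarrow> 0) at_boundary"
  shows "killing_polynomial X"
  using holomorphic_L2_tangential_quadratic[OF assms(1)
      vanishing_radial_imp_L2_tangential[OF holomorphic_on_imp_continuous_on[OF assms(1)] assms(2)]]
  unfolding killing_polynomial_def by metis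

text \<open>The Killing equations say that X is holomorphic and that Re X' = -2 <z,X> / rho. Along a
  ray this is a linear ordinary differential equation for the radial component, whose solution
  decays like \<open>rho\<close>; the uniqueness result for vanishing radial part then gives the
  polynomial.\<close>

lemma killing_imp_polynomial:
  assumes "X \<in> killing"
  shows "killing_polynomial X"
proof -
  have dX: "X differentiable (at z)" if "z \<in> disc" for z
  proof -
    have "Ck_on 1 disc X" using assms smooth_on_open_iff[of disc X] by (auto simp: killing_def)
    then show ?thesis using that by simp
  qed
  have lie: "lie_metric X z v w = 0" if "z \<in> disc" for z v w
    using assms that by (auto simp: killing_def)
  have W: "\<exists>a. (X has_field_derivative a) (at z) \<and> Re a = - 2 * (z \<bullet> X z) / rho z"
    if z: "z \<in> disc" for z
  proof -
    obtain a b where ab: "has_wirtinger X a b z"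
      using differentiable_imp_has_wirtinger[OF dX[OF z]] by blast
    have r: "rho z > 0" using rho_pos[OF z] .
    \<comment> \<open>The entries (1, 1) and (\<open>\<i>\<close>, \<open>\<i>\<close>) differ only
      in the sign of Re b, and the mixed entry is a multiple of Im b; together they force b =
      0.\<close>
    have "16 * (z \<bullet> X z) / rho z ^ 3 + (8 * Re a + Re (8 * cnj b)) / (rho z)\<^sup>2 = 0"
      using lie[OF z, of 1 1] unfolding lie_metric_eq[OF z ab] by simp
    moreover have "16 * (z \<bullet> X z) / rho z ^ 3 + (8 * Re a - Re (8 * cnj b)) / (rho z)\<^sup>2 = 0"
      using lie[OF z, of \<i> \<i>] unfolding lie_metric_eq[OF z ab] by (simp add: inner_complex_def)
    moreover have "Im b = 0"
      using lie[OF z, of 1 \<i>] r unfolding lie_metric_eq[OF z ab] by (simp add: inner_complex_def)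
    moreover have "Re b = 0"
    proof -
      have "(8 * Re a + Re (8 * cnj b)) / (rho z)\<^sup>2 = (8 * Re a - Re (8 * cnj b)) / (rho z)\<^sup>2"
        using calculation(1,2) by linarith
      then show ?thesis using r by simp
    qed
    ultimately have b: "b = 0" and e: "16 * (z \<bullet> X z) / rho z ^ 3 + 8 * Re a / (rho z)\<^sup>2 = 0"
      by (simp_all add: complex_eq_iff)
    from e have "Re a = - 2 * (z \<bullet> X z) / rho z"
      using r by (simp add: field_simps power2_eq_square power3_eq_cube)
    then show ?thesis using ab unfolding b has_wirtinger_0_iff by blast
  qed
  have hol: "X holomorphic_on disc"
    using W by (subst holomorphic_on_open) blast+
  have rad: "radial X (of_real r * cis t) = r * (1 - r\<^sup>2) * (cis t \<bullet> X 0)" if "0 < r" "r < 1" for r t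
  proof -
    \<comment> \<open>1 / (1 - s^2) is the integrating factor of the equation along the ray, so
      \<open>u\<close> is constant.\<close>
    define u where "u s = (cis t \<bullet> X (of_real s * cis t)) / (1 - s\<^sup>2)" for s :: real
    have s1: "1 - s\<^sup>2 > 0" if "0 \<le> s" "s < 1" for s :: real
      using that by (simp add: power_less_one_iff abs_square_less_1)
    have D: "(u has_real_derivative 0) (at s)" if s: "0 \<le> s" "s < 1" for s
    proof -
      define z where "z = of_real s * cis t"
      have z: "z \<in> disc" using s by (simp add: z_def norm_mult)
      obtain a where a: "(X has_field_derivative a) (at z)" "Re a = - 2 * (z \<bullet> X z) / rho z"
        using W[OF z] by blast
      have rz: "rho z = 1 - s\<^sup>2" by (simp add: rho_def z_def norm_mult)
      have "((\<lambda>s. of_real s * cis t) has_vector_derivative cis t) (at s)"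
        by (auto intro!: derivative_eq_intros simp: has_vector_derivative_def scaleR_conv_of_real)
      from field_vector_diff_chain_at[OF this a(1)[unfolded z_def]]
      have "((\<lambda>s. X (of_real s * cis t)) has_vector_derivative cis t * a) (at s)"
        by (simp add: comp_def)
      then have "((\<lambda>s. cis t \<bullet> X (of_real s * cis t)) has_real_derivative cis t \<bullet> (cis t * a)) (at s)"
        unfolding has_vector_derivative_def has_field_derivative_def
        by (auto intro!: derivative_eq_intros)
      moreover have "cis t \<bullet> (cis t * a) = Re a"
      proof -
        have "cis t \<bullet> (cis t * a) = Re (cnj (cis t) * (cis t * a))"
          by (simp add: inner_complex_def)
        also have "cnj (cis t) * (cis t * a) = a"
          by (simp add: cis_cnj cis_mult flip: mult.assoc)
        finally show ?thesis .
      qed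
      ultimately have "((\<lambda>s. cis t \<bullet> X (of_real s * cis t)) has_real_derivative Re a) (at s)" by simp
      then have "(u has_real_derivative
          (Re a * (1 - s\<^sup>2) + (cis t \<bullet> X z) * (2 * s)) / (1 - s\<^sup>2)\<^sup>2) (at s)"
        unfolding u_def z_def using s1[OF s]
        by (auto intro!: derivative_eq_intros simp: power2_eq_square)
      moreover have "Re a * (1 - s\<^sup>2) + (cis t \<bullet> X z) * (2 * s) = 0"
      proof -
        have "z \<bullet> X z = s * (cis t \<bullet> X z)" by (simp add: z_def inner_complex_def algebra_simps)
        then show ?thesis using a(2) s1[OF s] by (simp add: rz)
      qed
      ultimately show ?thesis by simp
    qed
    have "continuous_on {0..r} u"
    proof (rule DERIV_atLeastAtMost_imp_continuous_on)
      fix s assume "0 \<le> s" "s \<le> r"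
      then show "\<exists>y. (u has_real_derivative y) (at s)" using D[of s] that by auto
    qed
    then have "u r = u 0"
      using DERIV_isconst_end[of 0 r u] D that by simp
    then have "(cis t \<bullet> X (of_real r * cis t)) = (1 - r\<^sup>2) * (cis t \<bullet> X 0)"
      using s1[of r] that by (simp add: u_def field_simps)
    then have "r * (cis t \<bullet> X (of_real r * cis t)) = r * ((1 - r\<^sup>2) * (cis t \<bullet> X 0))" by simp
    moreover have "radial X (of_real r * cis t) = r * (cis t \<bullet> X (of_real r * cis t))"
      by (simp add: radial_def inner_complex_def algebra_simps)
    ultimately show ?thesis by simp
  qed
  have "(radial X \<longlongrightarrow> 0) at_boundary"
  proof (rule Lim_null_comparison)
    show "((\<lambda>z. rho z * norm (X 0)) \<longlongrightarrow> 0) at_boundary"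
      using tendsto_mult_right[OF rho_tendsto_boundary, of "norm (X 0)"] by simp
    show "\<forall>\<^sub>F z in at_boundary. norm (radial X z) \<le> rho z * norm (X 0)"
      unfolding eventually_at_boundary
    proof (intro exI[of _ 0] conjI allI impI)
      fix z :: complex assume z: "0 < norm z \<and> norm z < 1"
      define r where "r = norm z"
      have zr: "z = of_real r * cis (Arg z)" using rcis_cmod_Arg[of z] by (simp add: rcis_def r_def)
      have r: "0 < r" "r < 1" using z by (auto simp: r_def)
      have p: "1 - r\<^sup>2 \<ge> 0" using r by (simp add: power_le_one)
      have "\<bar>radial X z\<bar> = r * (1 - r\<^sup>2) * \<bar>cis (Arg z) \<bullet> X 0\<bar>"
        using rad[OF r, of "Arg z"] zr r p by (simp add: abs_mult)
      also have "\<dots> \<le> 1 * (1 - r\<^sup>2) * norm (X 0)"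
        using Cauchy_Schwarz_ineq2[of "cis (Arg z)" "X 0"] r p
        by (intro mult_mono) auto
      finally show "norm (radial X z) \<le> rho z * norm (X 0)" by (simp add: rho_def r_def)
    qed auto
  qed
  then show ?thesis using hol holomorphic_vanishing_radial_killing by blast
qed

lemma killing_iff: "X \<in> killing \<longleftrightarrow> X \<in> extensional disc \<and> killing_polynomial X"
proof
  assume "X \<in> killing"
  then show "X \<in> extensional disc \<and> killing_polynomial X"
    using killing_imp_polynomial by (auto simp: killing_def)
next
  assume X: "X \<in> extensional disc \<and> killing_polynomial X"
  then obtain a b where ab: "\<And>z. z \<in> disc \<Longrightarrow> X z = a + \<i> * complex_of_real b * z - cnj a * z\<^sup>2"
    unfolding killing_polynomial_def by auto
  have hol: "X holomorphic_on disc"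
  proof (rule holomorphic_transform)
    show "(\<lambda>z. a + \<i> * complex_of_real b * z - cnj a * z\<^sup>2) holomorphic_on disc"
      by (intro holomorphic_intros)
  qed (use ab in auto)
  have w: "has_wirtinger X (\<i> * b - cnj a * (2 * z)) 0 z" if "z \<in> disc" for z
  proof -
    have "has_wirtinger (\<lambda>z. a + \<i> * complex_of_real b * z - cnj a * z\<^sup>2) (\<i> * b - cnj a * (2 * z)) 0 z"
      unfolding has_wirtinger_0_iff by (auto intro!: derivative_eq_intros)
    then show ?thesis using has_wirtinger_cong_open[of disc z X] ab that by simp
  qed
  have "lie_metric X z v w = 0" if z: "z \<in> disc" for z v w
  proof -
    have r: "rho z > 0" using rho_pos[OF z] .
    \<comment> \<open>With vanishing cnj z derivative, the Lie derivative of the metric is a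
      multiple of this expression.\<close>
    have e: "2 * (z \<bullet> X z) + Re (\<i> * b - cnj a * (2 * z)) * rho z = 0"
      unfolding ab[OF z] rho_def cmod_power2
      by (simp add: inner_complex_def algebra_simps power2_eq_square)
    have "lie_metric X z v w = 8 * (v \<bullet> w) * (2 * (z \<bullet> X z) + Re (\<i> * b - cnj a * (2 * z)) * rho z) / rho z ^ 3"
      unfolding lie_metric_eq[OF z w[OF z]] using r
      by (simp add: field_simps power2_eq_square power3_eq_cube)
    then show ?thesis unfolding e by simp
  qed
  then show "X \<in> killing"
    using X Ck_on_holomorphic[OF _ hol] smooth_on_open_iff[of disc X] by (simp add: killing_def)
qed


section \<open>Boundary values in the mean\<close>

lemma space_circle_measure: "space circle_measure = sphere 0 1"
  by (simp add: circle_measure_def space_restrict_space)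

lemma sets_circle_measure: "sets circle_measure = sets (restrict_space borel (sphere 0 1))"
  by (simp add: circle_measure_def)

lemma continuous_measurable_circle:
  fixes f :: "complex \<Rightarrow> 'a::topological_space"
  shows "continuous_on (sphere 0 1) f \<Longrightarrow> f \<in> borel_measurable circle_measure"
  using borel_measurable_continuous_on_restrict[of "sphere 0 1" f]
  by (simp add: measurable_cong_sets[OF sets_circle_measure refl])

lemma cis_measurable_circle:
  "cis \<in> measurable (restrict_space lborel {0..<2*pi}) (restrict_space borel (sphere 0 1))"
proof (rule measurable_restrict_space2)
  have "cis \<in> borel_measurable borel"
    by (intro borel_measurable_continuous_onI continuous_intros)
  then show "cis \<in> borel_measurable (restrict_space lborel {0..<2*pi})"
    by (intro measurable_restrict_space1) simp
qed auto

lemma emeasure_circle_measure: "emeasure circle_measure (sphere 0 1) = ennreal (2 * pi)"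
proof -
  have "emeasure circle_measure (sphere 0 1) =
      emeasure (restrict_space lborel {0..<2*pi}) (cis -` sphere 0 1 \<inter> space (restrict_space lborel {0..<2*pi}))"
    unfolding circle_measure_def
    by (rule emeasure_distr[OF cis_measurable_circle]) (auto simp: sets_restrict_space)
  also have "cis -` sphere 0 1 \<inter> space (restrict_space lborel {0..<2*pi}) = {0..<2*pi}"
    by (auto simp: space_restrict_space)
  also have "emeasure (restrict_space lborel {0..<2*pi}) {0..<2*pi} = emeasure lborel {0..<2*pi}"
    by (rule emeasure_restrict_space) auto
  finally show ?thesis by simp
qed

text \<open>The measure is pushed forward from a half-open interval, the other integrals live on the
  closed one; they differ in the single point 2 pi.\<close>

lemma nn_integral_circle_measure:
  fixes F :: "complex \<Rightarrow> real"
  assumes c: "continuous_on (sphere 0 1) F" and p: "\<And>z. F z \<ge> 0"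
  shows "(\<integral>\<^sup>+ z. ennreal (F z) \<partial>circle_measure) = ennreal (integral {0..2*pi} (\<lambda>t. F (cis t)))"
proof -
  have cF: "continuous_on A (\<lambda>t. F (cis t))" for A
    by (intro continuous_on_compose2[OF c] continuous_intros) auto
  have "(\<integral>\<^sup>+ z. ennreal (F z) \<partial>circle_measure) =
      (\<integral>\<^sup>+ t. ennreal (F (cis t)) \<partial>restrict_space lborel {0..<2*pi})"
    unfolding circle_measure_def
    using borel_measurable_continuous_on_restrict[OF c]
    by (intro nn_integral_distr cis_measurable_circle) auto
  also have "\<dots> = (\<integral>\<^sup>+ t. ennreal (F (cis t)) * indicator {0..<2*pi} t \<partial>lborel)"
    by (rule nn_integral_restrict_space) auto
  also have "\<dots> = ennreal (integral {0..2*pi} (\<lambda>t. F (cis t)))"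
  proof (rule nn_integral_has_integral_lebesgue')
    have "((\<lambda>t. F (cis t)) has_integral integral {0..2*pi} (\<lambda>t. F (cis t))) {0..2*pi}"
      by (intro integrable_integral integrable_continuous_real cF)
    moreover have n1: "negligible {x \<in> {0..2*pi} - {0..<2*pi}. F (cis x) \<noteq> 0}"
      by (rule negligible_subset[of "{2 * pi}"]) auto
    moreover have n2: "negligible {x \<in> {0..<2*pi} - {0..2*pi}. F (cis x) \<noteq> 0}"
      by (rule negligible_subset[of "{}"]) auto
    ultimately show "((\<lambda>t. F (cis t)) has_integral integral {0..2*pi} (\<lambda>t. F (cis t))) {0..<2*pi}"
      using has_integral_spike_set_eq[OF n1 n2] by blast
  qed (use p in auto)
  finally show ?thesis .
qed

lemma filterlim_one_minus_at_left: "filterlim (\<lambda>r::real. 1 - r) (at_right 0) (at_left 1)"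
proof -
  have "((\<lambda>r::real. 1 - r) \<longlongrightarrow> 1 - 1) (at_left 1)" by (intro tendsto_intros)
  moreover have "\<forall>\<^sub>F r in at_left (1::real). 1 - r \<in> {0<..} \<and> 1 - r \<noteq> 0"
    unfolding eventually_at_left[of 0 "1::real", simplified] by (intro exI[of _ 0]) auto
  ultimately show ?thesis by (simp add: filterlim_at)
qed

lemma filterlim_one_minus_at_right: "filterlim (\<lambda>r::real. 1 - r) (at_left 1) (at_right 0)"
proof -
  have "((\<lambda>r::real. 1 - r) \<longlongrightarrow> 1 - 0) (at_right 0)" by (intro tendsto_intros)
  moreover have "\<forall>\<^sub>F r in at_right (0::real). 1 - r \<in> {..<1} \<and> 1 - r \<noteq> 1"
    unfolding eventually_at_right[of "0::real" 1, simplified] by (intro exI[of _ 1]) auto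
  ultimately show ?thesis by (simp add: filterlim_at)
qed

lemma eventually_at_left_1: "\<forall>\<^sub>F r in at_left (1::real). 0 < r \<and> r < 1"
  unfolding eventually_at_left[of 0 "1::real", simplified] by (intro exI[of _ 0]) auto

text \<open>A tangential Y satisfies Re (cnj z Y) = 0 almost everywhere, so Y can be subtracted
  inside the radial part at no cost. The radial part is then dominated by the distance to the
  boundary value, with radius r = 1 - \<epsilon>.\<close>

lemma L2_extension_imp_L2_tangential:
  assumes e: "has_L2_extension X Y" and t: "tangential Y"
  shows "L2_tangential X"
proof -
  have c: "continuous_on disc X" using e by (simp add: has_L2_extension_def)
  define N where "N \<epsilon> = (\<integral>\<^sup>+ z. ennreal ((norm (X ((1 - of_real \<epsilon>) * z) - Y z))\<^sup>2) \<partial>circle_measure)" for \<epsilon> :: real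
  have N: "(N \<longlongrightarrow> 0) (at_right 0)" using e unfolding has_L2_extension_def N_def by blast
  have N': "((\<lambda>r. N (1 - r)) \<longlongrightarrow> 0) (at_left 1)"
    by (rule filterlim_compose[OF N filterlim_one_minus_at_left])
  define J where "J r = integral {0..2*pi} (\<lambda>t. (radial X (of_real r * cis t))\<^sup>2)" for r
  obtain f :: "complex \<Rightarrow> real" where f: "AE z in circle_measure. Y z = of_real (f z) * (\<i> * z)"
    using t unfolding tangential_def by blast
  have le: "ennreal (J r) \<le> N (1 - r)" if r: "0 < r \<and> r < 1" for r
  proof -
    have cr: "continuous_on (sphere 0 1) (\<lambda>z. radial X (of_real r * z))"
      unfolding radial_def using r
      by (intro continuous_intros continuous_on_compose2[OF c]) (auto simp: norm_mult)
    have "ennreal (J r) = (\<integral>\<^sup>+ z. ennreal ((radial X (of_real r * z))\<^sup>2) \<partial>circle_measure)"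
      unfolding J_def by (rule nn_integral_circle_measure[symmetric]) (auto intro!: continuous_intros cr)
    also have "\<dots> \<le> N (1 - r)"
      unfolding N_def
    proof (rule nn_integral_mono_AE)
      show "AE z in circle_measure. ennreal ((radial X (of_real r * z))\<^sup>2)
          \<le> ennreal ((norm (X ((1 - of_real (1 - r)) * z) - Y z))\<^sup>2)"
        using f AE_space
      proof eventually_elim
        case (elim z)
        then have z: "norm z = 1" by (simp add: space_circle_measure)
        have "cnj z * Y z = of_real (f z) * (\<i> * (z * cnj z))" using elim by simp
        also have "z * cnj z = 1" using z complex_norm_square[of z] by simp
        finally have "Re (cnj z * Y z) = 0" by simp
        then have "radial X (of_real r * z) = r * Re (cnj z * (X (of_real r * z) - Y z))"
          by (simp add: radial_def algebra_simps)
        also have "\<bar>\<dots>\<bar> \<le> 1 * norm (cnj z * (X (of_real r * z) - Y z))"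
          unfolding abs_mult by (intro mult_mono abs_Re_le_cmod) (use r in auto)
        also have "\<dots> = norm (X (of_real r * z) - Y z)" using z by (simp add: norm_mult)
        finally have "\<bar>radial X (of_real r * z)\<bar>\<^sup>2 \<le> (norm (X (of_real r * z) - Y z))\<^sup>2"
          by (intro power_mono) auto
        then show ?case by (simp add: ennreal_leI)
      qed
    qed
    finally show ?thesis .
  qed
  have "((\<lambda>r. ennreal (J r)) \<longlongrightarrow> ennreal 0) (at_left 1)"
  proof (rule tendsto_sandwich[OF _ _ tendsto_const])
    show "\<forall>\<^sub>F r in at_left 1. ennreal (J r) \<le> N (1 - r)"
      using eventually_at_left_1 le by (rule eventually_mono)
    show "((\<lambda>r. N (1 - r)) \<longlongrightarrow> ennreal 0) (at_left 1)" using N' by simp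
  qed auto
  moreover have "J r \<ge> 0" for r
    unfolding J_def by (metis integral_nonneg not_integrable_integral order_refl zero_le_power2)
  ultimately have "(J \<longlongrightarrow> 0) (at_left 1)"
    by (intro tendsto_ennrealD) auto
  then show ?thesis by (simp add: L2_tangential_def J_def[abs_def])
qed

lemma L2_tangential_diff:
  assumes X: "continuous_on disc X" "L2_tangential X" and Y: "continuous_on disc Y" "L2_tangential Y"
  shows "L2_tangential (\<lambda>z. X z - Y z)"
proof -
  define J where "J X r = integral {0..2*pi} (\<lambda>t. (radial X (of_real r * cis t))\<^sup>2)" for X r
  have "((\<lambda>r. 2 * J X r + 2 * J Y r) \<longlongrightarrow> 2 * 0 + 2 * 0) (at_left 1)"
    using X(2) Y(2) unfolding L2_tangential_def J_def[symmetric] by (intro tendsto_intros)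
  then have J: "((\<lambda>r. 2 * J X r + 2 * J Y r) \<longlongrightarrow> 0) (at_left 1)" by simp
  have "(J (\<lambda>z. X z - Y z) \<longlongrightarrow> 0) (at_left 1)"
  proof (rule Lim_null_comparison[OF _ J])
    show "\<forall>\<^sub>F r in at_left 1. norm (J (\<lambda>z. X z - Y z) r) \<le> 2 * J X r + 2 * J Y r"
      using eventually_at_left_1
    proof eventually_elim
      case (elim r)
      note i = integrable_continuous_real continuous_intros radial_continuous_on_circle X(1) Y(1)
      have "norm (J (\<lambda>z. X z - Y z) r) \<le> integral {0..2*pi}
          (\<lambda>t. 2 * (radial X (of_real r * cis t))\<^sup>2 + 2 * (radial Y (of_real r * cis t))\<^sup>2)"
        unfolding J_def
      proof (rule integral_norm_bound_integral)
        fix t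
        have "radial (\<lambda>z. X z - Y z) w = radial X w - radial Y w" for w
          by (simp add: radial_def algebra_simps)
        moreover have "(a - b)\<^sup>2 \<le> 2 * a\<^sup>2 + 2 * b\<^sup>2" for a b :: real
          using zero_le_power2[of "a + b"] unfolding power2_sum power2_diff by linarith
        ultimately show "norm ((radial (\<lambda>z. X z - Y z) (of_real r * cis t))\<^sup>2)
            \<le> 2 * (radial X (of_real r * cis t))\<^sup>2 + 2 * (radial Y (of_real r * cis t))\<^sup>2" by simp
      qed (use elim in \<open>auto intro!: i\<close>)
      also have "\<dots> = 2 * J X r + 2 * J Y r"
        unfolding J_def using elim
        by (subst integral_add) (auto intro!: i)
      finally show ?case by simp
    qed
  qed
  then show ?thesis by (simp add: L2_tangential_def J_def[abs_def])
qed

lemma ennreal_tendsto_0: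
  fixes f :: "'a \<Rightarrow> ennreal"
  assumes "\<And>e::real. e > 0 \<Longrightarrow> \<forall>\<^sub>F x in F. f x \<le> ennreal e"
  shows "(f \<longlongrightarrow> 0) F"
proof (rule order_tendstoI)
  fix a :: ennreal assume "0 < a"
  then obtain c where c: "0 < c" "c < a" using dense by blast
  then obtain e where e: "c = ennreal e" "e \<ge> 0" by (cases c) auto
  then have "e > 0" using c e by (cases "e = 0") auto
  from assms[OF this] show "\<forall>\<^sub>F x in F. f x < a"
    by (rule eventually_mono) (use c e in auto)
qed auto

text \<open>Uniform convergence makes Y continuous, hence bounded and measurable, and bounds the
  squared L2 distance by 2 pi times the squared supremum. The radial part passes to the limit along
  each ray, which makes Y tangential.\<close>

lemma uniform_limit_L2_extension:
  assumes c: "continuous_on disc X"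
    and u: "uniform_limit (sphere 0 1) (\<lambda>r z. X (of_real r * z)) Y (at_left 1)"
    and v: "(radial X \<longlongrightarrow> 0) at_boundary"
  shows "has_L2_extension X Y" "tangential Y"
proof -
  have cY: "continuous_on (sphere 0 1) Y"
  proof (rule uniform_limit_theorem[OF _ u])
    show "\<forall>\<^sub>F r in at_left 1. continuous_on (sphere 0 1) (\<lambda>z. X (of_real r * z))"
      using eventually_at_left_1
      by eventually_elim (intro continuous_on_compose2[OF c] continuous_intros, auto simp: norm_mult)
  qed auto
  have "bounded (Y ` sphere 0 1)"
    by (intro compact_imp_bounded compact_continuous_image cY) simp
  then obtain B where B: "\<And>z. z \<in> sphere 0 1 \<Longrightarrow> norm (Y z) \<le> B"
    unfolding bounded_iff by blast
  have bd: "(\<integral>\<^sup>+ z. ennreal ((norm (f z))\<^sup>2) \<partial>circle_measure) \<le> ennreal (C\<^sup>2 * (2 * pi))"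
    if "\<And>z. z \<in> sphere 0 1 \<Longrightarrow> norm (f z) \<le> C" for f :: "complex \<Rightarrow> complex" and C
  proof -
    have "(\<integral>\<^sup>+ z. ennreal ((norm (f z))\<^sup>2) \<partial>circle_measure) \<le> (\<integral>\<^sup>+ z. ennreal (C\<^sup>2) \<partial>circle_measure)"
      using that by (intro nn_integral_mono ennreal_leI power_mono) (auto simp: space_circle_measure)
    also have "\<dots> = ennreal (C\<^sup>2 * (2 * pi))"
      using emeasure_circle_measure by (simp add: space_circle_measure ennreal_mult)
    finally show ?thesis .
  qed
  show "has_L2_extension X Y"
    unfolding has_L2_extension_def
  proof (intro conjI c continuous_measurable_circle cY)
    show "(\<integral>\<^sup>+ z. ennreal ((norm (Y z))\<^sup>2) \<partial>circle_measure) < \<infinity>"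
      using bd[of Y B] B by (auto simp: less_top[symmetric] top_unique)
    show "((\<lambda>\<epsilon>::real. \<integral>\<^sup>+ z. ennreal ((norm (X ((1 - of_real \<epsilon>) * z) - Y z))\<^sup>2) \<partial>circle_measure) \<longlongrightarrow> 0) (at_right 0)"
    proof (rule ennreal_tendsto_0)
      fix e :: real assume e: "e > 0"
      define s where "s = sqrt (e / (2 * pi))"
      have s: "s > 0" "s\<^sup>2 * (2 * pi) = e" using e by (auto simp: s_def)
      have "\<forall>\<^sub>F r in at_left 1. \<forall>z\<in>sphere 0 1. dist (X (of_real r * z)) (Y z) < s"
        using u s(1) unfolding uniform_limit_iff by blast
      from eventually_compose_filterlim[OF this filterlim_one_minus_at_right]
      show "\<forall>\<^sub>F \<epsilon> in at_right 0. (\<integral>\<^sup>+ z. ennreal ((norm (X ((1 - of_real \<epsilon>) * z) - Y z))\<^sup>2) \<partial>circle_measure) \<le> ennreal e"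
      proof eventually_elim
        case (elim \<epsilon>)
        show ?case
          unfolding s(2)[symmetric] using elim by (intro bd) (force simp: dist_norm)
      qed
    qed
  qed
  have "Re (cnj z * Y z) = 0" if z: "z \<in> sphere 0 1" for z
  proof -
    have "filterlim (\<lambda>r::real. norm (of_real r * z)) (at_left 1) (at_left 1)"
      using eventually_at_left_1 z
      by (intro filterlim_ident[THEN filterlim_cong[THEN iffD1, rotated 3]] refl)
         (auto elim!: eventually_mono simp: norm_mult)
    then have "filterlim (\<lambda>r::real. of_real r * z) at_boundary (at_left 1)"
      by (simp add: filterlim_filtercomap_iff comp_def)
    from filterlim_compose[OF v this]
    have "((\<lambda>r. radial X (of_real r * z)) \<longlongrightarrow> 0) (at_left 1)" .
    moreover have "((\<lambda>r. radial X (of_real r * z)) \<longlongrightarrow> Re (cnj (of_real 1 * z) * Y z)) (at_left 1)"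
      unfolding radial_def by (intro tendsto_intros tendsto_uniform_limitI[OF u z])
    ultimately show ?thesis using tendsto_unique[OF trivial_limit_at_left_real] by fastforce
  qed
  then have "Y z = of_real (Im (cnj z * Y z)) * (\<i> * z)" if "z \<in> sphere 0 1" for z
  proof -
    have "cnj z * Y z = of_real (Im (cnj z * Y z)) * \<i>"
      using \<open>\<And>z. z \<in> sphere 0 1 \<Longrightarrow> Re (cnj z * Y z) = 0\<close>[OF that] by (simp add: complex_eq_iff)
    moreover have "z * (cnj z * Y z) = Y z"
      using that complex_norm_square[of z] by (simp flip: mult.assoc)
    ultimately show ?thesis by (metis mult.assoc mult.commute)
  qed
  then show "tangential Y"
    unfolding tangential_def
    by (intro exI[of _ "\<lambda>z. Im (cnj z * Y z)"] AE_I2) (simp only: space_circle_measure)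
qed


section \<open>Growth of primitives\<close>

text \<open>The mean value inequality along a ray, with a majorant whose derivative dominates that
  of G. It turns each growth bound for a derivative into one for its primitive.\<close>

lemma holomorphic_radial_growth:
  assumes G: "G holomorphic_on disc" and e: "norm e = 1" and sr: "0 \<le> s" "s \<le> r" "r < 1"
    and \<phi>: "\<And>x. 0 \<le> x \<Longrightarrow> x < 1 \<Longrightarrow> (\<phi> has_real_derivative \<phi>' x) (at x)"
    and bd: "\<And>x. 0 \<le> x \<Longrightarrow> x < 1 \<Longrightarrow> norm (deriv G (of_real x * e)) \<le> \<phi>' x"
  shows "norm (G (of_real r * e) - G (of_real s * e)) \<le> \<phi> r - \<phi> s"
proof (cases "s = r")
  case False
  have d: "((\<lambda>x. G (of_real x * e)) has_vector_derivative e * deriv G (of_real x * e)) (at x)"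
    if "0 \<le> x" "x < 1" for x
  proof -
    have "of_real x * e \<in> disc" using that e by (simp add: norm_mult)
    then have 1: "(G has_field_derivative deriv G (of_real x * e)) (at (of_real x * e))"
      using G holomorphic_derivI by blast
    have "((\<lambda>x. of_real x * e) has_vector_derivative e) (at x)"
      by (auto intro!: derivative_eq_intros simp: has_vector_derivative_def scaleR_conv_of_real)
    from field_vector_diff_chain_at[OF this 1] show ?thesis by (simp add: comp_def)
  qed
  have p: "(\<phi> has_vector_derivative \<phi>' x) (at x)" if "0 \<le> x" "x < 1" for x
    using \<phi>[OF that] by (simp add: has_real_derivative_iff_has_vector_derivative)
  show ?thesis
  proof (rule differentiable_bound_general)
    show "s < r" using False sr by simp
    show "continuous_on {s..r} (\<lambda>x. G (of_real x * e))"
      using sr by (intro continuous_at_imp_continuous_on ballI has_vector_derivative_continuous[OF d]) auto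
    show "continuous_on {s..r} \<phi>"
      using sr by (intro continuous_at_imp_continuous_on ballI has_vector_derivative_continuous[OF p]) auto
    show "norm (e * deriv G (of_real x * e)) \<le> \<phi>' x" if "s < x" "x < r" for x
      using bd[of x] that sr e by (simp add: norm_mult)
  qed (use d p sr in auto)
qed auto

lemma rho_bounds:
  assumes "norm z \<le> 1"
  shows "1 - norm z \<le> rho z" "rho z \<le> 2 * (1 - norm z)"
proof -
  have "rho z = (1 - norm z) * (1 + norm z)" by (simp add: rho_def power2_eq_square algebra_simps)
  then show "1 - norm z \<le> rho z" "rho z \<le> 2 * (1 - norm z)"
    using assms mult_left_mono[of 1 "1 + norm z" "1 - norm z"] mult_left_mono[of "1 + norm z" 2 "1 - norm z"]
    by auto
qed

lemma disc_polar:
  fixes z :: complex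
  assumes "z \<in> disc"
  obtains r e where "z = of_real r * e" "norm e = 1" "norm z = r" "0 \<le> r" "r < 1"
proof
  show "z = of_real (norm z) * cis (Arg z)" using rcis_cmod_Arg[of z] by (simp add: rcis_def)
qed (use assms in auto)

text \<open>Integrating (1 - r)^(-2) gives (1 - r)^(-1), but the next integration would give a
  logarithm. Weakening that to (1 - r)^(-1/2) keeps all majorants elementary and still leaves F with
  the modulus sqrt (1 - s) along rays, uniformly in the direction.\<close>

lemma primitive_growth:
  assumes F: "F holomorphic_on disc"
    and q: "\<And>z. z \<in> disc \<Longrightarrow> norm (deriv (deriv (deriv F)) z) * (rho z)\<^sup>2 \<le> C"
  obtains K where "K \<ge> 0"
    "\<And>z. z \<in> disc \<Longrightarrow> norm (deriv (deriv F) z) * (1 - norm z) \<le> K"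
    "\<And>z. z \<in> disc \<Longrightarrow> norm (deriv F z) * sqrt (1 - norm z) \<le> K"
    "\<And>e r s. norm e = 1 \<Longrightarrow> 0 \<le> s \<Longrightarrow> s \<le> r \<Longrightarrow> r < 1 \<Longrightarrow>
        norm (F (of_real r * e) - F (of_real s * e)) \<le> K * sqrt (1 - s)"
proof -
  have F1: "deriv F holomorphic_on disc" and F2: "deriv (deriv F) holomorphic_on disc"
    using F by (auto intro!: holomorphic_deriv)
  have C0: "C \<ge> 0"
    using q[of 0] by (smt (verit) centre_in_ball norm_ge_zero zero_le_mult_iff zero_le_power2)
  \<comment> \<open>Each constant comes from the next majorant: C / (1 - x), then 2 C2 / sqrt (1 -
    x), then -2 C3 sqrt (1 - x), together with the value of the derivative at 0 in the first two
    cases.\<close>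
  define C2 where "C2 = norm (deriv (deriv F) 0) + C"
  define C3 where "C3 = norm (deriv F 0) + 2 * C2"
  define K where "K = 2 * C3"
  have c: "C2 \<ge> 0" "C3 \<ge> C2" "K \<ge> C3" using C0 by (auto simp: C2_def C3_def K_def)
  have b2: "norm (deriv (deriv F) z) * (1 - norm z) \<le> C2" if z: "z \<in> disc" for z
  proof -
    obtain r e where re: "z = of_real r * e" "norm e = 1" "norm z = r" "0 \<le> r" "r < 1"
      using disc_polar[OF z] by blast
    have "norm (deriv (deriv F) (of_real r * e) - deriv (deriv F) (of_real 0 * e)) \<le> C / (1 - r) - C / (1 - 0)"
    proof (rule holomorphic_radial_growth[OF F2 re(2) order_refl re(4,5),
          where \<phi> = "\<lambda>x. C / (1 - x)" and \<phi>' = "\<lambda>x. C / (1 - x)\<^sup>2"])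
      fix x :: real assume x: "0 \<le> x" "x < 1"
      show "((\<lambda>x. C / (1 - x)) has_real_derivative C / (1 - x)\<^sup>2) (at x)"
        using x by (auto intro!: derivative_eq_intros simp: power2_eq_square)
      define w where "w = of_real x * e"
      have w: "w \<in> disc" "norm w = x" using x re by (auto simp: w_def norm_mult)
      have "norm (deriv (deriv (deriv F)) w) * (1 - x)\<^sup>2 \<le> norm (deriv (deriv (deriv F)) w) * (rho w)\<^sup>2"
        using rho_bounds[of w] w x by (intro mult_left_mono power_mono) auto
      also have "\<dots> \<le> C" by (rule q[OF w(1)])
      finally show "norm (deriv (deriv (deriv F)) (of_real x * e)) \<le> C / (1 - x)\<^sup>2"
        using x by (simp add: field_simps w_def)
    qed
    then have "norm (deriv (deriv F) z) \<le> norm (deriv (deriv F) 0) + (C / (1 - r) - C)"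
      using norm_triangle_sub[of "deriv (deriv F) z" "deriv (deriv F) 0"] re by simp
    then have "norm (deriv (deriv F) z) * (1 - r) \<le> (norm (deriv (deriv F) 0) + (C / (1 - r) - C)) * (1 - r)"
      using re by (intro mult_right_mono) auto
    also have "\<dots> = norm (deriv (deriv F) 0) * (1 - r) + (C - C * (1 - r))"
      using re by (simp add: field_simps)
    also have "\<dots> \<le> norm (deriv (deriv F) 0) * 1 + C"
      using re C0 by (intro add_mono mult_left_mono) auto
    finally show ?thesis using re by (simp add: C2_def)
  qed
  have b1: "norm (deriv F z) * sqrt (1 - norm z) \<le> C3" if z: "z \<in> disc" for z
  proof -
    obtain r e where re: "z = of_real r * e" "norm e = 1" "norm z = r" "0 \<le> r" "r < 1"
      using disc_polar[OF z] by blast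
    have "norm (deriv F (of_real r * e) - deriv F (of_real 0 * e)) \<le> 2 * C2 / sqrt (1 - r) - 2 * C2 / sqrt (1 - 0)"
    proof (rule holomorphic_radial_growth[OF F1 re(2) order_refl re(4,5),
          where \<phi> = "\<lambda>x. 2 * C2 / sqrt (1 - x)" and \<phi>' = "\<lambda>x. C2 / (sqrt (1 - x)) ^ 3"])
      fix x :: real assume x: "0 \<le> x" "x < 1"
      define t where "t = sqrt (1 - x)"
      have t: "0 < t" "t \<le> 1" and t2: "1 - x = t\<^sup>2" using x by (auto simp: t_def)
      have "((\<lambda>x. 2 * C2 / sqrt (1 - x)) has_real_derivative
          2 * C2 * (inverse (sqrt (1 - x)) / 2) / (sqrt (1 - x) * sqrt (1 - x))) (at x)"
        using x by (auto intro!: derivative_eq_intros)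
      then show "((\<lambda>x. 2 * C2 / sqrt (1 - x)) has_real_derivative C2 / (sqrt (1 - x)) ^ 3) (at x)"
        by (simp add: field_simps power3_eq_cube)
      define w where "w = of_real x * e"
      have w: "w \<in> disc" "norm w = x" using x re by (auto simp: w_def norm_mult)
      \<comment> \<open>The extra factor t \<le> 1 gives away half a power of 1 - x and so avoids
        the logarithm.\<close>
      have "norm (deriv (deriv F) w) * t ^ 3 \<le> norm (deriv (deriv F) w) * t\<^sup>2"
        using t by (intro mult_left_mono power_decreasing) auto
      also have "\<dots> \<le> C2" using b2[OF w(1)] unfolding w(2) t2 .
      finally show "norm (deriv (deriv F) (of_real x * e)) \<le> C2 / (sqrt (1 - x)) ^ 3"
        unfolding w_def[symmetric] t_def[symmetric] using t by (simp add: field_simps)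
    qed
    then have le: "norm (deriv F z) \<le> norm (deriv F 0) + (2 * C2 / sqrt (1 - r) - 2 * C2)"
      using norm_triangle_sub[of "deriv F z" "deriv F 0"] re by simp
    define t where "t = sqrt (1 - r)"
    have t: "0 < t" "t \<le> 1" using re by (auto simp: t_def)
    from le have "norm (deriv F z) * t \<le> (norm (deriv F 0) + (2 * C2 / t - 2 * C2)) * t"
      using t by (intro mult_right_mono) (auto simp: t_def)
    also have "\<dots> = norm (deriv F 0) * t + (2 * C2 - 2 * C2 * t)"
      using t by (simp add: field_simps)
    also have "\<dots> \<le> norm (deriv F 0) * 1 + 2 * C2"
      using t c by (intro add_mono mult_left_mono) auto
    finally show ?thesis using re by (simp add: C3_def t_def)
  qed
  have b0: "norm (F (of_real r * e) - F (of_real s * e)) \<le> K * sqrt (1 - s)"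
    if h: "norm e = 1" "0 \<le> s" "s \<le> r" "r < 1" for e r s
  proof -
    have "norm (F (of_real r * e) - F (of_real s * e)) \<le> - K * sqrt (1 - r) - (- K * sqrt (1 - s))"
    proof (rule holomorphic_radial_growth[OF F h,
          where \<phi> = "\<lambda>x. - K * sqrt (1 - x)" and \<phi>' = "\<lambda>x. C3 / sqrt (1 - x)"])
      fix x :: real assume x: "0 \<le> x" "x < 1"
      show "((\<lambda>x. - K * sqrt (1 - x)) has_real_derivative C3 / sqrt (1 - x)) (at x)"
        using x by (auto intro!: derivative_eq_intros simp: K_def field_simps)
      define w where "w = of_real x * e"
      have w: "w \<in> disc" "norm w = x" using x h by (auto simp: w_def norm_mult)
      show "norm (deriv F (of_real x * e)) \<le> C3 / sqrt (1 - x)"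
        using b1[OF w(1)] w x by (simp add: field_simps w_def)
    qed
    also have "\<dots> \<le> K * sqrt (1 - s)" using c h by simp
    finally show ?thesis .
  qed
  show ?thesis
  proof (rule that[of K])
    show "K \<ge> 0" using c by linarith
    show "norm (deriv (deriv F) z) * (1 - norm z) \<le> K" if "z \<in> disc" for z
      using b2[OF that] c by linarith
    show "norm (deriv F z) * sqrt (1 - norm z) \<le> K" if "z \<in> disc" for z
      using b1[OF that] c by linarith
  qed (use b0 in auto)
qed

text \<open>The increments along each ray are Cauchy at a rate independent of the ray. Letting the
  outer radius tend to 1 keeps the rate, which later makes the convergence to the boundary uniform
  in \<open>e\<close>.\<close>

lemma radial_limits:
  fixes F :: "complex \<Rightarrow> complex"
  assumes K: "K \<ge> 0" and b0: "\<And>e r s. norm e = 1 \<Longrightarrow> 0 \<le> s \<Longrightarrow> s \<le> r \<Longrightarrow> r < 1 \<Longrightarrow>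
        norm (F (of_real r * e) - F (of_real s * e)) \<le> K * sqrt (1 - s)"
  obtains L :: "complex \<Rightarrow> complex" where
    "\<And>e s. norm e = 1 \<Longrightarrow> 0 \<le> s \<Longrightarrow> s < 1 \<Longrightarrow> norm (L e - F (of_real s * e)) \<le> K * sqrt (1 - s)"
proof -
  define r where "r n = 1 - inverse (real (Suc n))" for n
  have r: "0 \<le> r n" "r n < 1" for n by (auto simp: r_def field_simps)
  have rlim: "(\<lambda>n. K * sqrt (1 - r n)) \<longlonglongrightarrow> 0"
  proof -
    have "(\<lambda>n. K * sqrt (inverse (real (Suc n)))) \<longlonglongrightarrow> K * sqrt 0"
      by (intro tendsto_intros LIMSEQ_inverse_real_of_nat)
    then show ?thesis by (simp add: r_def)
  qed
  have mono: "r m \<le> r n" if "m \<le> n" for m n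
    using that by (simp add: r_def field_simps)
  have conv: "convergent (\<lambda>n. F (of_real (r n) * e))" if e: "norm e = 1" for e :: complex
  proof (intro Cauchy_convergent metric_CauchyI)
    fix d :: real assume "d > 0"
    then have "\<forall>\<^sub>F n in sequentially. K * sqrt (1 - r n) < d / 2"
      using rlim by (intro order_tendstoD(2)) auto
    then obtain N where N: "K * sqrt (1 - r N) < d / 2"
      by (auto simp: eventually_sequentially)
    have "dist (F (of_real (r n) * e)) (F (of_real (r N) * e)) < d / 2" if "n \<ge> N" for n
      using b0[OF e r(1) mono[OF that] r(2)] N by (simp add: dist_norm)
    then show "\<exists>M. \<forall>m\<ge>M. \<forall>n\<ge>M. dist (F (of_real (r m) * e)) (F (of_real (r n) * e)) < d"
      using dist_triangle_half_l by blast
  qed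
  define L where "L e = lim (\<lambda>n. F (of_real (r n) * e))" for e :: complex
  show ?thesis
  proof (rule that[of L])
    fix e :: complex and s :: real assume e: "norm e = 1" and s: "0 \<le> s" "s < 1"
    have "(\<lambda>n. F (of_real (r n) * e)) \<longlonglongrightarrow> L e"
      using conv[OF e] by (simp add: L_def convergent_LIMSEQ_iff)
    then have "(\<lambda>n. norm (F (of_real (r n) * e) - F (of_real s * e))) \<longlonglongrightarrow> norm (L e - F (of_real s * e))"
      by (intro tendsto_intros)
    moreover have "\<forall>\<^sub>F n in sequentially. norm (F (of_real (r n) * e) - F (of_real s * e)) \<le> K * sqrt (1 - s)"
    proof -
      have "r \<longlonglongrightarrow> 1 - 0" unfolding r_def by (intro tendsto_intros LIMSEQ_inverse_real_of_nat)
      then have "\<forall>\<^sub>F n in sequentially. s < r n" using s by (intro order_tendstoD(1)) auto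
      then show ?thesis by eventually_elim (use b0[OF e s(1)] r in auto)
    qed
    ultimately show "norm (L e - F (of_real s * e)) \<le> K * sqrt (1 - s)"
      by (intro tendsto_upperbound) auto
  qed
qed

section \<open>The harmonic field with a given potential\<close>

text \<open>Repeated integration by parts of rho^2 cnj F''' in cnj z: each term cancels what the
  derivative of \<open>rho\<close> leaves over from its predecessor, as \<open>rho\<close> has
  derivative - z in cnj z. The holomorphic term -2 F is invisible to this derivative and makes the
  boundary value tangential: on the circle z^2 cnj F - F is z times an imaginary number.\<close>

definition potential_field :: "(complex \<Rightarrow> complex) \<Rightarrow> complex \<Rightarrow> complex" where
  "potential_field F z =
     (of_real ((rho z)\<^sup>2) * cnj (deriv (deriv F) z) + 2 * z * of_real (rho z) * cnj (deriv F z)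
       + 2 * z\<^sup>2 * cnj (F z) - 2 * F z) / 8"

lemma potential_field_continuous:
  assumes F: "F holomorphic_on disc"
  shows "continuous_on disc (potential_field F)"
proof -
  note c = holomorphic_on_imp_continuous_on
  have "continuous_on disc F" "continuous_on disc (deriv F)" "continuous_on disc (deriv (deriv F))"
    using F by (auto intro!: c holomorphic_deriv)
  then show ?thesis unfolding potential_field_def[abs_def] rho_def by (intro continuous_intros) auto
qed

text \<open>The first two terms are O(sqrt (1 - |z|)) by the growth bounds. In the radial part of
  the others z cnj F cancels against its conjugate up to a factor \<open>rho\<close>, so boundedness
  of F settles them; uniform convergence uses the radial limits of F as well.\<close>

lemma potential_field_boundary:
  assumes F: "F holomorphic_on disc"
    and q: "\<And>z. z \<in> disc \<Longrightarrow> norm (deriv (deriv (deriv F)) z) * (rho z)\<^sup>2 \<le> C"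
  shows "\<exists>Y. has_L2_extension (potential_field F) Y \<and> tangential Y"
    and "(radial (potential_field F) \<longlongrightarrow> 0) at_boundary"
    and "\<exists>B. \<forall>z\<in>disc. norm (potential_field F z) \<le> B"
proof -
  obtain K where K: "K \<ge> 0"
    and b2: "\<And>z. z \<in> disc \<Longrightarrow> norm (deriv (deriv F) z) * (1 - norm z) \<le> K"
    and b1: "\<And>z. z \<in> disc \<Longrightarrow> norm (deriv F z) * sqrt (1 - norm z) \<le> K"
    and b0: "\<And>e r s. norm e = 1 \<Longrightarrow> 0 \<le> s \<Longrightarrow> s \<le> r \<Longrightarrow> r < 1 \<Longrightarrow>
        norm (F (of_real r * e) - F (of_real s * e)) \<le> K * sqrt (1 - s)"
    using primitive_growth[OF F q] by blast
  obtain L where L: "\<And>e s. norm e = 1 \<Longrightarrow> 0 \<le> s \<Longrightarrow> s < 1 \<Longrightarrow> norm (L e - F (of_real s * e)) \<le> K * sqrt (1 - s)"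
    using radial_limits[of K F, OF K b0] by blast
  define M where "M = norm (F 0) + K"
  have LM: "norm (L e) \<le> M" if "norm e = 1" for e
    using L[OF that, of 0] norm_triangle_sub[of "L e" "F 0"] by (simp add: M_def)
  have FM: "norm (F z) \<le> M" if z: "z \<in> disc" for z
  proof -
    obtain r e where "z = of_real r * e" "norm e = 1" "norm z = r" "0 \<le> r" "r < 1"
      using disc_polar[OF z] by blast
    then show ?thesis
      using b0[of e 0 r] norm_triangle_sub[of "F z" "F 0"] by (simp add: M_def)
  qed
  have M: "M \<ge> 0" using K by (simp add: M_def)
  have s: "sqrt (1 - norm z) \<ge> 0" "sqrt (1 - norm z) \<le> 1" "(sqrt (1 - norm z))\<^sup>2 = 1 - norm z"
      "1 - norm z \<le> sqrt (1 - norm z)" if "z \<in> disc" for z :: complex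
  proof -
    show 1: "sqrt (1 - norm z) \<ge> 0" "sqrt (1 - norm z) \<le> 1" "(sqrt (1 - norm z))\<^sup>2 = 1 - norm z"
      using that by auto
    then show "1 - norm z \<le> sqrt (1 - norm z)"
      using power_decreasing[of 1 2 "sqrt (1 - norm z)"] by simp
  qed
  have t2: "norm (of_real ((rho z)\<^sup>2) * cnj (deriv (deriv F) z)) \<le> 4 * K * sqrt (1 - norm z)"
    if z: "z \<in> disc" for z
  proof -
    have "norm (of_real ((rho z)\<^sup>2) * cnj (deriv (deriv F) z)) = (rho z)\<^sup>2 * norm (deriv (deriv F) z)"
      by (simp add: norm_mult norm_power)
    also have "\<dots> \<le> (2 * (1 - norm z))\<^sup>2 * norm (deriv (deriv F) z)"
      using rho_bounds[of z] rho_pos[OF z] z by (intro mult_right_mono power_mono) auto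
    also have "\<dots> = 4 * (1 - norm z) * (norm (deriv (deriv F) z) * (1 - norm z))"
      by (simp add: power2_eq_square algebra_simps)
    also have "\<dots> \<le> 4 * sqrt (1 - norm z) * K"
      using b2[OF z] s[OF z] z K by (intro mult_mono) auto
    finally show ?thesis by (simp add: mult_ac)
  qed
  have t1: "norm (2 * z * of_real (rho z) * cnj (deriv F z)) \<le> 4 * K * sqrt (1 - norm z)"
    if z: "z \<in> disc" for z
  proof -
    have "norm (2 * z * of_real (rho z) * cnj (deriv F z)) = 2 * norm z * rho z * norm (deriv F z)"
      using rho_pos[OF z] by (simp add: norm_mult)
    also have "\<dots> \<le> 2 * 1 * (2 * (1 - norm z)) * norm (deriv F z)"
      using rho_bounds[of z] rho_pos[OF z] z by (intro mult_mono) auto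
    also have "\<dots> = 4 * sqrt (1 - norm z) * (norm (deriv F z) * sqrt (1 - norm z))"
      using s(3)[OF z] by (simp add: power2_eq_square)
    also have "\<dots> \<le> 4 * sqrt (1 - norm z) * K"
      using b1[OF z] s[OF z] by (intro mult_left_mono) auto
    finally show ?thesis by (simp add: mult_ac)
  qed
  have rad: "\<bar>radial (potential_field F) z\<bar> \<le> (K + M) * sqrt (1 - norm z)" if z: "z \<in> disc" for z
  proof -
    define A where "A = of_real ((rho z)\<^sup>2) * cnj (deriv (deriv F) z)"
    define B where "B = 2 * z * of_real (rho z) * cnj (deriv F z)"
    have zz: "z * cnj z = of_real (1 - rho z)" using rho_of_real[of z] by (simp add: algebra_simps)
    define w where "w = z * cnj (F z)"
    \<comment> \<open>With w = z cnj F this is 2 |z|^2 w - 2 cnj w, whose real part is -2 rho Re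
      w.\<close>
    have E: "cnj z * (2 * z\<^sup>2 * cnj (F z) - 2 * F z) = 2 * (z * cnj z) * w - 2 * cnj w"
      by (simp add: w_def power2_eq_square algebra_simps)
    have "Re (2 * of_real (1 - rho z) * w - 2 * cnj w) = - 2 * rho z * Re w"
      by (simp add: algebra_simps)
    then have e: "Re (cnj z * (2 * z\<^sup>2 * cnj (F z) - 2 * F z)) = - 2 * rho z * Re (z * cnj (F z))"
      unfolding E zz w_def .
    define G where "G = 2 * z\<^sup>2 * cnj (F z) - 2 * F z"
    have pf: "potential_field F z = (A + B + G) / 8"
      by (simp add: potential_field_def A_def B_def G_def)
    have "8 * radial (potential_field F) z = Re (cnj z * (A + B)) + Re (cnj z * G)"
      unfolding radial_def pf by (simp add: algebra_simps add_divide_distrib)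
    then have "8 * radial (potential_field F) z = Re (cnj z * (A + B)) - 2 * rho z * Re (z * cnj (F z))"
      unfolding G_def e by simp
    moreover have "\<bar>Re (cnj z * (A + B))\<bar> \<le> 1 * (4 * K * sqrt (1 - norm z) + 4 * K * sqrt (1 - norm z))"
    proof -
      have "norm (A + B) \<le> 4 * K * sqrt (1 - norm z) + 4 * K * sqrt (1 - norm z)"
        using t2[OF z] t1[OF z] norm_triangle_ineq[of A B] unfolding A_def B_def by linarith
      then have "norm (cnj z * (A + B)) \<le> 1 * (4 * K * sqrt (1 - norm z) + 4 * K * sqrt (1 - norm z))"
        unfolding norm_mult using z by (intro mult_mono) auto
      then show ?thesis using abs_Re_le_cmod[of "cnj z * (A + B)"] by linarith
    qed
    moreover have "\<bar>2 * rho z * Re (z * cnj (F z))\<bar> \<le> 4 * sqrt (1 - norm z) * M"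
    proof -
      have "\<bar>Re (z * cnj (F z))\<bar> \<le> 1 * M"
        using abs_Re_le_cmod[of "z * cnj (F z)"] FM[OF z] z M
          mult_mono[of "norm z" 1 "norm (F z)" M] by (simp add: norm_mult)
      moreover have "2 * rho z \<le> 4 * sqrt (1 - norm z)"
        using rho_bounds[of z] s(4)[OF z] z by simp
      ultimately have "2 * rho z * \<bar>Re (z * cnj (F z))\<bar> \<le> 4 * sqrt (1 - norm z) * M"
        using s(1)[OF z] M mult_mono[of "2 * rho z" "4 * sqrt (1 - norm z)" "\<bar>Re (z * cnj (F z))\<bar>" M] by simp
      then show ?thesis using rho_pos[OF z] by (simp add: abs_mult)
    qed
    moreover have "8 * \<bar>x\<bar> \<le> p + q" if "8 * x = a - b" "\<bar>a\<bar> \<le> p" "\<bar>b\<bar> \<le> q" for x a b p q :: real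
      using that by linarith
    ultimately have "8 * \<bar>radial (potential_field F) z\<bar> \<le>
        1 * (4 * K * sqrt (1 - norm z) + 4 * K * sqrt (1 - norm z)) + 4 * sqrt (1 - norm z) * M"
      by blast
    moreover have "sqrt (1 - norm z) * M \<ge> 0" using s[OF z] M by simp
    ultimately show ?thesis by (simp add: algebra_simps)
  qed
  show van: "(radial (potential_field F) \<longlongrightarrow> 0) at_boundary"
  proof (rule Lim_null_comparison)
    have "((\<lambda>r::real. (K + M) * sqrt (1 - r)) \<longlongrightarrow> (K + M) * sqrt (1 - 1)) (at_left 1)"
      by (intro tendsto_intros)
    from filterlim_compose[OF this filterlim_filtercomap, of norm]
    show "((\<lambda>z::complex. (K + M) * sqrt (1 - norm z)) \<longlongrightarrow> 0) at_boundary" by simp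
    show "\<forall>\<^sub>F z in at_boundary. norm (radial (potential_field F) z) \<le> (K + M) * sqrt (1 - norm z)"
      using eventually_at_boundary_disc by eventually_elim (use rad in simp)
  qed
  show "\<exists>B. \<forall>z\<in>disc. norm (potential_field F z) \<le> B"
  proof (intro exI ballI)
    fix z :: complex assume z: "z \<in> disc"
    have "norm (2 * z\<^sup>2 * cnj (F z)) \<le> 2 * 1 * M"
      unfolding norm_mult norm_power using z FM[OF z] by (intro mult_mono) (auto simp: power_le_one)
    moreover have "norm (2 * F z) \<le> 2 * M" using FM[OF z] by (simp add: norm_mult)
    moreover have "4 * K * sqrt (1 - norm z) \<le> 4 * K" using s[OF z] K by (simp add: mult_left_le)
    ultimately have "norm (of_real ((rho z)\<^sup>2) * cnj (deriv (deriv F) z) + 2 * z * of_real (rho z) * cnj (deriv F z)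
       + 2 * z\<^sup>2 * cnj (F z) - 2 * F z) \<le> 4 * K + 4 * K + 2 * M + 2 * M"
      using t2[OF z] t1[OF z] by (intro norm_triangle_le norm_triangle_le_diff add_mono) linarith+
    then show "norm (potential_field F z) \<le> (4 * K + 4 * K + 2 * M + 2 * M) / 8"
      unfolding potential_field_def norm_divide by simp
  qed
  \<comment> \<open>At radius 1 the terms carrying \<open>rho\<close> are gone and F is replaced by
    its radial limit.\<close>
  define Y where "Y e = (2 * e\<^sup>2 * cnj (L e) - 2 * L e) / 8" for e
  have est: "norm (potential_field F (of_real r * e) - Y e) \<le> (2 * K + M) * sqrt (1 - r)"
    if e: "norm e = 1" and r: "0 < r" "r < 1" for e r
  proof -
    define z where "z = of_real r * e"
    have z: "z \<in> disc" "norm z = r" using e r by (auto simp: z_def norm_mult)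
    have Lz: "norm (L e - F z) \<le> K * sqrt (1 - r)" using L[OF e, of r] r by (simp add: z_def)
    have a: "norm (2 * z\<^sup>2 * cnj (F z) - 2 * e\<^sup>2 * cnj (L e)) \<le> 2 * K * sqrt (1 - r) + 4 * M * sqrt (1 - r)"
    proof -
      have "2 * z\<^sup>2 * cnj (F z) - 2 * e\<^sup>2 * cnj (L e) =
          2 * e\<^sup>2 * (of_real (r\<^sup>2) * cnj (F z - L e)) - 2 * e\<^sup>2 * (of_real (1 - r\<^sup>2) * cnj (L e))"
        by (simp add: z_def algebra_simps power_mult_distrib)
      also have "norm \<dots> \<le> norm (2 * e\<^sup>2 * (of_real (r\<^sup>2) * cnj (F z - L e))) + norm (2 * e\<^sup>2 * (of_real (1 - r\<^sup>2) * cnj (L e)))"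
        by (rule norm_triangle_ineq4)
      also have "\<dots> = 2 * (r\<^sup>2 * norm (L e - F z)) + 2 * (\<bar>1 - r\<^sup>2\<bar> * norm (L e))"
        unfolding norm_mult norm_power norm_of_real complex_mod_cnj e by (simp add: norm_minus_commute)
      also have "\<dots> \<le> 2 * (1 * (K * sqrt (1 - r))) + 2 * ((2 * sqrt (1 - r)) * M)"
      proof -
        have "\<bar>1 - r\<^sup>2\<bar> \<le> 2 * sqrt (1 - r)"
          using rho_bounds[of z] rho_pos[OF z(1)] s(4)[OF z(1)] z r by (simp add: rho_def)
        then show ?thesis
          using Lz LM[OF e] r by (intro add_mono mult_left_mono mult_mono) (auto simp: power_le_one)
      qed
      finally show ?thesis by (simp add: algebra_simps)
    qed
    have b: "norm (2 * L e - 2 * F z) \<le> 2 * K * sqrt (1 - r)"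
    proof -
      have "2 * L e - 2 * F z = 2 * (L e - F z)" by (simp add: algebra_simps)
      then show ?thesis using Lz by (simp only: norm_mult) simp
    qed
    have "8 * (potential_field F z - Y e) = (of_real ((rho z)\<^sup>2) * cnj (deriv (deriv F) z) + 2 * z * of_real (rho z) * cnj (deriv F z))
       + ((2 * z\<^sup>2 * cnj (F z) - 2 * e\<^sup>2 * cnj (L e)) + (2 * L e - 2 * F z))"
      unfolding potential_field_def Y_def by (simp add: algebra_simps add_divide_distrib diff_divide_distrib)
    also have "norm \<dots> \<le> (4 * K * sqrt (1 - r) + 4 * K * sqrt (1 - r)) +
        ((2 * K * sqrt (1 - r) + 4 * M * sqrt (1 - r)) + 2 * K * sqrt (1 - r))"
      using t2[OF z(1)] t1[OF z(1)] a b z(2) by (intro norm_triangle_le add_mono) simp_all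
    finally have "8 * norm (potential_field F z - Y e) \<le> (12 * K + 4 * M) * sqrt (1 - r)"
      by (simp only: norm_mult) (simp add: algebra_simps)
    moreover have "(12 * K + 4 * M) * sqrt (1 - r) \<le> (8 * (2 * K + M)) * sqrt (1 - r)"
      using K M r by (intro mult_right_mono) auto
    ultimately show ?thesis unfolding z_def mult.assoc by linarith
  qed
  have "uniform_limit (sphere 0 1) (\<lambda>r z. potential_field F (of_real r * z)) Y (at_left 1)"
    unfolding uniform_limit_iff
  proof (intro allI impI)
    fix d :: real assume d: "d > 0"
    have "((\<lambda>r::real. (2 * K + M) * sqrt (1 - r)) \<longlongrightarrow> (2 * K + M) * sqrt (1 - 1)) (at_left 1)"
      by (intro tendsto_intros)
    then have "\<forall>\<^sub>F r in at_left 1. (2 * K + M) * sqrt (1 - r) < d"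
      using d by (intro order_tendstoD(2)) auto
    then show "\<forall>\<^sub>F r in at_left 1. \<forall>e\<in>sphere 0 1. dist (potential_field F (of_real r * e)) (Y e) < d"
      using eventually_at_left_1
    proof eventually_elim
      case (elim r)
      then show ?case using est[of _ r] by (fastforce simp: dist_norm)
    qed
  qed
  then show "\<exists>Y. has_L2_extension (potential_field F) Y \<and> tangential Y"
    using uniform_limit_L2_extension[OF potential_field_continuous[OF F] _ van] by blast
qed


section \<open>The equation satisfied by the potential field\<close>

lemma has_wirtinger_eqI:
  "has_wirtinger f a b z \<Longrightarrow> a = a' \<Longrightarrow> b = b' \<Longrightarrow> has_wirtinger f a' b' z"
  by simp

lemma has_wirtinger_holomorphic:
  assumes "G holomorphic_on S" "open S" "z \<in> S"
  shows "has_wirtinger G (deriv G z) 0 z"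
  unfolding has_wirtinger_0_iff using assms holomorphic_derivI by blast

lemma has_wirtinger_rho: "has_wirtinger (\<lambda>z. of_real (rho z)) (- cnj z) (- z) z"
proof -
  have "has_wirtinger (\<lambda>z. 1 - z * cnj z) (- cnj z) (- z) z"
    by (rule has_wirtinger_eqI, (rule has_wirtinger_intros)+) simp_all
  then show ?thesis by (simp only: rho_of_real)
qed

lemma potential_field_has_wirtinger:
  assumes F: "F holomorphic_on disc" and z: "z \<in> disc"
  shows "has_wirtinger (potential_field F)
    ((- 2 * of_real (rho z) * cnj z * cnj (deriv (deriv F) z) + 2 * of_real (rho z) * cnj (deriv F z)
       - 2 * z * cnj z * cnj (deriv F z) + 4 * z * cnj (F z) - 2 * deriv F z) / 8)
    (of_real ((rho z)\<^sup>2) * cnj (deriv (deriv (deriv F)) z) / 8) z"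
proof -
  have h: "has_wirtinger F (deriv F z) 0 z" "has_wirtinger (deriv F) (deriv (deriv F) z) 0 z"
    "has_wirtinger (deriv (deriv F)) (deriv (deriv (deriv F)) z) 0 z"
    using F z by (auto intro!: has_wirtinger_holomorphic[where S=disc] holomorphic_deriv)
  \<comment> \<open>Powers and the division by 8 are rewritten as products, the form that the
    derivative rules match.\<close>
  have e: "potential_field F = (\<lambda>z. (1 / 8) *
     (of_real (rho z) * of_real (rho z) * cnj (deriv (deriv F) z) + 2 * z * of_real (rho z) * cnj (deriv F z)
       + 2 * (z * z) * cnj (F z) - 2 * F z))"
    by (auto simp: potential_field_def power2_eq_square)
  show ?thesis
    unfolding e
    by (rule has_wirtinger_eqI, (rule h has_wirtinger_rho has_wirtinger_intros)+)
      (simp_all add: field_simps power2_eq_square)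
qed

text \<open>Both are the mixed second derivative of the potential field. Its value \<open>C\<close>
  is plain from the second: the z derivative of rho^2 times an antiholomorphic function falls on
  rho^2 alone.\<close>

lemma potential_field_second_derivatives:
  assumes F: "F holomorphic_on disc" and z: "z \<in> disc"
  defines "C \<equiv> - of_real (rho z) * cnj z * cnj (deriv (deriv (deriv F)) z) / 4"
  shows "\<exists>a. has_wirtinger (\<lambda>z. (- 2 * of_real (rho z) * cnj z * cnj (deriv (deriv F) z) + 2 * of_real (rho z) * cnj (deriv F z)
       - 2 * z * cnj z * cnj (deriv F z) + 4 * z * cnj (F z) - 2 * deriv F z) / 8) a C z"
    and "\<exists>b. has_wirtinger (\<lambda>z. of_real ((rho z)\<^sup>2) * cnj (deriv (deriv (deriv F)) z) / 8) C b z"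
proof -
  have h: "has_wirtinger F (deriv F z) 0 z" "has_wirtinger (deriv F) (deriv (deriv F) z) 0 z"
    "has_wirtinger (deriv (deriv F)) (deriv (deriv (deriv F)) z) 0 z"
    "has_wirtinger (deriv (deriv (deriv F))) (deriv (deriv (deriv (deriv F))) z) 0 z"
    using F z by (auto intro!: has_wirtinger_holomorphic[where S=disc] holomorphic_deriv)
  \<comment> \<open>The rules instantiate both derivatives; only the one that matters is then
    compared with \<open>C\<close>.\<close>
  have "\<exists>a b. has_wirtinger (\<lambda>z. (1 / 8) * (- 2 * of_real (rho z) * cnj z * cnj (deriv (deriv F) z) + 2 * of_real (rho z) * cnj (deriv F z)
       - 2 * z * cnj z * cnj (deriv F z) + 4 * z * cnj (F z) - 2 * deriv F z)) a b z \<and> b = C"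
    by (intro exI conjI, (rule h has_wirtinger_rho has_wirtinger_intros)+)
      (simp add: C_def field_simps)
  then show "\<exists>a. has_wirtinger (\<lambda>z. (- 2 * of_real (rho z) * cnj z * cnj (deriv (deriv F) z) + 2 * of_real (rho z) * cnj (deriv F z)
       - 2 * z * cnj z * cnj (deriv F z) + 4 * z * cnj (F z) - 2 * deriv F z) / 8) a C z"
    by auto
  have "\<exists>a b. has_wirtinger (\<lambda>z. (1 / 8) * (of_real (rho z) * of_real (rho z) * cnj (deriv (deriv (deriv F)) z))) a b z \<and> a = C"
    by (intro exI conjI, (rule h has_wirtinger_rho has_wirtinger_intros)+)
      (simp add: C_def field_simps)
  then show "\<exists>b. has_wirtinger (\<lambda>z. of_real ((rho z)\<^sup>2) * cnj (deriv (deriv (deriv F)) z) / 8) C b z"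
    by (auto simp: power2_eq_square)
qed

section \<open>Smoothness and harmonicity\<close>

lemma Ck_on_cnj:
  "open S \<Longrightarrow> Ck_on k S f \<Longrightarrow> Ck_on k S (\<lambda>x. cnj (f x))"
  by (rule Ck_on_linear_compose[OF bounded_linear_cnj])

lemma Ck_on_rho: "Ck_on k disc (\<lambda>z. complex_of_real (rho z))"
  unfolding rho_of_real
  by (intro Ck_on_diff Ck_on_mult Ck_on_const Ck_on_cnj Ck_on_bounded_linear[OF bounded_linear_ident] open_ball)

lemma potential_field_Ck:
  assumes F: "F holomorphic_on disc"
  shows "Ck_on k disc (potential_field F)"
proof -
  have e: "potential_field F = (\<lambda>z. (1 / 8) *
     (of_real (rho z) * of_real (rho z) * cnj (deriv (deriv F) z) + 2 * z * of_real (rho z) * cnj (deriv F z)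
       + 2 * (z * z) * cnj (F z) - 2 * F z))"
    by (auto simp: potential_field_def power2_eq_square)
  show ?thesis unfolding e
    by (intro Ck_on_add Ck_on_diff Ck_on_mult Ck_on_const Ck_on_cnj Ck_on_rho open_ball
        Ck_on_bounded_linear[OF bounded_linear_ident] Ck_on_holomorphic holomorphic_deriv F)
qed

text \<open>The difference quotient at 0 is \<open>g t\<close> itself, so continuity of
  \<open>g\<close> replaces differentiability. Velocity and derivative of the tension field are both
  read off from an explicit factor t in this way.\<close>

lemma has_vector_derivative_linear_factor:
  fixes g :: "real \<Rightarrow> 'a::real_normed_vector"
  assumes "(g \<longlongrightarrow> g 0) (at 0 within S)"
  shows "((\<lambda>t. c + t *\<^sub>R g t) has_vector_derivative g 0) (at 0 within S)"
proof -
  have "((\<lambda>y. (1 / norm (y - 0)) *\<^sub>R ((c + y *\<^sub>R g y) - ((c + 0 *\<^sub>R g 0) + (y - 0) *\<^sub>R g 0))) \<longlongrightarrow> 0) (at 0 within S)"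
  proof (rule Lim_null_comparison)
    show "((\<lambda>t. norm (g t - g 0)) \<longlongrightarrow> 0) (at 0 within S)"
      using assms tendsto_norm_zero LIM_zero by blast
    have "norm ((1 / norm (y - 0)) *\<^sub>R ((c + y *\<^sub>R g y) - ((c + 0 *\<^sub>R g 0) + (y - 0) *\<^sub>R g 0))) \<le> norm (g y - g 0)" for y
    proof -
      have "(c + y *\<^sub>R g y) - ((c + 0 *\<^sub>R g 0) + (y - 0) *\<^sub>R g 0) = y *\<^sub>R (g y - g 0)"
        by (simp add: scaleR_right_diff_distrib)
      then show ?thesis by simp
    qed
    then show "\<forall>\<^sub>F y in at 0 within S. norm ((1 / norm (y - 0)) *\<^sub>R ((c + y *\<^sub>R g y) - ((c + 0 *\<^sub>R g 0) + (y - 0) *\<^sub>R g 0))) \<le> norm (g y - g 0)"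
      by simp
  qed
  then show ?thesis
    unfolding has_vector_derivative_def has_derivative_within by (simp add: bounded_linear_scaleR_left)
qed

text \<open>
  The maps \<open>z \<mapsto> z + t X z\<close> may leave the disc for every \<open>t > 0\<close>, since \<open>X\<close> need not vanish
  at the boundary; the damping factor \<open>1 / (1 + t\<^sup>2 |X|\<^sup>2 / rho\<^sup>2)\<close> keeps the displacement at most \<open>rho / 2\<close>.
\<close>

definition damped :: "(complex \<Rightarrow> complex) \<Rightarrow> real \<times> complex \<Rightarrow> complex" where
  "damped X p = X (snd p) * inverse (1 + of_real (fst p) * of_real (fst p) *
     (X (snd p) * cnj (X (snd p)) * (inverse (of_real (rho (snd p))) * inverse (of_real (rho (snd p))))))"

text \<open>With products and \<open>cnj\<close> the denominator of \<open>damped\<close> stays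
  within the \<open>Ck_on\<close> calculus; written with the norm it is visibly a real number at
  least 1.\<close>

lemma damped_denominator:
  "1 + of_real t * of_real t * (x * cnj x * (inverse (of_real r) * inverse (of_real r))) =
     complex_of_real (1 + (t * norm x / r)\<^sup>2)"
proof -
  have "x * cnj x = of_real (norm x) * of_real (norm x)"
    using complex_norm_square[of x] by (simp add: power2_eq_square)
  then show ?thesis
    by (simp add: power2_eq_square field_simps)
qed

lemma damped_0 [simp]: "damped X (0, z) = X z"
  by (simp add: damped_def)

lemma damped_Ck:
  assumes "\<And>k. Ck_on k disc X"
  shows "Ck_on k (UNIV \<times> disc) (damped X)"
proof -
  have o: "open ((UNIV :: real set) \<times> disc)" by (simp add: open_Times)
  have X: "Ck_on k ((UNIV :: real set) \<times> disc) (\<lambda>p. X (snd p))"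
    by (rule Ck_on_compose_snd[OF open_ball assms])
  have r: "Ck_on k ((UNIV :: real set) \<times> disc) (\<lambda>p. inverse (complex_of_real (rho (snd p))))"
  proof (rule Ck_on_inverse[OF o])
    show "Ck_on k ((UNIV :: real set) \<times> disc) (\<lambda>p. complex_of_real (rho (snd p)))"
      by (rule Ck_on_compose_snd[OF open_ball Ck_on_rho])
    show "complex_of_real (rho (snd p)) \<noteq> 0" if "p \<in> (UNIV :: real set) \<times> disc" for p
      using rho_pos[of "snd p"] that by auto
  qed
  have t: "Ck_on k ((UNIV :: real set) \<times> disc) (\<lambda>p. complex_of_real (fst p))"
    by (rule Ck_on_bounded_linear, rule bounded_linear_compose[OF bounded_linear_of_real bounded_linear_fst])
  show ?thesis
    unfolding damped_def[abs_def]
  proof (rule Ck_on_mult[OF o X], rule Ck_on_inverse[OF o])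
    show "Ck_on k (UNIV \<times> disc) (\<lambda>p. 1 + complex_of_real (fst p) * complex_of_real (fst p) *
     (X (snd p) * cnj (X (snd p)) * (inverse (of_real (rho (snd p))) * inverse (of_real (rho (snd p))))))"
      by (intro Ck_on_add Ck_on_mult Ck_on_const Ck_on_cnj o X r t)
    fix p :: "real \<times> complex"
    have "1 + (fst p * norm (X (snd p)) / rho (snd p))\<^sup>2 > 0" by (simp add: add_pos_nonneg)
    then show "1 + complex_of_real (fst p) * complex_of_real (fst p) *
     (X (snd p) * cnj (X (snd p)) * (inverse (of_real (rho (snd p))) * inverse (of_real (rho (snd p))))) \<noteq> 0"
      unfolding damped_denominator by (metis less_irrefl of_real_eq_0_iff)
  qed
qed

lemma damped_in_disc:
  assumes z: "z \<in> disc" and t: "t \<ge> 0"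
  shows "z + of_real t * damped X (t, z) \<in> disc"
proof -
  have r: "rho z > 0" by (rule rho_pos[OF z])
  define a where "a = t * norm (X z) / rho z"
  have a: "1 + a\<^sup>2 > 0" "a \<ge> 0" using r t by (auto simp: a_def add_pos_nonneg)
  have "damped X (t, z) = X z / of_real (1 + a\<^sup>2)"
    unfolding damped_def fst_conv snd_conv damped_denominator a_def[symmetric] by (simp add: divide_inverse)
  then have "norm (of_real t * damped X (t, z)) = t * norm (X z) / (1 + a\<^sup>2)"
    using t a by (simp only: norm_mult norm_divide norm_of_real) simp
  also have "\<dots> = rho z * (a / (1 + a\<^sup>2))" using r by (simp add: a_def)
  also have "\<dots> \<le> rho z * (1 / 2)"
  proof (rule mult_left_mono)
    have "2 * a \<le> 1 + a\<^sup>2" using zero_le_power2[of "a - 1"] unfolding power2_diff by simp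
    then show "a / (1 + a\<^sup>2) \<le> 1 / 2" using a by (simp add: field_simps)
  qed (use r in auto)
  \<comment> \<open>\<open>rho\<close> factors into 1 - |z| and 1 + |z| < 2, so half of it is
    strictly less than the distance to the circle.\<close>
  also have "\<dots> < 1 - norm z"
  proof -
    have n: "norm z < 1" using z by simp
    have "rho z = (1 - norm z) * (1 + norm z)" by (simp add: rho_def power2_eq_square algebra_simps)
    also have "\<dots> < (1 - norm z) * 2" using n by (intro mult_strict_left_mono) auto
    finally show ?thesis by simp
  qed
  finally show ?thesis using norm_triangle_ineq[of z "of_real t * damped X (t, z)"] by simp
qed

text \<open>The condition \<open>h\<close> says that B / rho^2 has zero derivative in z, that is,
  that the (2,0)-part of the Lie derivative is holomorphic. It is the linearised tension field of z
  + t X: up to the factor rho^2 / 4, the Laplacian contributes 4 C and the target connection 8 cnj z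
  B / rho.\<close>

lemma harmonic_field_criterion:
  assumes X: "\<And>k. Ck_on k disc X"
    and AB: "\<And>z. z \<in> disc \<Longrightarrow> has_wirtinger X (A z) (B z) z"
    and A: "\<And>z. z \<in> disc \<Longrightarrow> \<exists>a. has_wirtinger A a (C z) z"
    and B: "\<And>z. z \<in> disc \<Longrightarrow> \<exists>b. has_wirtinger B (C z) b z"
    and h: "\<And>z. z \<in> disc \<Longrightarrow> of_real (rho z) * C z = - 2 * cnj z * B z"
  shows "harmonic_field_on disc X"
proof -
  define H where "H = damped X"
  define W where "W = (UNIV :: real set) \<times> disc"
  have oW: "open W" by (simp add: W_def open_Times)
  have HC: "Ck_on k W H" for k unfolding H_def W_def by (rule damped_Ck[OF X])
  define \<phi> where "\<phi> t z = z + of_real t * H (t, z)" for t z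
  define H1 where "H1 v p = frechet_derivative H (at p) (0, v)" for v p
  define H2 where "H2 v p = frechet_derivative (H1 v) (at p) (0, v)" for v p
  have H1C: "Ck_on k W (H1 v)" for k v
    using HC[of "Suc k"] unfolding H1_def[abs_def] by simp
  have H2C: "Ck_on k W (H2 v)" for k v
    using H1C[of "Suc k" v] unfolding H2_def[abs_def] by simp
  have Hd: "H differentiable (at (t, z))" if "z \<in> disc" for t z
    using HC[of 1] that by (simp add: W_def)
  have H1d: "H1 v differentiable (at (t, z))" if "z \<in> disc" for t z v
    using H1C[of 1 v] that by (simp add: W_def)
  have cont: "((\<lambda>t. G (t, z)) \<longlongrightarrow> G (0, z)) (at 0 within S)"
    if "Ck_on 0 W G" "z \<in> disc" for G :: "real \<times> complex \<Rightarrow> complex" and z S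
  proof -
    have "isCont G (0, z)"
      using that oW by (simp add: continuous_on_eq_continuous_at W_def)
    moreover have "((\<lambda>t. (t, z)) \<longlongrightarrow> (0, z)) (at 0 within S)" by (intro tendsto_intros)
    ultimately show ?thesis by (rule isCont_tendsto_compose)
  qed
  have d\<phi>: "(\<phi> t has_derivative (\<lambda>v. v + of_real t * H1 v (t, z))) (at z)" if z: "z \<in> disc" for t z
  proof -
    have "((\<lambda>x. H (t, x)) has_derivative frechet_derivative (\<lambda>x. H (t, x)) (at z)) (at z)"
      using frechet_derivative_slice(2)[OF Hd[OF z]] frechet_derivative_works by blast
    also have "frechet_derivative (\<lambda>x. H (t, x)) (at z) = (\<lambda>v. H1 v (t, z))"
      using frechet_derivative_slice(1)[OF Hd[OF z]] by (simp add: H1_def fun_eq_iff)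
    finally have "((\<lambda>x. x + of_real t * H (t, x)) has_derivative (\<lambda>v. v + of_real t * H1 v (t, z))) (at z)"
      by (intro has_derivative_add has_derivative_ident has_derivative_mult_right)
    then show ?thesis by (simp add: \<phi>_def[abs_def])
  qed
  have f\<phi>: "frechet_derivative (\<phi> t) (at z) v = v + of_real t * H1 v (t, z)" if "z \<in> disc" for t z v
    by (rule frechet_derivative_eq[OF d\<phi>[OF that]])
  have f2\<phi>: "frechet_derivative (\<lambda>x. frechet_derivative (\<phi> t) (at x) v) (at z) v = of_real t * H2 v (t, z)"
    if z: "z \<in> disc" for t z v
  proof -
    have "((\<lambda>x. H1 v (t, x)) has_derivative frechet_derivative (\<lambda>x. H1 v (t, x)) (at z)) (at z)"
      using frechet_derivative_slice(2)[OF H1d[OF z]] frechet_derivative_works by blast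
    then have "((\<lambda>x. v + of_real t * H1 v (t, x)) has_derivative
        (\<lambda>u. 0 + of_real t * frechet_derivative (\<lambda>x. H1 v (t, x)) (at z) u)) (at z)"
      by (intro has_derivative_add has_derivative_const has_derivative_mult_right)
    then have "frechet_derivative (\<lambda>x. v + of_real t * H1 v (t, x)) (at z) v =
        0 + of_real t * frechet_derivative (\<lambda>x. H1 v (t, x)) (at z) v"
      by (rule frechet_derivative_eq)
    also have "frechet_derivative (\<lambda>x. H1 v (t, x)) (at z) v = H2 v (t, z)"
      unfolding H2_def by (rule frechet_derivative_slice(1)[OF H1d[OF z]])
    finally show ?thesis
      using frechet_derivative_cong_open[of disc z "\<lambda>x. frechet_derivative (\<phi> t) (at x) v" "\<lambda>x. v + of_real t * H1 v (t, x)"]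
        z f\<phi> by simp
  qed
  have in_disc: "\<phi> t z \<in> disc" if "z \<in> disc" "t \<ge> 0" for t z
    unfolding \<phi>_def H_def by (rule damped_in_disc[OF that])
  have fX: "H1 v (0, z) = A z * v + B z * cnj v" if z: "z \<in> disc" for z v
  proof -
    have "H1 v (0, z) = frechet_derivative (\<lambda>x. H (0, x)) (at z) v"
      unfolding H1_def by (rule frechet_derivative_slice(1)[OF Hd[OF z], symmetric])
    also have "(\<lambda>x. H (0, x)) = X" by (simp add: H_def)
    also have "frechet_derivative X (at z) v = A z * v + B z * cnj v"
      using AB[OF z] unfolding has_wirtinger_def by (rule frechet_derivative_eq)
    finally show ?thesis .
  qed
  \<comment> \<open>The sum over the two coordinate directions is the Laplacian, four times the
    mixed Wirtinger derivative.\<close>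
  have f2X: "H2 1 (0, z) + H2 \<i> (0, z) = 4 * C z" if z: "z \<in> disc" for z
  proof -
    obtain a b where ab: "has_wirtinger A a (C z) z" "has_wirtinger B (C z) b z"
      using A[OF z] B[OF z] by blast
    have "H2 v (0, z) = (a * v + C z * cnj v) * v + (C z * v + b * cnj v) * cnj v" for v
    proof -
      have "H2 v (0, z) = frechet_derivative (\<lambda>x. H1 v (0, x)) (at z) v"
        unfolding H2_def by (rule frechet_derivative_slice(1)[OF H1d[OF z], symmetric])
      also have "frechet_derivative (\<lambda>x. H1 v (0, x)) (at z) =
          frechet_derivative (\<lambda>x. A x * v + B x * cnj v) (at z)"
        by (rule frechet_derivative_cong_open[OF open_ball z]) (use fX in auto)
      also have "frechet_derivative (\<lambda>x. A x * v + B x * cnj v) (at z) v =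
          (a * v + C z * cnj v) * v + (C z * v + b * cnj v) * cnj v"
        using ab unfolding has_wirtinger_def
        by (intro frechet_derivative_eq has_derivative_add has_derivative_mult_left)
      finally show ?thesis .
    qed
    from this[of 1] this[of \<i>] show ?thesis by (simp add: algebra_simps)
  qed
  have tens: "((\<lambda>t. tension (\<phi> t) z) has_vector_derivative 0) (at 0 within {0..<1})" if z: "z \<in> disc" for z
  proof -
    \<comment> \<open>The tension field divided by t. The division is exact because the squares of
      the two first derivatives, 1 and \<open>\<i>\<close> at t = 0, cancel there.\<close>
    define g where "g t = of_real ((rho z)\<^sup>2 / 4) * (H2 1 (t, z) + H2 \<i> (t, z) +
      2 * cnj (\<phi> t z) / of_real (rho (\<phi> t z)) *
        (2 * H1 1 (t, z) + 2 * \<i> * H1 \<i> (t, z) + of_real t * ((H1 1 (t, z))\<^sup>2 + (H1 \<i> (t, z))\<^sup>2)))" for t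
    have g: "tension (\<phi> t) z = 0 + t *\<^sub>R g t" if "t \<in> {0..<1}" for t
    proof -
      have 1: "\<phi> t differentiable (at z)" using d\<phi>[OF z] by (auto simp: differentiable_def)
      have 2: "\<phi> t z \<in> disc" using in_disc[OF z] that by simp
      have 3: "(1 + of_real t * H1 1 (t, z))\<^sup>2 + (\<i> + of_real t * H1 \<i> (t, z))\<^sup>2 =
         of_real t * (2 * H1 1 (t, z) + 2 * \<i> * H1 \<i> (t, z) + of_real t * ((H1 1 (t, z))\<^sup>2 + (H1 \<i> (t, z))\<^sup>2))"
        by (simp add: power2_eq_square algebra_simps)
      show ?thesis
        unfolding tension_eq[OF z 1 2] f\<phi>[OF z] f2\<phi>[OF z] 3 g_def
        by (simp add: scaleR_conv_of_real algebra_simps)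
    qed
    have \<phi>0: "\<phi> 0 z = z" by (simp add: \<phi>_def)
    have c\<phi>: "((\<lambda>t. \<phi> t z) \<longlongrightarrow> \<phi> 0 z) (at 0 within {0..<1})"
      unfolding \<phi>_def by (intro tendsto_intros cont[OF HC z])
    have "(g \<longlongrightarrow> g 0) (at 0 within {0..<1})"
      unfolding g_def
    proof (intro tendsto_intros cont[OF H1C z] cont[OF H2C z] c\<phi>)
      show "((\<lambda>t. rho (\<phi> t z)) \<longlongrightarrow> rho (\<phi> 0 z)) (at 0 within {0..<1})"
        unfolding rho_def by (intro tendsto_intros c\<phi>)
      show "complex_of_real (rho (\<phi> 0 z)) \<noteq> 0" using rho_pos[OF z] by (simp add: \<phi>0)
    qed
    from has_vector_derivative_linear_factor[OF this, of 0]
    have "((\<lambda>t. 0 + t *\<^sub>R g t) has_vector_derivative g 0) (at 0 within {0..<1})" .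
    moreover have "g 0 = 0"
    proof -
      \<comment> \<open>At time 0, \<open>H1 1 + \<i> * H1 \<i>\<close> is 2 B: the holomorphic part
        A drops out.\<close>
      have "g 0 = of_real ((rho z)\<^sup>2 / 4) * (4 * C z + 2 * cnj z / of_real (rho z) * (4 * B z))"
        unfolding g_def \<phi>0 f2X[OF z] fX[OF z] by (simp add: algebra_simps)
      also have "4 * C z + 2 * cnj z / of_real (rho z) * (4 * B z) =
          4 / of_real (rho z) * (of_real (rho z) * C z + 2 * cnj z * B z)"
        using rho_pos[OF z] by (simp add: field_simps)
      also have "\<dots> = 0" using h[OF z] by simp
      finally show ?thesis by simp
    qed
    ultimately have "((\<lambda>t. 0 + t *\<^sub>R g t) has_vector_derivative 0) (at 0 within {0..<1})" by simp
    then show ?thesis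
      by (rule has_vector_derivative_transform[rotated 2]) (use g in auto)
  qed
  have vel: "((\<lambda>t. \<phi> t z) has_vector_derivative X z) (at 0 within {0..<1})" if z: "z \<in> disc" for z
    using has_vector_derivative_linear_factor[OF cont[OF HC z], of z "{0..<1}"]
    by (simp add: \<phi>_def[abs_def] H_def scaleR_conv_of_real)
  have sm: "smooth_on ({0..<1} \<times> disc) (\<lambda>(t, z). \<phi> t z)"
  proof (rule smooth_on_subset_extension[OF oW])
    have "Ck_on k W (\<lambda>p. snd p + complex_of_real (fst p) * H p)" for k
      by (intro Ck_on_add Ck_on_mult oW HC Ck_on_bounded_linear bounded_linear_snd
          bounded_linear_compose[OF bounded_linear_of_real bounded_linear_fst])
    then show "Ck_on k W (\<lambda>(t, z). \<phi> t z)" for k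
      by (simp add: \<phi>_def case_prod_unfold)
  qed (auto simp: W_def)
  show ?thesis
    unfolding harmonic_field_on_def
  proof (intro conjI exI)
    show "smooth_on disc X" using X smooth_on_open_iff[of disc X] by simp
    show "(0::real) < 1" by simp
    show "smooth_on ({0..<1} \<times> disc) (\<lambda>(t, z). \<phi> t z)" by (rule sm)
    show "\<forall>t\<in>{0..<1}. \<phi> t ` disc \<subseteq> disc" using in_disc by auto
    show "\<forall>z\<in>disc. \<phi> 0 z = z" by (simp add: \<phi>_def)
    show "\<forall>z\<in>disc. ((\<lambda>t. \<phi> t z) has_vector_derivative X z) (at 0 within {0..<1})" using vel by blast
    show "\<forall>z\<in>disc. ((\<lambda>t. tension (\<phi> t) z) has_vector_derivative 0) (at 0 within {0..<1})" using tens by blast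
  qed
qed

lemma potential_field_solves:
  assumes F: "F holomorphic_on disc"
    and q: "\<And>z. z \<in> disc \<Longrightarrow> deriv (deriv (deriv F)) z = q z"
    and C: "\<And>z. z \<in> disc \<Longrightarrow> norm (q z) * (rho z)\<^sup>2 \<le> C"
  shows "solves q (potential_field F)"
  unfolding solves_def
proof (intro conjI ballI)
  note w = potential_field_has_wirtinger[OF F]
  show "harmonic_field_on disc (potential_field F)"
    by (rule harmonic_field_criterion[OF potential_field_Ck[OF F] w
          potential_field_second_derivatives(1)[OF F] potential_field_second_derivatives(2)[OF F]])
       (auto simp: power2_eq_square)
  show "lie_metric_20 (potential_field F) z = q z" if "z \<in> disc" for z
    unfolding lie_metric_20_iff[OF that w[OF that]] using q[OF that] by simp
  show "\<exists>Y. has_L2_extension (potential_field F) Y \<and> tangential Y"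
    by (rule potential_field_boundary(1)[OF F, of C]) (use q C in auto)
qed

section \<open>Iterated primitives on the disc\<close>

lemma holomorphic_primitive_disc:
  assumes "q holomorphic_on disc"
  obtains G where "G holomorphic_on disc" "\<And>z. z \<in> disc \<Longrightarrow> deriv G z = q z"
proof -
  obtain G where G: "\<And>z. z \<in> disc \<Longrightarrow> (G has_field_derivative q z) (at z within disc)"
    using holomorphic_convex_primitive'[of disc q] assms by auto
  then have "\<And>z. z \<in> disc \<Longrightarrow> (G has_field_derivative q z) (at z)"
    by (metis at_within_open open_ball)
  then show ?thesis
    using that[of G] by (metis DERIV_imp_deriv holomorphic_on_open open_ball)
qed

lemma deriv_cong_open:
  fixes f g :: "complex \<Rightarrow> complex"
  assumes "open S" "z \<in> S" "\<And>w. w \<in> S \<Longrightarrow> f w = g w"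
  shows "deriv f z = deriv g z"
  using assms by (intro deriv_cong_ev) (auto simp: eventually_nhds)

lemma holomorphic_third_primitive:
  assumes "q holomorphic_on disc"
  obtains F where "F holomorphic_on disc" "\<And>z. z \<in> disc \<Longrightarrow> deriv (deriv (deriv F)) z = q z"
proof -
  obtain F2 where F2: "F2 holomorphic_on disc" "\<And>z. z \<in> disc \<Longrightarrow> deriv F2 z = q z"
    using holomorphic_primitive_disc[OF assms] by blast
  obtain F1 where F1: "F1 holomorphic_on disc" "\<And>z. z \<in> disc \<Longrightarrow> deriv F1 z = F2 z"
    using holomorphic_primitive_disc[OF F2(1)] by blast
  obtain F where F: "F holomorphic_on disc" "\<And>z. z \<in> disc \<Longrightarrow> deriv F z = F1 z"
    using holomorphic_primitive_disc[OF F1(1)] by blast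
  have 1: "deriv (deriv F) z = F2 z" if "z \<in> disc" for z
    using deriv_cong_open[of disc z "deriv F" F1] F(2) F1(2) that by simp
  have "deriv (deriv (deriv F)) z = q z" if "z \<in> disc" for z
    using deriv_cong_open[of disc z "deriv (deriv F)" F2] 1 F2(2) that by simp
  then show ?thesis using that F(1) by blast
qed

lemma deriv_cmult_disc:
  fixes F :: "complex \<Rightarrow> complex"
  assumes F: "F holomorphic_on disc" and z: "z \<in> disc"
  shows "deriv (\<lambda>w. c * F w) z = c * deriv F z"
    "deriv (deriv (\<lambda>w. c * F w)) z = c * deriv (deriv F) z"
    "deriv (deriv (deriv (\<lambda>w. c * F w))) z = c * deriv (deriv (deriv F)) z"
proof -
  have d: "deriv (\<lambda>w. c * G w) z = c * deriv G z" if "G holomorphic_on disc" "z \<in> disc" for G and z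
    using that by (intro deriv_cmult holomorphic_on_imp_differentiable_at[of G disc]) auto
  have h: "deriv F holomorphic_on disc" "deriv (deriv F) holomorphic_on disc"
    using F by (auto intro!: holomorphic_deriv)
  show "deriv (\<lambda>w. c * F w) z = c * deriv F z" by (rule d[OF F z])
  have 2: "deriv (deriv (\<lambda>w. c * F w)) z = c * deriv (deriv F) z" if "z \<in> disc" for z
    using deriv_cong_open[of disc z "deriv (\<lambda>w. c * F w)" "\<lambda>w. c * deriv F w"] d[OF F] d[OF h(1)] that by simp
  show "deriv (deriv (\<lambda>w. c * F w)) z = c * deriv (deriv F) z" by (rule 2[OF z])
  show "deriv (deriv (deriv (\<lambda>w. c * F w))) z = c * deriv (deriv (deriv F)) z"
    using deriv_cong_open[of disc z "deriv (deriv (\<lambda>w. c * F w))" "\<lambda>w. c * deriv (deriv F) w"] 2 d[OF h(2)] z by simp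
qed


section \<open>Isometries of the disc\<close>

lemma isom_plus_maps_disc: "\<gamma> \<in> isom_plus \<Longrightarrow> z \<in> disc \<Longrightarrow> \<gamma> z \<in> disc"
  by (auto simp: isom_plus_def Bij_def bij_betw_def simp del: mem_ball)

text \<open>Equal length and orthogonality of \<open>L 1\<close> and \<open>L \<i>\<close> are the
  real and imaginary part of a cnj b = 0. Positive determinant excludes a = 0, so b = 0, and the
  scaling |a| is the quotient of the conformal factors.\<close>

lemma isom_plus_derivative:
  assumes g: "\<gamma> \<in> isom_plus" and z: "z \<in> disc"
  shows "\<exists>a. (\<gamma> has_field_derivative a) (at z) \<and> norm a = rho (\<gamma> z) / rho z"
proof -
  have "Ck_on 1 disc \<gamma>" using g smooth_on_open_iff[of disc \<gamma>] by (auto simp: isom_plus_def)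
  then have "\<gamma> differentiable (at z)" using z by simp
  then obtain a b where ab: "has_wirtinger \<gamma> a b z" using differentiable_imp_has_wirtinger by blast
  define L where "L = frechet_derivative \<gamma> (at z)"
  have L: "L v = a * v + b * cnj v" for v
    unfolding L_def using ab unfolding has_wirtinger_def by (rule frechet_derivative_eq)
  have iso: "hyp_metric (\<gamma> z) (L v) (L w) = hyp_metric z v w" and det: "Im (cnj (L 1) * L \<i>) > 0" for v w
    using g z unfolding isom_plus_def L_def by (auto simp: Let_def)
  have r: "rho z > 0" "rho (\<gamma> z) > 0" using rho_pos isom_plus_maps_disc[OF g z] z by auto
  define s where "s = (rho (\<gamma> z) / rho z)\<^sup>2"
  have e: "L v \<bullet> L w = s * (v \<bullet> w)" for v w
    using iso[of v w] r unfolding hyp_metric_rho s_def by (simp add: field_simps power_divide)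
  have "L 1 \<bullet> L 1 = L \<i> \<bullet> L \<i>" "L 1 \<bullet> L \<i> = 0"
    using e[of 1 1] e[of \<i> \<i>] e[of 1 \<i>] by (simp_all add: inner_complex_def)
  then have ab0: "a * cnj b = 0"
    by (simp add: L complex_eq_iff inner_complex_def algebra_simps)
  moreover have "a \<noteq> 0"
  proof
    assume "a = 0"
    then have "Im (cnj (L 1) * L \<i>) = - (norm b)\<^sup>2"
      by (simp add: L cmod_power2) (simp add: power2_eq_square)
    then show False using det by simp
  qed
  ultimately have b: "b = 0" by simp
  have "norm a ^ 2 = s" using e[of 1 1] by (simp add: L b power2_norm_eq_inner)
  then have "norm a = rho (\<gamma> z) / rho z"
    unfolding s_def using r by (simp add: power2_eq_iff_nonneg)
  then show ?thesis using ab unfolding b has_wirtinger_0_iff by blast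
qed

lemma isom_plus_holomorphic: "\<gamma> \<in> isom_plus \<Longrightarrow> \<gamma> holomorphic_on disc"
  using isom_plus_derivative by (subst holomorphic_on_open) blast+

lemma isom_plus_norm_deriv:
  "\<gamma> \<in> isom_plus \<Longrightarrow> z \<in> disc \<Longrightarrow> norm (deriv \<gamma> z) = rho (\<gamma> z) / rho z"
  using isom_plus_derivative DERIV_imp_deriv by blast

lemma isom_plus_deriv_nonzero:
  assumes "\<gamma> \<in> isom_plus" "z \<in> disc"
  shows "deriv \<gamma> z \<noteq> 0"
proof -
  have "norm (deriv \<gamma> z) > 0"
    unfolding isom_plus_norm_deriv[OF assms]
    using rho_pos assms isom_plus_maps_disc[OF assms] by simp
  then show ?thesis by auto
qed

text \<open>Composing with the Moebius map that sends \<open>\<gamma> 0\<close> to 0 gives a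
  self-map of the disc fixing 0. The isometry property gives its derivative at 0 modulus 1, so the
  equality case of the Schwarz lemma makes it a rotation; solving for \<open>\<gamma>\<close> yields
  the formula.\<close>

lemma isom_plus_moebius:
  assumes g: "\<gamma> \<in> isom_plus"
  obtains b c where "norm b < 1" "norm c = 1"
    "\<And>z. z \<in> disc \<Longrightarrow> 1 + cnj b * c * z \<noteq> 0"
    "\<And>z. z \<in> disc \<Longrightarrow> \<gamma> z = (c * z + b) / (1 + cnj b * c * z)"
    "\<And>z. z \<in> disc \<Longrightarrow> deriv \<gamma> z = c * of_real (rho b) / (1 + cnj b * c * z)\<^sup>2"
proof -
  define b where "b = \<gamma> 0"
  have bd: "b \<in> disc" unfolding b_def by (rule isom_plus_maps_disc[OF g]) simp
  then have b: "norm b < 1" by simp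
  have rb: "rho b > 0" by (rule rho_pos[OF bd])
  define f where "f = Moebius_function 0 b \<circ> \<gamma>"
  have f: "f z = (\<gamma> z - b) / (1 - cnj b * \<gamma> z)" for z
    by (simp add: f_def Moebius_function_def)
  have hol: "f holomorphic_on disc"
    unfolding f_def
    by (rule holomorphic_on_compose_gen[OF isom_plus_holomorphic[OF g] Moebius_function_holomorphic[OF b]])
      (use isom_plus_maps_disc[OF g] in blast)
  have f0: "f 0 = 0" by (simp add: f b_def)
  have f1: "norm (f z) < 1" if "norm z < 1" for z
    unfolding f_def comp_def
    by (rule Moebius_function_norm_lt_1[OF b]) (use isom_plus_maps_disc[OF g, of z] that in simp)
  have nb: "1 - cnj b * b = of_real (rho b)" using rho_of_real[of b] by (simp add: mult.commute)
  have "(f has_field_derivative deriv \<gamma> 0 / of_real (rho b)) (at 0)"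
  proof -
    have d: "(\<gamma> has_field_derivative deriv \<gamma> 0) (at 0)"
      by (rule holomorphic_derivI[OF isom_plus_holomorphic[OF g]]) auto
    have nz: "1 - cnj b * \<gamma> 0 \<noteq> 0" using nb rb by (simp add: b_def[symmetric])
    have "((\<lambda>z. (\<gamma> z - b) / (1 - cnj b * \<gamma> z)) has_field_derivative
        ((deriv \<gamma> 0 * (1 - cnj b * \<gamma> 0) - (\<gamma> 0 - b) * (- (cnj b * deriv \<gamma> 0))) / ((1 - cnj b * \<gamma> 0) * (1 - cnj b * \<gamma> 0)))) (at 0)"
      using nz by (auto intro!: derivative_eq_intros d)
    also have "(deriv \<gamma> 0 * (1 - cnj b * \<gamma> 0) - (\<gamma> 0 - b) * (- (cnj b * deriv \<gamma> 0))) / ((1 - cnj b * \<gamma> 0) * (1 - cnj b * \<gamma> 0)) =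
        deriv \<gamma> 0 / of_real (rho b)"
      using nz by (simp add: b_def[symmetric] nb[symmetric])
    also have "(\<lambda>z. (\<gamma> z - b) / (1 - cnj b * \<gamma> z)) = f" using f by auto
    finally show ?thesis .
  qed
  then have "norm (deriv f 0) = norm (deriv \<gamma> 0) / rho b"
    using rb by (simp add: DERIV_imp_deriv norm_divide)
  also have "\<dots> = 1"
    using isom_plus_norm_deriv[OF g, of 0] rb by (simp add: b_def rho_def)
  finally have "\<exists>\<alpha>. (\<forall>z. norm z < 1 \<longrightarrow> f z = \<alpha> * z) \<and> norm \<alpha> = 1"
    using Schwarz_Lemma(3)[OF hol f0 f1, of 0] by simp
  then obtain c where c: "\<And>z. norm z < 1 \<Longrightarrow> f z = c * z" "norm c = 1" by blast
  have nz: "1 + cnj b * c * z \<noteq> 0" if "z \<in> disc" for z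
  proof
    assume "1 + cnj b * c * z = 0"
    then have "cnj b * c * z = - 1" by (simp add: add_eq_0_iff)
    then have "norm (cnj b * c * z) = 1" by simp
    moreover have "norm b * norm z < 1 * 1"
      using b that by (intro mult_strict_mono') auto
    ultimately show False using c(2) by (simp add: norm_mult)
  qed
  have form: "\<gamma> z = (c * z + b) / (1 + cnj b * c * z)" if z: "z \<in> disc" for z
  proof -
    have n: "1 - cnj b * \<gamma> z \<noteq> 0"
    proof
      assume "1 - cnj b * \<gamma> z = 0"
      then have "norm (cnj b * \<gamma> z) = 1" by (simp add: norm_one eq_iff_diff_eq_0[symmetric] flip: eq_iff_diff_eq_0)
      moreover have "norm b * norm (\<gamma> z) < 1 * 1"
        using b isom_plus_maps_disc[OF g z] by (intro mult_strict_mono') auto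
      ultimately show False by (simp add: norm_mult)
    qed
    have "(\<gamma> z - b) / (1 - cnj b * \<gamma> z) = c * z" using c(1)[of z] z f by simp
    then have "\<gamma> z - b = c * z * (1 - cnj b * \<gamma> z)" using n by (simp add: field_simps)
    then have "\<gamma> z * (1 + cnj b * c * z) = c * z + b" by (simp add: algebra_simps)
    then show ?thesis using nz[OF z] by (simp add: field_simps)
  qed
  have "deriv \<gamma> z = c * of_real (rho b) / (1 + cnj b * c * z)\<^sup>2" if z: "z \<in> disc" for z
  proof -
    have "deriv \<gamma> z = deriv (\<lambda>z. (c * z + b) / (1 + cnj b * c * z)) z"
      by (rule deriv_cong_open[OF open_ball z]) (use form in auto)
    also have "\<dots> = c * of_real (rho b) / (1 + cnj b * c * z)\<^sup>2"
      unfolding nb[symmetric] using nz[OF z]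
      by (intro DERIV_imp_deriv) (auto intro!: derivative_eq_intros simp: power2_eq_square algebra_simps)
    finally show ?thesis .
  qed
  then show ?thesis using that[of b c] b c(2) nz form by blast
qed

text \<open>The explicit formula bounds \<gamma>' on the whole disc, and |\<gamma>'| is the ratio of
  \<open>rho\<close> at image and source. Hence \<open>rho\<close> of the image tends to 0 with
  \<open>rho\<close>.\<close>

lemma isom_plus_boundary:
  assumes g: "\<gamma> \<in> isom_plus"
  shows "filterlim \<gamma> at_boundary at_boundary"
proof -
  obtain b c where b: "norm b < 1" and c: "norm c = 1"
    and nz: "\<And>z. z \<in> disc \<Longrightarrow> 1 + cnj b * c * z \<noteq> 0"
    and d: "\<And>z. z \<in> disc \<Longrightarrow> deriv \<gamma> z = c * of_real (rho b) / (1 + cnj b * c * z)\<^sup>2"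
    using isom_plus_moebius[OF g] by metis
  have rb: "rho b > 0" using b rho_pos[of b] by simp
  have le: "rho (\<gamma> z) \<le> rho z * (rho b / (1 - norm b)\<^sup>2)" if z: "z \<in> disc" for z
  proof -
    have "1 - norm b \<le> norm (1 + cnj b * c * z)"
    proof -
      have "norm (cnj b * c * z) \<le> norm b * 1" unfolding norm_mult using z c by (simp add: mult_left_le)
      then show ?thesis using norm_triangle_ineq2[of 1 "- (cnj b * c * z)"] by simp
    qed
    then have "norm (deriv \<gamma> z) \<le> rho b / (1 - norm b)\<^sup>2"
      unfolding d[OF z] norm_divide norm_mult norm_power c norm_of_real using rb b
      by (intro frac_le power_mono) auto
    moreover have "rho (\<gamma> z) = rho z * norm (deriv \<gamma> z)"
      using isom_plus_norm_deriv[OF g z] rho_pos[OF z] by simp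
    ultimately show ?thesis using rho_pos[OF z] by (metis mult_left_mono less_imp_le)
  qed
  have "((\<lambda>z. rho (\<gamma> z)) \<longlongrightarrow> 0) at_boundary"
  proof (rule Lim_null_comparison)
    show "((\<lambda>z. rho z * (rho b / (1 - norm b)\<^sup>2)) \<longlongrightarrow> 0) at_boundary"
      using tendsto_mult_right[OF rho_tendsto_boundary, of "rho b / (1 - norm b)\<^sup>2"] by simp
    show "\<forall>\<^sub>F z in at_boundary. norm (rho (\<gamma> z)) \<le> rho z * (rho b / (1 - norm b)\<^sup>2)"
      using eventually_at_boundary_disc
      by eventually_elim (use le rho_pos[OF isom_plus_maps_disc[OF g]] in force)
  qed
  then have "((\<lambda>z. sqrt (1 - rho (\<gamma> z))) \<longlongrightarrow> sqrt (1 - 0)) at_boundary"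
    by (intro tendsto_intros)
  then have "((\<lambda>z. norm (\<gamma> z)) \<longlongrightarrow> 1) at_boundary" by (simp add: rho_def)
  moreover have "\<forall>\<^sub>F z in at_boundary. norm (\<gamma> z) \<in> {..<1} \<and> norm (\<gamma> z) \<noteq> 1"
    using eventually_at_boundary_disc
    by eventually_elim (use isom_plus_maps_disc[OF g] in force)
  ultimately have "filterlim (\<lambda>z. norm (\<gamma> z)) (at_left 1) at_boundary"
    by (simp add: filterlim_at)
  then show ?thesis by (simp add: filterlim_filtercomap_iff comp_def)
qed

text \<open>The derivative of \<gamma> carries the normal direction at z to the one at \<gamma> z
  only on the circle itself. Inside, the discrepancy is \<open>rho z\<close> times a multiple of the
  full field, which is where the bound on X enters.\<close>

lemma pull_field_vanishing_radial:
  assumes g: "\<gamma> \<in> isom_plus" and v: "(radial X \<longlongrightarrow> 0) at_boundary"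
    and B: "\<And>z. z \<in> disc \<Longrightarrow> norm (X z) \<le> B"
  shows "(radial (pull_field \<gamma> X) \<longlongrightarrow> 0) at_boundary"
proof -
  obtain b c where b: "norm b < 1" and c: "norm c = 1"
    and nz: "\<And>z. z \<in> disc \<Longrightarrow> 1 + cnj b * c * z \<noteq> 0"
    and form: "\<And>z. z \<in> disc \<Longrightarrow> \<gamma> z = (c * z + b) / (1 + cnj b * c * z)"
    and d: "\<And>z. z \<in> disc \<Longrightarrow> deriv \<gamma> z = c * of_real (rho b) / (1 + cnj b * c * z)\<^sup>2"
    using isom_plus_moebius[OF g] by metis
  have rb: "rho b > 0" using b rho_pos[of b] by simp
  have cc: "c * cnj c = 1" using c complex_norm_square[of c] by simp
  have eq: "rho b * radial (pull_field \<gamma> X) z =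
      (norm (1 + cnj b * c * z))\<^sup>2 * radial X (\<gamma> z) - rho z * Re ((1 + cnj b * c * z) * cnj b * X (\<gamma> z))"
    if z: "z \<in> disc" for z
  proof -
    define D where "D = 1 + cnj b * c * z"
    have D: "D \<noteq> 0" using nz[OF z] by (simp add: D_def)
    have c0: "c \<noteq> 0" using c by auto
    have inv: "inverse (deriv \<gamma> z) = cnj c * D\<^sup>2 / of_real (rho b)"
      unfolding d[OF z] D_def[symmetric] using cc c0 D rb by (simp add: field_simps)
    have gD: "cnj (\<gamma> z) * cnj D = cnj c * cnj z + cnj b"
    proof -
      have "\<gamma> z * D = c * z + b"
        using form[OF z] D unfolding D_def[symmetric] by (simp add: field_simps)
      then have "cnj (\<gamma> z * D) = cnj (c * z + b)" by simp
      then show ?thesis by simp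
    qed
    \<comment> \<open>On the circle this is cnj (\<gamma> z D); the defect - cnj b rho inside comes
      from z cnj z = 1 - rho.\<close>
    have "cnj z * D * cnj c = cnj c * cnj z + cnj b * (c * cnj c) * (z * cnj z)"
      by (simp add: D_def algebra_simps)
    also have "\<dots> = cnj c * cnj z + cnj b - cnj b * of_real (rho z)"
      unfolding cc rho_of_real by (simp add: algebra_simps)
    finally have key: "cnj z * D * cnj c = cnj (\<gamma> z) * cnj D - cnj b * of_real (rho z)"
      using gD by simp
    have "of_real (rho b) * (cnj z * pull_field \<gamma> X z) = (cnj z * D * cnj c) * D * X (\<gamma> z)"
      unfolding pull_field_def inv using rb by (simp add: power2_eq_square)
    also have "\<dots> = (D * cnj D) * (cnj (\<gamma> z) * X (\<gamma> z)) - of_real (rho z) * (D * cnj b * X (\<gamma> z))"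
      unfolding key by (simp add: algebra_simps)
    also have "D * cnj D = of_real ((norm D)\<^sup>2)" using complex_norm_square[of D] by simp
    finally have "Re (of_real (rho b) * (cnj z * pull_field \<gamma> X z)) =
        Re (of_real ((norm D)\<^sup>2) * (cnj (\<gamma> z) * X (\<gamma> z)) - of_real (rho z) * (D * cnj b * X (\<gamma> z)))"
      by simp
    moreover have "Re (of_real r * x) = r * Re x" for r x by simp
    ultimately show ?thesis unfolding radial_def D_def minus_complex.sel by metis
  qed
  show ?thesis
  proof (rule Lim_null_comparison)
    have v': "((\<lambda>z. radial X (\<gamma> z)) \<longlongrightarrow> 0) at_boundary"
      by (rule filterlim_compose[OF v isom_plus_boundary[OF g]])
    have "((\<lambda>z. (4 * norm (radial X (\<gamma> z)) + rho z * (2 * B)) / rho b) \<longlongrightarrow> (4 * norm (0::real) + 0 * (2 * B)) / rho b) at_boundary"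
      using rb by (intro tendsto_intros rho_tendsto_boundary v') auto
    then show "((\<lambda>z. (4 * norm (radial X (\<gamma> z)) + rho z * (2 * B)) / rho b) \<longlongrightarrow> 0) at_boundary" by simp
    show "\<forall>\<^sub>F z in at_boundary. norm (radial (pull_field \<gamma> X) z) \<le> (4 * norm (radial X (\<gamma> z)) + rho z * (2 * B)) / rho b"
      using eventually_at_boundary_disc
    proof eventually_elim
      case z: (elim z)
      define D where "D = 1 + cnj b * c * z"
      have "norm (cnj b * c * z) \<le> 1 * 1 * 1"
        unfolding norm_mult using b c z by (intro mult_mono) auto
      then have D: "norm D \<le> 2" using norm_triangle_ineq[of 1 "cnj b * c * z"] by (simp add: D_def)
      have X: "norm (X (\<gamma> z)) \<le> B" by (rule B[OF isom_plus_maps_disc[OF g z]])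
      have B0: "B \<ge> 0" using X norm_ge_zero order_trans by blast
      have "\<bar>(norm D)\<^sup>2 * radial X (\<gamma> z)\<bar> \<le> 4 * norm (radial X (\<gamma> z))"
        using power_mono[OF D, of 2] by (simp add: abs_mult mult_right_mono)
      moreover have "\<bar>rho z * Re (D * cnj b * X (\<gamma> z))\<bar> \<le> rho z * (2 * B)"
      proof -
        have "norm (D * cnj b * X (\<gamma> z)) \<le> 2 * 1 * B"
          unfolding norm_mult using D b X by (intro mult_mono) auto
        then have "\<bar>Re (D * cnj b * X (\<gamma> z))\<bar> \<le> 2 * B"
          using abs_Re_le_cmod[of "D * cnj b * X (\<gamma> z)"] by linarith
        then show ?thesis using rho_pos[OF z] by (simp only: abs_mult) (simp add: mult_left_mono)
      qed
      ultimately have "\<bar>rho b * radial (pull_field \<gamma> X) z\<bar> \<le> 4 * norm (radial X (\<gamma> z)) + rho z * (2 * B)"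
        unfolding eq[OF z] D_def[symmetric] by (intro order_trans[OF abs_triangle_ineq4] add_mono)
      then show ?case using rb by (simp add: abs_mult field_simps)
    qed
  qed
qed

text \<open>The weight is holomorphic, so the cnj z derivative only picks up the factor cnj
  \<gamma>' / \<gamma>'.\<close>

lemma pull_field_has_wirtinger:
  assumes g: "\<gamma> \<in> isom_plus" and z: "z \<in> disc" and X: "has_wirtinger X A B (\<gamma> z)"
  shows "\<exists>a. has_wirtinger (pull_field \<gamma> X) a (B * cnj (deriv \<gamma> z) * inverse (deriv \<gamma> z)) z"
proof -
  have hol: "\<gamma> holomorphic_on disc" by (rule isom_plus_holomorphic[OF g])
  have 1: "(\<gamma> has_field_derivative deriv \<gamma> z) (at z)"
    by (rule holomorphic_derivI[OF hol open_ball z])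
  have "(\<lambda>z. inverse (deriv \<gamma> z)) holomorphic_on disc"
    using isom_plus_deriv_nonzero[OF g] by (intro holomorphic_intros holomorphic_deriv hol) auto
  from has_wirtinger_mult[OF has_wirtinger_compose_holomorphic[OF 1 X] has_wirtinger_holomorphic[OF this open_ball z]]
  show ?thesis unfolding pull_field_def[abs_def] by auto
qed

section \<open>Invariant functions\<close>

lemma subgroup_isom_plusD:
  assumes "subgroup \<Gamma> isom_plus_group"
  shows "\<Gamma> \<subseteq> isom_plus" "(\<lambda>z\<in>disc. z) \<in> \<Gamma>"
    "\<And>g h. g \<in> \<Gamma> \<Longrightarrow> h \<in> \<Gamma> \<Longrightarrow> g \<otimes>\<^bsub>isom_plus_group\<^esub> h \<in> \<Gamma>"
    "\<And>g h z. g \<in> \<Gamma> \<Longrightarrow> h \<in> \<Gamma> \<Longrightarrow> z \<in> disc \<Longrightarrow> (g \<otimes>\<^bsub>isom_plus_group\<^esub> h) z = g (h z)"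
proof -
  show 1: "\<Gamma> \<subseteq> isom_plus" using subgroup.subset[OF assms] by (simp add: isom_plus_group_def)
  show "(\<lambda>z\<in>disc. z) \<in> \<Gamma>"
    using subgroup.one_closed[OF assms] by (simp add: isom_plus_group_def BijGroup_def)
  show "\<And>g h. g \<in> \<Gamma> \<Longrightarrow> h \<in> \<Gamma> \<Longrightarrow> g \<otimes>\<^bsub>isom_plus_group\<^esub> h \<in> \<Gamma>"
    using subgroup.m_closed[OF assms] by blast
  show "(g \<otimes>\<^bsub>isom_plus_group\<^esub> h) z = g (h z)" if "g \<in> \<Gamma>" "h \<in> \<Gamma>" "z \<in> disc" for g h z
  proof -
    have "g \<in> Bij disc" "h \<in> Bij disc" using 1 that by (auto simp: isom_plus_def)
    then show ?thesis using that(3) by (simp add: isom_plus_group_def BijGroup_def compose_def)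
  qed
qed

text \<open>The sublevel sets u < n are invariant, hence preimages of open subsets of the orbit
  space. These cover it, and compactness leaves finitely many; no fundamental domain has to be
  constructed.\<close>

lemma cocompact_invariant_bounded:
  fixes u :: "complex \<Rightarrow> real"
  assumes G: "subgroup \<Gamma> isom_plus_group" and co: "cocompact \<Gamma>"
    and c: "continuous_on disc u"
    and inv: "\<And>\<gamma> z. \<gamma> \<in> \<Gamma> \<Longrightarrow> z \<in> disc \<Longrightarrow> u (\<gamma> z) = u z"
  obtains C where "\<And>z. z \<in> disc \<Longrightarrow> u z \<le> C"
proof -
  define U where "U n = orbit_of \<Gamma> ` {z \<in> disc. u z < real n}" for n
  have pre: "{z \<in> disc. orbit_of \<Gamma> z \<in> U n} = {z \<in> disc. u z < real n}" for n
  proof (intro equalityI subsetI)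
    fix z assume "z \<in> {z \<in> disc. orbit_of \<Gamma> z \<in> U n}"
    then obtain w where z: "z \<in> disc" and w: "w \<in> disc" "u w < real n" "orbit_of \<Gamma> z = orbit_of \<Gamma> w"
      unfolding U_def by blast
    \<comment> \<open>The identity element puts z into its own orbit, so equality of orbits places z
      in the orbit of w.\<close>
    have "(\<lambda>z\<in>disc. z) z \<in> orbit_of \<Gamma> z"
      unfolding orbit_of_def using subgroup_isom_plusD(2)[OF G] by blast
    then have "z \<in> orbit_of \<Gamma> w" using z w(3) by (metis restrict_apply')
    then obtain \<gamma> where "\<gamma> \<in> \<Gamma>" "z = \<gamma> w" unfolding orbit_of_def by blast
    then have "u z = u w" using inv w(1) by blast
    then show "z \<in> {z \<in> disc. u z < real n}" using z w(2) by simp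
  qed (auto simp: U_def)
  have "openin (orbit_space \<Gamma>) (U n)" for n
    unfolding openin_orbit_space pre
  proof
    show "U n \<subseteq> orbit_of \<Gamma> ` disc" unfolding U_def by blast
    have "openin (top_of_set disc) (disc \<inter> u -` {..<real n})"
      by (rule continuous_openin_preimage_gen[OF c]) simp
    also have "disc \<inter> u -` {..<real n} = {z \<in> disc. u z < real n}" by auto
    finally show "openin (top_of_set disc) {z \<in> disc. u z < real n}" .
  qed
  then have 1: "\<forall>V\<in>range U. openin (orbit_space \<Gamma>) V" by blast
  have sub: "topspace (orbit_space \<Gamma>) \<subseteq> orbit_of \<Gamma> ` disc"
    unfolding topspace_def openin_orbit_space by blast
  have top: "orbit_of \<Gamma> ` disc \<subseteq> topspace (orbit_space \<Gamma>)"
  proof -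
    have "{z \<in> disc. orbit_of \<Gamma> z \<in> orbit_of \<Gamma> ` disc} = disc" by blast
    then have "openin (orbit_space \<Gamma>) (orbit_of \<Gamma> ` disc)"
      unfolding openin_orbit_space by simp
    then show ?thesis by (rule openin_subset)
  qed
  have 2: "topspace (orbit_space \<Gamma>) \<subseteq> \<Union> (range U)"
  proof
    fix O' assume "O' \<in> topspace (orbit_space \<Gamma>)"
    then obtain z where z: "z \<in> disc" "O' = orbit_of \<Gamma> z" using sub by blast
    obtain n :: nat where "u z < real n" using reals_Archimedean2 by blast
    then have "O' \<in> U n" unfolding U_def using z by blast
    then show "O' \<in> \<Union> (range U)" by blast
  qed
  have "compactin (orbit_space \<Gamma>) (topspace (orbit_space \<Gamma>))"
    using co by (simp add: cocompact_def compact_space_def)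
  then obtain \<F> where F: "finite \<F>" "\<F> \<subseteq> range U" "topspace (orbit_space \<Gamma>) \<subseteq> \<Union> \<F>"
    unfolding compactin_def using 1 2 by meson
  then obtain N where N: "finite N" "\<F> = U ` N" using finite_subset_image by metis
  \<comment> \<open>Inserting 0 keeps \<open>Max\<close> meaningful even for an empty index
    set.\<close>
  show ?thesis
  proof (rule that[of "real (Max (insert 0 N))"])
    fix z assume z: "z \<in> disc"
    then have "orbit_of \<Gamma> z \<in> \<Union> \<F>" using top F(3) by blast
    then obtain n where n: "n \<in> N" "orbit_of \<Gamma> z \<in> U n" unfolding N(2) by blast
    then have "u z < real n" using pre[of n] z by blast
    moreover have "n \<le> Max (insert 0 N)" using n(1) N(1) by simp
    ultimately show "u z \<le> real (Max (insert 0 N))"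
      by (meson less_imp_le of_nat_le_iff order_trans)
  qed
qed

text \<open>Up to a constant, |q| rho^2 is the pointwise hyperbolic norm of q, so isometries that
  preserve q preserve it.\<close>

lemma HQD_bounded:
  assumes G: "subgroup \<Gamma> isom_plus_group" and co: "cocompact \<Gamma>" and q: "q \<in> HQD \<Gamma>"
  obtains C where "\<And>z. z \<in> disc \<Longrightarrow> norm (q z) * (rho z)\<^sup>2 \<le> C"
proof -
  have qh: "q holomorphic_on disc" and qi: "\<And>\<gamma> z. \<gamma> \<in> \<Gamma> \<Longrightarrow> z \<in> disc \<Longrightarrow> q (\<gamma> z) * (deriv \<gamma> z)\<^sup>2 = q z"
    using q unfolding HQD_def by blast+
  have "norm (q (\<gamma> z)) * (rho (\<gamma> z))\<^sup>2 = norm (q z) * (rho z)\<^sup>2" if g: "\<gamma> \<in> \<Gamma>" and z: "z \<in> disc" for \<gamma> z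
  proof -
    have gi: "\<gamma> \<in> isom_plus" using subgroup_isom_plusD(1)[OF G] g by blast
    have "norm (q z) = norm (q (\<gamma> z)) * (rho (\<gamma> z) / rho z)\<^sup>2"
      unfolding isom_plus_norm_deriv[OF gi z, symmetric] norm_power[symmetric] norm_mult[symmetric] qi[OF g z] ..
    then show ?thesis using rho_pos[OF z] by (simp add: power_divide)
  qed
  moreover have "continuous_on disc (\<lambda>z. norm (q z) * (rho z)\<^sup>2)"
    unfolding rho_def by (intro continuous_intros holomorphic_on_imp_continuous_on qh)
  ultimately show ?thesis
    using cocompact_invariant_bounded[OF G co, of "\<lambda>z. norm (q z) * (rho z)\<^sup>2"] that by blast
qed


section \<open>Solutions and their coboundaries\<close>

lemma killing_polynomial_holomorphic:
  assumes "killing_polynomial X"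
  shows "X holomorphic_on disc"
proof -
  obtain a b where "\<And>z. z \<in> disc \<Longrightarrow> X z = a + \<i> * complex_of_real b * z - cnj a * z\<^sup>2"
    using assms unfolding killing_polynomial_def by auto
  moreover have "(\<lambda>z. a + \<i> * complex_of_real b * z - cnj a * z\<^sup>2) holomorphic_on disc"
    by (intro holomorphic_intros)
  ultimately show ?thesis by (metis (no_types, lifting) holomorphic_transform)
qed

text \<open>The rotation part i b z is tangential to every circle about 0, and in the rest the two
  terms combine to a factor \<open>rho\<close>.\<close>

lemma killing_polynomial_vanishing_radial:
  assumes "killing_polynomial X"
  shows "(radial X \<longlongrightarrow> 0) at_boundary"
proof -
  obtain a b where ab: "\<And>z. z \<in> disc \<Longrightarrow> X z = a + \<i> * complex_of_real b * z - cnj a * z\<^sup>2"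
    using assms unfolding killing_polynomial_def by auto
  have r: "radial X z = rho z * Re (cnj a * z)" if "z \<in> disc" for z
    unfolding radial_def ab[OF that] rho_def cmod_power2
    by (simp add: power2_eq_square algebra_simps)
  show ?thesis
  proof (rule Lim_null_comparison)
    show "((\<lambda>z. rho z * norm a) \<longlongrightarrow> 0) at_boundary"
      using tendsto_mult_right[OF rho_tendsto_boundary, of "norm a"] by simp
    show "\<forall>\<^sub>F z in at_boundary. norm (radial X z) \<le> rho z * norm a"
      using eventually_at_boundary_disc
    proof eventually_elim
      case z: (elim z)
      have "norm (cnj a * z) \<le> norm a * 1" unfolding norm_mult using z by (intro mult_mono) auto
      then have "\<bar>Re (cnj a * z)\<bar> \<le> norm a" using abs_Re_le_cmod[of "cnj a * z"] by linarith
      then show ?case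
        unfolding r[OF z] using rho_pos[OF z] by (simp only: real_norm_def abs_mult) (simp add: mult_left_mono)
    qed
  qed
qed

lemma killing_polynomial_bounded:
  assumes "killing_polynomial X"
  shows "\<exists>B. \<forall>z\<in>disc. norm (X z) \<le> B"
proof -
  obtain a b where ab: "\<And>z. z \<in> disc \<Longrightarrow> X z = a + \<i> * complex_of_real b * z - cnj a * z\<^sup>2"
    using assms unfolding killing_polynomial_def by auto
  have "norm (X z) \<le> (norm a + \<bar>b\<bar> * 1) + norm a * 1" if z: "z \<in> disc" for z
    unfolding ab[OF z] using z
    by (intro order_trans[OF norm_triangle_ineq4] add_mono order_trans[OF norm_triangle_ineq])
       (auto simp: norm_mult norm_power power_le_one intro!: mult_left_le)
  then show ?thesis by blast
qed

lemma killing_polynomial_cong: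
  "(\<And>z. z \<in> disc \<Longrightarrow> X z = Y z) \<Longrightarrow> killing_polynomial X \<longleftrightarrow> killing_polynomial Y"
  unfolding killing_polynomial_def by simp

lemma killing_polynomial_zero: "killing_polynomial (\<lambda>z. 0)"
  unfolding killing_polynomial_def by (intro exI[of _ 0]) simp

lemma killing_polynomial_add:
  assumes "killing_polynomial X" "killing_polynomial Y"
  shows "killing_polynomial (\<lambda>z. X z + Y z)"
proof -
  obtain a b c d where h:
    "\<And>z. z \<in> disc \<Longrightarrow> X z = a + \<i> * complex_of_real b * z - cnj a * z\<^sup>2"
    "\<And>z. z \<in> disc \<Longrightarrow> Y z = c + \<i> * complex_of_real d * z - cnj c * z\<^sup>2"
    using assms unfolding killing_polynomial_def by auto
  have "X z + Y z = (a + c) + \<i> * complex_of_real (b + d) * z - cnj (a + c) * z\<^sup>2" if "z \<in> disc" for z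
    unfolding h(1)[OF that] h(2)[OF that] by (simp add: algebra_simps)
  then show ?thesis unfolding killing_polynomial_def by blast
qed

lemma killing_polynomial_minus:
  assumes "killing_polynomial X"
  shows "killing_polynomial (\<lambda>z. - X z)"
proof -
  obtain a b where h: "\<And>z. z \<in> disc \<Longrightarrow> X z = a + \<i> * complex_of_real b * z - cnj a * z\<^sup>2"
    using assms unfolding killing_polynomial_def by auto
  have "- X z = - a + \<i> * complex_of_real (- b) * z - cnj (- a) * z\<^sup>2" if "z \<in> disc" for z
    unfolding h[OF that] by (simp add: algebra_simps)
  then show ?thesis unfolding killing_polynomial_def by blast
qed

lemma restrict_killing: "killing_polynomial X \<Longrightarrow> restrict X disc \<in> killing"
  unfolding killing_iff using killing_polynomial_cong[of "restrict X disc" X] by simp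

lemma has_wirtinger_0_imp_holomorphic:
  assumes "\<And>z. z \<in> disc \<Longrightarrow> \<exists>a. has_wirtinger X a 0 z"
  shows "X holomorphic_on disc"
  using assms unfolding has_wirtinger_0_iff by (subst holomorphic_on_open) blast+

lemma solves_has_wirtinger:
  assumes s: "solves q X" and z: "z \<in> disc"
  shows "\<exists>a. has_wirtinger X a (of_real ((rho z)\<^sup>2) * cnj (q z) / 8) z"
proof -
  have "Ck_on 1 disc X"
    using s smooth_on_open_iff[of disc X] unfolding solves_def harmonic_field_on_def by blast
  then have "X differentiable (at z)" using z by simp
  then obtain a b where ab: "has_wirtinger X a b z" using differentiable_imp_has_wirtinger by blast
  moreover have "lie_metric_20 X z = q z" using s z by (simp add: solves_def)
  ultimately show ?thesis using lie_metric_20_iff[OF z ab, of "q z"] by metis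
qed

lemma solves_continuous: "solves q X \<Longrightarrow> continuous_on disc X"
  using solves_has_wirtinger by (intro has_wirtinger_imp_continuous_on) blast

lemma solves_L2_tangential: "solves q X \<Longrightarrow> L2_tangential X"
  unfolding solves_def using L2_extension_imp_L2_tangential by blast

text \<open>Equal (2,0)-parts mean equal cnj z derivatives, so the difference is holomorphic and the
  Fourier argument applies to it in the L2 class.\<close>

lemma solves_unique:
  assumes X: "solves q X" and Y: "solves q Y"
  shows "killing_polynomial (\<lambda>z. X z - Y z)"
proof -
  have "\<exists>a. has_wirtinger (\<lambda>z. X z - Y z) a 0 z" if z: "z \<in> disc" for z
    using solves_has_wirtinger[OF X z] solves_has_wirtinger[OF Y z] has_wirtinger_diff by fastforce
  then have "(\<lambda>z. X z - Y z) holomorphic_on disc" by (rule has_wirtinger_0_imp_holomorphic)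
  from holomorphic_L2_tangential_quadratic[OF this
      L2_tangential_diff[OF solves_continuous[OF X] solves_L2_tangential[OF X]
        solves_continuous[OF Y] solves_L2_tangential[OF Y]]]
  show ?thesis unfolding killing_polynomial_def by metis
qed

text \<open>Stated for a growth bound instead of a group, so that it serves the difference of two
  invariant differentials directly.\<close>

lemma bounded_differential_solvable:
  assumes "q holomorphic_on disc" "\<forall>z\<in>disc. norm (q z) * (rho z)\<^sup>2 \<le> C"
  shows "\<exists>F. F holomorphic_on disc \<and> (\<forall>z\<in>disc. deriv (deriv (deriv F)) z = q z) \<and>
    solves q (potential_field F) \<and> (radial (potential_field F) \<longlongrightarrow> 0) at_boundary \<and>
    (\<exists>B. \<forall>z\<in>disc. norm (potential_field F z) \<le> B)"
proof -
  obtain F where F: "F holomorphic_on disc" "\<And>z. z \<in> disc \<Longrightarrow> deriv (deriv (deriv F)) z = q z"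
    using holomorphic_third_primitive[OF assms(1)] by blast
  have C: "norm (deriv (deriv (deriv F)) z) * (rho z)\<^sup>2 \<le> C" if "z \<in> disc" for z
    using assms(2) F(2) that by auto
  show ?thesis
    using assms(2)
    by (intro exI[of _ F] conjI ballI F potential_field_solves[OF F, of C]
          potential_field_boundary(2)[OF F(1) C] potential_field_boundary(3)[OF F(1) C])
      (assumption | erule (1) bspec)+
qed

text \<open>By definition a solution is controlled only in the mean on circles. It differs from the
  potential field by a Killing polynomial, and this upgrades the control to the pointwise bounds
  that survive pulling back.\<close>

lemma solves_boundary:
  assumes q: "q holomorphic_on disc" "\<forall>z\<in>disc. norm (q z) * (rho z)\<^sup>2 \<le> C"
    and X: "solves q X"
  shows "(radial X \<longlongrightarrow> 0) at_boundary" "\<exists>B. \<forall>z\<in>disc. norm (X z) \<le> B"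
proof -
  obtain F where F: "solves q (potential_field F)" "(radial (potential_field F) \<longlongrightarrow> 0) at_boundary"
    "\<exists>B. \<forall>z\<in>disc. norm (potential_field F z) \<le> B"
    using bounded_differential_solvable[OF q] by blast
  define K where "K z = X z - potential_field F z" for z
  have K: "killing_polynomial K" unfolding K_def by (rule solves_unique[OF X F(1)])
  have "((\<lambda>z. radial (potential_field F) z + radial K z) \<longlongrightarrow> 0 + 0) at_boundary"
    by (intro tendsto_add F(2) killing_polynomial_vanishing_radial K)
  moreover have "radial (potential_field F) z + radial K z = radial X z" for z
    by (simp add: radial_def K_def algebra_simps)
  ultimately show "(radial X \<longlongrightarrow> 0) at_boundary" by simp
  obtain B B' where B: "\<And>z. z \<in> disc \<Longrightarrow> norm (potential_field F z) \<le> B" "\<And>z. z \<in> disc \<Longrightarrow> norm (K z) \<le> B'"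
    using F(3) killing_polynomial_bounded[OF K] by blast
  have "norm (X z) \<le> B + B'" if "z \<in> disc" for z
    using norm_triangle_ineq[of "potential_field F z" "K z"] B[OF that] by (simp add: K_def)
  then show "\<exists>B. \<forall>z\<in>disc. norm (X z) \<le> B" by blast
qed

text \<open>Invariance of q makes X and its pullback have the same cnj z derivative, so their
  difference is holomorphic. Its radial part vanishes at the boundary because that of X does and X
  is bounded.\<close>

lemma solves_pull_field_killing:
  assumes G: "subgroup \<Gamma> isom_plus_group" and co: "cocompact \<Gamma>" and q: "q \<in> HQD \<Gamma>"
    and X: "solves q X" and g: "\<gamma> \<in> \<Gamma>"
  shows "killing_polynomial (\<lambda>z. pull_field \<gamma> X z - X z)"
proof -
  have gi: "\<gamma> \<in> isom_plus" using subgroup_isom_plusD(1)[OF G] g by blast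
  have qh: "q holomorphic_on disc" using q unfolding HQD_def by blast
  obtain C where C: "\<forall>z\<in>disc. norm (q z) * (rho z)\<^sup>2 \<le> C"
    using HQD_bounded[OF G co q] by metis
  note bd = solves_boundary[OF qh C X]
  obtain B where B: "\<And>z. z \<in> disc \<Longrightarrow> norm (X z) \<le> B" using bd(2) by blast
  have "\<exists>a. has_wirtinger (\<lambda>z. pull_field \<gamma> X z - X z) a 0 z" if z: "z \<in> disc" for z
  proof -
    define d where "d = deriv \<gamma> z"
    have d0: "d \<noteq> 0" unfolding d_def by (rule isom_plus_deriv_nonzero[OF gi z])
    have qi: "q (\<gamma> z) * d\<^sup>2 = q z" using q g z unfolding HQD_def d_def by blast
    have "rho (\<gamma> z) = rho z * norm d"
      using isom_plus_norm_deriv[OF gi z] rho_pos[OF z] by (simp add: d_def)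
    then have "complex_of_real ((rho (\<gamma> z))\<^sup>2) = of_real ((rho z)\<^sup>2) * of_real ((norm d)\<^sup>2)"
      by (simp add: power_mult_distrib)
    also have "complex_of_real ((norm d)\<^sup>2) = d * cnj d" by (rule complex_norm_square)
    \<comment> \<open>The factor \<gamma>' cnj \<gamma>' from rho^2 and the factor cnj \<gamma>' /
      \<gamma>' from the pullback combine to the conjugate of \<gamma>'^2, the weight in the
      invariance of q.\<close>
    finally have "of_real ((rho (\<gamma> z))\<^sup>2) * cnj (q (\<gamma> z)) / 8 * cnj d * inverse d =
        of_real ((rho z)\<^sup>2) * cnj (q z) / 8"
      unfolding qi[symmetric] using d0 by (simp add: power2_eq_square)
    moreover obtain a where "has_wirtinger X a (of_real ((rho (\<gamma> z))\<^sup>2) * cnj (q (\<gamma> z)) / 8) (\<gamma> z)"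
      using solves_has_wirtinger[OF X isom_plus_maps_disc[OF gi z]] by blast
    ultimately obtain a' where "has_wirtinger (pull_field \<gamma> X) a' (of_real ((rho z)\<^sup>2) * cnj (q z) / 8) z"
      using pull_field_has_wirtinger[OF gi z] unfolding d_def by metis
    then show ?thesis using solves_has_wirtinger[OF X z] has_wirtinger_diff by fastforce
  qed
  then have "(\<lambda>z. pull_field \<gamma> X z - X z) holomorphic_on disc" by (rule has_wirtinger_0_imp_holomorphic)
  moreover have "(radial (\<lambda>z. pull_field \<gamma> X z - X z) \<longlongrightarrow> 0) at_boundary"
  proof -
    have "((\<lambda>z. radial (pull_field \<gamma> X) z - radial X z) \<longlongrightarrow> 0 - 0) at_boundary"
      by (intro tendsto_diff bd(1) pull_field_vanishing_radial[OF gi bd(1) B])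
    moreover have "radial (pull_field \<gamma> X) z - radial X z = radial (\<lambda>z. pull_field \<gamma> X z - X z) z" for z
      by (simp add: radial_def algebra_simps)
    ultimately show ?thesis by simp
  qed
  ultimately show ?thesis by (rule holomorphic_vanishing_radial_killing)
qed

lemma pull_field_mult:
  assumes G: "subgroup \<Gamma> isom_plus_group" and g: "g \<in> \<Gamma>" "h \<in> \<Gamma>" and z: "z \<in> disc"
  shows "pull_field (g \<otimes>\<^bsub>isom_plus_group\<^esub> h) X z = pull_field h (pull_field g X) z"
proof -
  have gi: "g \<in> isom_plus" "h \<in> isom_plus" using subgroup_isom_plusD(1)[OF G] g by auto
  have m: "(g \<otimes>\<^bsub>isom_plus_group\<^esub> h) w = g (h w)" if "w \<in> disc" for w
    by (rule subgroup_isom_plusD(4)[OF G g that])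
  have "deriv (g \<otimes>\<^bsub>isom_plus_group\<^esub> h) z = deriv (g \<circ> h) z"
    by (rule deriv_cong_open[OF open_ball z]) (simp add: m)
  also have "\<dots> = deriv g (h z) * deriv h z"
    using isom_plus_holomorphic[OF gi(1)] isom_plus_holomorphic[OF gi(2)] z isom_plus_maps_disc[OF gi(2) z]
    by (intro deriv_chain) (auto simp: holomorphic_on_imp_differentiable_at[of _ disc])
  finally show ?thesis unfolding pull_field_def m[OF z] by simp
qed

lemma coboundary_apply:
  "\<gamma> \<in> \<Gamma> \<Longrightarrow> z \<in> disc \<Longrightarrow> coboundary \<Gamma> X \<gamma> z = pull_field \<gamma> X z - X z"
  by (simp add: coboundary_def)

text \<open>Killing fields are extensional, so a witness has to be cut off at the disc. Isometries
  preserve the disc, hence the coboundary does not notice.\<close>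

lemma coboundary_restrict:
  assumes "\<Gamma> \<subseteq> isom_plus" "\<gamma> \<in> \<Gamma>" "z \<in> disc"
  shows "coboundary \<Gamma> (restrict X disc) \<gamma> z = coboundary \<Gamma> X \<gamma> z"
  using assms isom_plus_maps_disc[of \<gamma> z] by (auto simp: coboundary_apply pull_field_def)

text \<open>Once the values are known to be Killing, the cocycle rule is formal: the pullback is
  contravariant in the group and the terms telescope.\<close>

lemma coboundary_solves_cocycle:
  assumes G: "subgroup \<Gamma> isom_plus_group" and co: "cocompact \<Gamma>" and q: "q \<in> HQD \<Gamma>"
    and X: "solves q X"
  shows "coboundary \<Gamma> X \<in> cocycles \<Gamma>"
  unfolding cocycles_def
proof (intro CollectI conjI ballI)
  show "coboundary \<Gamma> X \<in> \<Gamma> \<rightarrow>\<^sub>E killing"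
  proof (rule PiE_I)
    fix \<gamma> assume g: "\<gamma> \<in> \<Gamma>"
    then show "coboundary \<Gamma> X \<gamma> \<in> killing"
      using restrict_killing[OF solves_pull_field_killing[OF G co q X g]] by (simp add: coboundary_def)
  qed (simp add: coboundary_def)
  fix g h z assume g: "g \<in> \<Gamma>" "h \<in> \<Gamma>" and z: "z \<in> disc"
  have hz: "h z \<in> disc" using isom_plus_maps_disc[of h z] subgroup_isom_plusD(1)[OF G] g z by blast
  have gh: "g \<otimes>\<^bsub>isom_plus_group\<^esub> h \<in> \<Gamma>" by (rule subgroup_isom_plusD(3)[OF G g])
  have "pull_field h (coboundary \<Gamma> X g) z = pull_field h (pull_field g X) z - pull_field h X z"
    unfolding pull_field_def[of h] coboundary_apply[OF g(1) hz] by (simp add: algebra_simps)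
  then show "coboundary \<Gamma> X (g \<otimes>\<^bsub>isom_plus_group\<^esub> h) z =
      pull_field h (coboundary \<Gamma> X g) z + coboundary \<Gamma> X h z"
    unfolding coboundary_apply[OF gh z] coboundary_apply[OF g(2) z] pull_field_mult[OF G g z] by simp
qed

section \<open>Cohomology classes\<close>

lemma equiv_cohomologous:
  assumes G: "\<Gamma> \<subseteq> isom_plus"
  shows "equiv (cocycles \<Gamma>) (cohomologous \<Gamma>)"
proof (rule equivI)
  have kp: "killing_polynomial K" if "K \<in> killing" for K using that killing_iff by blast
  have I: "(c, c') \<in> cohomologous \<Gamma>" if "c \<in> cocycles \<Gamma>" "c' \<in> cocycles \<Gamma>" "killing_polynomial K"
    "\<And>\<gamma> z. \<gamma> \<in> \<Gamma> \<Longrightarrow> z \<in> disc \<Longrightarrow> c \<gamma> z - c' \<gamma> z = coboundary \<Gamma> K \<gamma> z" for c c' K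
    unfolding cohomologous_def using that restrict_killing[of K] coboundary_restrict[OF G, of _ _ K]
    by (auto intro!: bexI[of _ "restrict K disc"] simp del: mem_ball)
  have E: "\<exists>K. c \<in> cocycles \<Gamma> \<and> c' \<in> cocycles \<Gamma> \<and> killing_polynomial K \<and>
      (\<forall>\<gamma>\<in>\<Gamma>. \<forall>z\<in>disc. c \<gamma> z - c' \<gamma> z = coboundary \<Gamma> K \<gamma> z)" if "(c, c') \<in> cohomologous \<Gamma>" for c c'
    using that kp unfolding cohomologous_def by blast
  show "cohomologous \<Gamma> \<subseteq> cocycles \<Gamma> \<times> cocycles \<Gamma>" unfolding cohomologous_def by blast
  show "refl_on (cocycles \<Gamma>) (cohomologous \<Gamma>)"
  proof (rule refl_onI)
    fix c assume "c \<in> cocycles \<Gamma>"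
    then show "(c, c) \<in> cohomologous \<Gamma>"
      by (intro I[OF _ _ killing_polynomial_zero]) (simp_all add: coboundary_apply pull_field_def)
  qed
  show "sym (cohomologous \<Gamma>)"
  proof (rule symI)
    fix c c' assume "(c, c') \<in> cohomologous \<Gamma>"
    then obtain K where K: "c \<in> cocycles \<Gamma>" "c' \<in> cocycles \<Gamma>" "killing_polynomial K"
      "\<forall>\<gamma>\<in>\<Gamma>. \<forall>z\<in>disc. c \<gamma> z - c' \<gamma> z = coboundary \<Gamma> K \<gamma> z" using E by blast
    show "(c', c) \<in> cohomologous \<Gamma>"
    proof (rule I[OF K(2,1) killing_polynomial_minus[OF K(3)]])
      fix \<gamma> z assume "\<gamma> \<in> \<Gamma>" "z \<in> disc"
      then have "c \<gamma> z - c' \<gamma> z = pull_field \<gamma> K z - K z" using K(4) coboundary_apply by metis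
      then show "c' \<gamma> z - c \<gamma> z = coboundary \<Gamma> (\<lambda>z. - K z) \<gamma> z"
        unfolding coboundary_apply[OF \<open>\<gamma> \<in> \<Gamma>\<close> \<open>z \<in> disc\<close>] by (simp add: pull_field_def algebra_simps)
    qed
  qed
  show "trans (cohomologous \<Gamma>)"
  proof (rule transI)
    fix c c' c'' assume 1: "(c, c') \<in> cohomologous \<Gamma>" and 2: "(c', c'') \<in> cohomologous \<Gamma>"
    obtain K where K: "c \<in> cocycles \<Gamma>" "killing_polynomial K"
      "\<forall>\<gamma>\<in>\<Gamma>. \<forall>z\<in>disc. c \<gamma> z - c' \<gamma> z = coboundary \<Gamma> K \<gamma> z" using E[OF 1] by blast
    obtain L where L: "c'' \<in> cocycles \<Gamma>" "killing_polynomial L"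
      "\<forall>\<gamma>\<in>\<Gamma>. \<forall>z\<in>disc. c' \<gamma> z - c'' \<gamma> z = coboundary \<Gamma> L \<gamma> z" using E[OF 2] by blast
    show "(c, c'') \<in> cohomologous \<Gamma>"
    proof (rule I[OF K(1) L(1) killing_polynomial_add[OF K(2) L(2)]])
      fix \<gamma> z assume g: "\<gamma> \<in> \<Gamma>" "z \<in> disc"
      have "c \<gamma> z - c'' \<gamma> z = (c \<gamma> z - c' \<gamma> z) + (c' \<gamma> z - c'' \<gamma> z)" by simp
      also have "\<dots> = coboundary \<Gamma> K \<gamma> z + coboundary \<Gamma> L \<gamma> z"
        using K(3)[rule_format, OF g] L(3)[rule_format, OF g] by (rule arg_cong2)
      also have "\<dots> = coboundary \<Gamma> (\<lambda>z. K z + L z) \<gamma> z"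
        unfolding coboundary_apply[OF g] by (simp add: pull_field_def algebra_simps)
      finally show "c \<gamma> z - c'' \<gamma> z = coboundary \<Gamma> (\<lambda>z. K z + L z) \<gamma> z" .
    qed
  qed
qed

text \<open>The difference of the two solutions is itself the Killing field that links the cocycles,
  so the class does not depend on the solution chosen.\<close>

lemma solves_cohomologous:
  assumes G: "subgroup \<Gamma> isom_plus_group" and co: "cocompact \<Gamma>" and q: "q \<in> HQD \<Gamma>"
    and X: "solves q X" and Y: "solves q Y"
  shows "(coboundary \<Gamma> X, coboundary \<Gamma> Y) \<in> cohomologous \<Gamma>"
proof -
  define K where "K = restrict (\<lambda>z. X z - Y z) disc"
  have K: "K \<in> killing" unfolding K_def by (rule restrict_killing[OF solves_unique[OF X Y]])
  have "coboundary \<Gamma> X \<gamma> z - coboundary \<Gamma> Y \<gamma> z = coboundary \<Gamma> K \<gamma> z" if "\<gamma> \<in> \<Gamma>" "z \<in> disc" for \<gamma> z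
    unfolding K_def coboundary_restrict[OF subgroup_isom_plusD(1)[OF G] that]
    unfolding coboundary_apply[OF that] by (simp add: pull_field_def algebra_simps)
  then show ?thesis
    unfolding cohomologous_def
    using K coboundary_solves_cocycle[OF G co q X] coboundary_solves_cocycle[OF G co q Y] by blast
qed

section \<open>Injectivity\<close>

lemma quadratic_third_derivative:
  fixes F :: "complex \<Rightarrow> complex"
  assumes F: "\<And>z. z \<in> disc \<Longrightarrow> F z = a + b * z + c * z\<^sup>2" and z: "z \<in> disc"
  shows "deriv (deriv (deriv F)) z = 0"
proof -
  have 1: "deriv F z = b + c * (2 * z)" if "z \<in> disc" for z
  proof -
    have "deriv F z = deriv (\<lambda>z. a + b * z + c * z\<^sup>2) z"
      by (rule deriv_cong_open[OF open_ball that F])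
    also have "\<dots> = b + c * (2 * z)"
      by (rule DERIV_imp_deriv) (auto intro!: derivative_eq_intros)
    finally show ?thesis .
  qed
  have 2: "deriv (deriv F) z = c * 2" if "z \<in> disc" for z
  proof -
    have "deriv (deriv F) z = deriv (\<lambda>z. b + c * (2 * z)) z"
      by (rule deriv_cong_open[OF open_ball that 1])
    also have "\<dots> = c * 2"
      by (rule DERIV_imp_deriv) (auto intro!: derivative_eq_intros)
    finally show ?thesis .
  qed
  have "deriv (deriv (deriv F)) z = deriv (\<lambda>z. c * 2) z"
    by (rule deriv_cong_open[OF open_ball z 2])
  then show ?thesis by simp
qed

text \<open>
  An invariant field is \<open>O(rho)\<close>, so both \<open>X\<close> and \<open>\<i> X\<close> have vanishing radial part and
  hence agree with potential fields up to Killing fields; as \<open>F \<mapsto> potential_field F\<close> is only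
  real linear, comparing the two expressions isolates \<open>F\<close>.
\<close>

lemma invariant_field_differential_zero:
  assumes G: "subgroup \<Gamma> isom_plus_group" and co: "cocompact \<Gamma>"
    and q: "q holomorphic_on disc" "\<forall>z\<in>disc. norm (q z) * (rho z)\<^sup>2 \<le> C"
    and X: "\<And>z. z \<in> disc \<Longrightarrow> \<exists>a. has_wirtinger X a (of_real ((rho z)\<^sup>2) * cnj (q z) / 8) z"
    and inv: "\<And>\<gamma> z. \<gamma> \<in> \<Gamma> \<Longrightarrow> z \<in> disc \<Longrightarrow> pull_field \<gamma> X z = X z"
    and z: "z \<in> disc"
  shows "q z = 0"
proof -
  have cX: "continuous_on disc X" using X by (intro has_wirtinger_imp_continuous_on) blast
  \<comment> \<open>|X| / rho is half the hyperbolic length of X, so it is invariant along with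
    X.\<close>
  have "norm (X (\<gamma> z)) / rho (\<gamma> z) = norm (X z) / rho z" if g: "\<gamma> \<in> \<Gamma>" and z: "z \<in> disc" for \<gamma> z
  proof -
    have gi: "\<gamma> \<in> isom_plus" using subgroup_isom_plusD(1)[OF G] g by blast
    have "norm (X z) = norm (X (\<gamma> z)) * inverse (rho (\<gamma> z) / rho z)"
      unfolding isom_plus_norm_deriv[OF gi z, symmetric] norm_inverse[symmetric] norm_mult[symmetric]
      using inv[OF g z] by (simp add: pull_field_def)
    then show ?thesis
      using rho_pos[OF z] rho_pos[OF isom_plus_maps_disc[OF gi z]] by (simp add: field_simps)
  qed
  moreover have "continuous_on disc (\<lambda>z. norm (X z) / rho z)"
  proof (intro continuous_intros cX)
    show "continuous_on disc rho" unfolding rho_def[abs_def] by (intro continuous_intros)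
    show "\<forall>z\<in>disc. rho z \<noteq> 0" using rho_pos by (metis less_irrefl)
  qed
  ultimately obtain M where "\<And>z. z \<in> disc \<Longrightarrow> norm (X z) / rho z \<le> M"
    using cocompact_invariant_bounded[OF G co, of "\<lambda>z. norm (X z) / rho z"] by blast
  then have M: "norm (X z) \<le> rho z * M" if "z \<in> disc" for z
    using rho_pos[OF that] that by (metis pos_divide_le_eq mult.commute)
  have rad: "(radial (\<lambda>z. c * X z) \<longlongrightarrow> 0) at_boundary" if "norm c = 1" for c
  proof (rule Lim_null_comparison)
    show "((\<lambda>z. rho z * M) \<longlongrightarrow> 0) at_boundary"
      using tendsto_mult_right[OF rho_tendsto_boundary, of M] by simp
    show "\<forall>\<^sub>F z in at_boundary. norm (radial (\<lambda>z. c * X z) z) \<le> rho z * M"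
      using eventually_at_boundary_disc
    proof eventually_elim
      case z: (elim z)
      have "norm (cnj z * (c * X z)) \<le> 1 * (1 * norm (X z))"
        unfolding norm_mult using z that by (intro mult_mono) auto
      then show ?case
        using abs_Re_le_cmod[of "cnj z * (c * X z)"] M[OF z] unfolding radial_def real_norm_def by linarith
    qed
  qed
  \<comment> \<open>Multiplying X by c multiplies its cnj z derivative by c, hence q by cnj c, since
    q enters conjugated. The cases used are c = 1 and c = \<open>\<i>\<close>.\<close>
  have diff: "killing_polynomial (\<lambda>z. c * X z - Y z)"
    if c: "norm c = 1" and Y: "solves (\<lambda>z. cnj c * q z) Y" "(radial Y \<longlongrightarrow> 0) at_boundary" for c Y
  proof (rule holomorphic_vanishing_radial_killing)
    have "\<exists>a. has_wirtinger (\<lambda>z. c * X z - Y z) a 0 z" if z: "z \<in> disc" for z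
    proof -
      obtain a where a: "has_wirtinger X a (of_real ((rho z)\<^sup>2) * cnj (q z) / 8) z" using X[OF z] by blast
      obtain a' where "has_wirtinger Y a' (of_real ((rho z)\<^sup>2) * cnj (cnj c * q z) / 8) z"
        using solves_has_wirtinger[OF Y(1) z] by blast
      from has_wirtinger_diff[OF has_wirtinger_mult[OF has_wirtinger_const[of c] a] this]
      show ?thesis by (auto simp: mult.left_commute)
    qed
    then show "(\<lambda>z. c * X z - Y z) holomorphic_on disc" by (rule has_wirtinger_0_imp_holomorphic)
    have "((\<lambda>z. radial (\<lambda>z. c * X z) z - radial Y z) \<longlongrightarrow> 0 - 0) at_boundary"
      by (intro tendsto_diff rad[OF c] Y(2))
    moreover have "radial (\<lambda>z. c * X z) z - radial Y z = radial (\<lambda>z. c * X z - Y z) z" for z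
      by (simp add: radial_def algebra_simps)
    ultimately show "(radial (\<lambda>z. c * X z - Y z) \<longlongrightarrow> 0) at_boundary" by simp
  qed
  obtain F where F: "F holomorphic_on disc" "\<forall>z\<in>disc. deriv (deriv (deriv F)) z = q z"
    "solves q (potential_field F)" "(radial (potential_field F) \<longlongrightarrow> 0) at_boundary"
    using bounded_differential_solvable[OF q] by blast
  \<comment> \<open>The third derivative of this potential is \<open>- \<i> * q\<close>, the
    differential that belongs to \<open>\<i> * X\<close>.\<close>
  define E where "E z = - \<i> * F z" for z
  have E: "E holomorphic_on disc" unfolding E_def by (intro holomorphic_intros F)
  note dE = deriv_cmult_disc[OF F(1), of _ "- \<i>", folded E_def]
  have E3: "deriv (deriv (deriv E)) z = cnj \<i> * q z" if "z \<in> disc" for z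
    using dE(3)[OF that] F(2) that by simp
  have Eb: "norm (cnj \<i> * q z) * (rho z)\<^sup>2 \<le> C" if "z \<in> disc" for z
    using q(2) that by (simp add: norm_mult)
  have "killing_polynomial (\<lambda>z. 1 * X z - potential_field F z)"
    using F(3,4) by (intro diff) simp_all
  then obtain a b where 1: "\<And>z. z \<in> disc \<Longrightarrow> X z - potential_field F z = a + \<i> * complex_of_real b * z - cnj a * z\<^sup>2"
    unfolding killing_polynomial_def by auto
  have "killing_polynomial (\<lambda>z. \<i> * X z - potential_field E z)"
  proof (rule diff)
    show "solves (\<lambda>z. cnj \<i> * q z) (potential_field E)"
      by (rule potential_field_solves[OF E E3 Eb])
    show "(radial (potential_field E) \<longlongrightarrow> 0) at_boundary"
      by (rule potential_field_boundary(2)[OF E, of C]) (use E3 Eb in simp)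
  qed simp
  then obtain c d where 2: "\<And>z. z \<in> disc \<Longrightarrow> \<i> * X z - potential_field E z = c + \<i> * complex_of_real d * z - cnj c * z\<^sup>2"
    unfolding killing_polynomial_def by auto
  have "F z = (2 * a + 2 * \<i> * c) + (2 * \<i> * b - 2 * d) * z + (- 2 * cnj a - 2 * \<i> * cnj c) * z\<^sup>2"
    if z: "z \<in> disc" for z
  proof -
    \<comment> \<open>The terms conjugate linear in F cancel, while the two copies of the complex
      linear term -2 F add up.\<close>
    have "potential_field E z - \<i> * potential_field F z = \<i> * F z / 2"
      unfolding potential_field_def dE(1,2)[OF z] E_def
      by (simp add: field_simps)
    then have "\<i> * F z = 2 * (\<i> * (X z - potential_field F z) - (\<i> * X z - potential_field E z))"
      by (simp add: algebra_simps)
    then have "F z = 2 * ((X z - potential_field F z) + \<i> * (\<i> * X z - potential_field E z))"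
      by (simp add: complex_eq_iff)
    then show ?thesis unfolding 1[OF z] 2[OF z] by (simp add: algebra_simps)
  qed
  from quadratic_third_derivative[OF this z] show ?thesis using F(2) z by simp
qed

section \<open>The map to cohomology\<close>

lemma Phi_eq:
  assumes G: "subgroup \<Gamma> isom_plus_group" and co: "cocompact \<Gamma>" and q: "q \<in> HQD \<Gamma>"
    and X: "solves q X"
  shows "Phi \<Gamma> q = cohomology_class \<Gamma> (coboundary \<Gamma> X)"
proof -
  have "solves q (SOME X. solves q X)" by (rule someI[of "solves q", OF X])
  from solves_cohomologous[OF G co q this X]
  show ?thesis
    unfolding Phi_def cohomology_class_def
    by (rule equiv_class_eq[OF equiv_cohomologous[OF subgroup_isom_plusD(1)[OF G]]])
qed

lemma HQD_solvable:
  assumes G: "subgroup \<Gamma> isom_plus_group" and co: "cocompact \<Gamma>" and q: "q \<in> HQD \<Gamma>"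
  shows "\<exists>X. solves q X"
proof -
  have qh: "q holomorphic_on disc" using q unfolding HQD_def by blast
  obtain C where C: "\<forall>z\<in>disc. norm (q z) * (rho z)\<^sup>2 \<le> C"
    using HQD_bounded[OF G co q] by metis
  show ?thesis using bounded_differential_solvable[OF qh C] by (elim exE conjE) (rule exI)
qed

text \<open>If K links the two cocycles, X - Y - K is fixed by all pullbacks. It still carries the
  differential q - q', since K is holomorphic.\<close>

lemma cohomologous_solutions_eq:
  assumes G: "subgroup \<Gamma> isom_plus_group" and co: "cocompact \<Gamma>"
    and q: "q \<in> HQD \<Gamma>" and q': "q' \<in> HQD \<Gamma>" and X: "solves q X" and Y: "solves q' Y"
    and coh: "(coboundary \<Gamma> X, coboundary \<Gamma> Y) \<in> cohomologous \<Gamma>"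
  shows "q = q'"
proof -
  obtain K where K: "K \<in> killing"
    "\<And>\<gamma> z. \<gamma> \<in> \<Gamma> \<Longrightarrow> z \<in> disc \<Longrightarrow> coboundary \<Gamma> X \<gamma> z - coboundary \<Gamma> Y \<gamma> z = coboundary \<Gamma> K \<gamma> z"
    using coh unfolding cohomologous_def by blast
  have Kh: "K holomorphic_on disc" using K(1) killing_iff killing_polynomial_holomorphic by blast
  have qh: "q holomorphic_on disc" "q' holomorphic_on disc" using q q' unfolding HQD_def by blast+
  obtain C where C: "\<forall>z\<in>disc. norm (q z) * (rho z)\<^sup>2 \<le> C"
    using HQD_bounded[OF G co q] by metis
  obtain C' where C': "\<And>z. z \<in> disc \<Longrightarrow> norm (q' z) * (rho z)\<^sup>2 \<le> C'"
    using HQD_bounded[OF G co q'] by blast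
  have zero: "q z - q' z = 0" if z: "z \<in> disc" for z
  proof (rule invariant_field_differential_zero[OF G co _ _ _ _ z])
    show "(\<lambda>z. q z - q' z) holomorphic_on disc" by (intro holomorphic_intros qh)
    show "\<forall>z\<in>disc. norm (q z - q' z) * (rho z)\<^sup>2 \<le> C + C'"
    proof
      fix z assume that: "z \<in> disc"
      have "norm (q z - q' z) * (rho z)\<^sup>2 \<le> (norm (q z) + norm (q' z)) * (rho z)\<^sup>2"
        by (intro mult_right_mono norm_triangle_ineq4) simp
      also have "\<dots> \<le> C + C'" unfolding distrib_right using C C'[OF that] that by (intro add_mono) auto
      finally show "norm (q z - q' z) * (rho z)\<^sup>2 \<le> C + C'" .
    qed
    show "\<exists>a. has_wirtinger (\<lambda>z. X z - Y z - K z) a (of_real ((rho z)\<^sup>2) * cnj (q z - q' z) / 8) z" if z: "z \<in> disc" for z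
    proof -
      obtain a where a: "has_wirtinger X a (of_real ((rho z)\<^sup>2) * cnj (q z) / 8) z"
        using solves_has_wirtinger[OF X z] by blast
      obtain a' where a': "has_wirtinger Y a' (of_real ((rho z)\<^sup>2) * cnj (q' z) / 8) z"
        using solves_has_wirtinger[OF Y z] by blast
      from has_wirtinger_diff[OF has_wirtinger_diff[OF a a'] has_wirtinger_holomorphic[OF Kh open_ball z]]
      show ?thesis by (auto simp: right_diff_distrib diff_divide_distrib)
    qed
    show "pull_field \<gamma> (\<lambda>z. X z - Y z - K z) z = X z - Y z - K z" if "\<gamma> \<in> \<Gamma>" "z \<in> disc" for \<gamma> z
    proof -
      have e: "pull_field \<gamma> (\<lambda>z. X z - Y z - K z) z = pull_field \<gamma> X z - pull_field \<gamma> Y z - pull_field \<gamma> K z"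
        by (simp add: pull_field_def left_diff_distrib)
      show ?thesis
        unfolding e using K(2)[OF that] unfolding coboundary_apply[OF that] by (simp add: algebra_simps)
    qed
  qed
  show ?thesis
  proof (rule extensionalityI[of _ disc])
    show "q \<in> extensional disc" "q' \<in> extensional disc" using q q' unfolding HQD_def by blast+
    show "q z = q' z" if "z \<in> disc" for z using zero[OF that] by simp
  qed
qed

text \<open>\<open>Phi\<close> picks a solution by \<open>SOME\<close>. The first conjunct therefore
  records that a solution exists and that every solution gives a cocycle in the class
  \<open>Phi \<Gamma> q\<close>, so that injectivity concerns the intended map.\<close>

theorem corollary2:
  fixes \<Gamma> :: "(complex \<Rightarrow> complex) set"
  assumes "subgroup \<Gamma> isom_plus_group"
    and "discrete_subset \<Gamma>"
    and "cocompact \<Gamma>"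
  shows "(\<forall>q\<in>HQD \<Gamma>. (\<exists>\<xi>. solves q \<xi>) \<and>
            (\<forall>\<xi>. solves q \<xi> \<longrightarrow> coboundary \<Gamma> \<xi> \<in> cocycles \<Gamma> \<and>
                               Phi \<Gamma> q = cohomology_class \<Gamma> (coboundary \<Gamma> \<xi>)))
    \<and> Phi \<Gamma> \<in> HQD \<Gamma> \<rightarrow> H1 \<Gamma>
    \<and> inj_on (Phi \<Gamma>) (HQD \<Gamma>)"
proof (intro conjI ballI allI impI)
  note G = assms(1) and co = assms(3)
  show "\<exists>\<xi>. solves q \<xi>" if "q \<in> HQD \<Gamma>" for q
    by (rule HQD_solvable[OF G co that])
  show "coboundary \<Gamma> \<xi> \<in> cocycles \<Gamma>" if "q \<in> HQD \<Gamma>" "solves q \<xi>" for q \<xi>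
    by (rule coboundary_solves_cocycle[OF G co that])
  show "Phi \<Gamma> q = cohomology_class \<Gamma> (coboundary \<Gamma> \<xi>)" if "q \<in> HQD \<Gamma>" "solves q \<xi>" for q \<xi>
    by (rule Phi_eq[OF G co that])
  show "Phi \<Gamma> \<in> HQD \<Gamma> \<rightarrow> H1 \<Gamma>"
  proof (rule funcsetI)
    fix q assume q: "q \<in> HQD \<Gamma>"
    then obtain X where X: "solves q X" using HQD_solvable[OF G co] by blast
    show "Phi \<Gamma> q \<in> H1 \<Gamma>"
      unfolding Phi_eq[OF G co q X] cohomology_class_def H1_def
      by (rule quotientI[OF coboundary_solves_cocycle[OF G co q X]])
  qed
  show "inj_on (Phi \<Gamma>) (HQD \<Gamma>)"
  proof (rule inj_onI)
    fix q q' assume q: "q \<in> HQD \<Gamma>" "q' \<in> HQD \<Gamma>" and eq: "Phi \<Gamma> q = Phi \<Gamma> q'"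
    obtain X Y where X: "solves q X" and Y: "solves q' Y" using HQD_solvable[OF G co] q by blast
    have "(coboundary \<Gamma> X, coboundary \<Gamma> Y) \<in> cohomologous \<Gamma>"
      using eq unfolding Phi_eq[OF G co q(1) X] Phi_eq[OF G co q(2) Y] cohomology_class_def
      by (rule eq_equiv_class[OF _ equiv_cohomologous[OF subgroup_isom_plusD(1)[OF G]]
            coboundary_solves_cocycle[OF G co q(2) Y]])
    then show "q = q'" by (rule cohomologous_solutions_eq[OF G co q X Y])
  qed
qed

end
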